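(* Fix integers $2\le r\le k$ with $r\ge 3$ or $k\ge 4$. There is a constant $c=c(k,r)>0$ such that every $k$-uniform hypergraph with $m$ edges has an $r$-cut with excess at least $c\,m^{5/9}$.
   Context: For $2\le r\le k$, an $r$-cut of a $k$-uniform hypergraph $H$ is a partition of $V(H)$ into $r$ labelled parts; its size is the number of edges that have a vertex in every part. The excess of an $r$-cut of an $m$-edge $k$-uniform hypergraph is its size minus $\frac{S(k,r)r!}{r^k}m$, where $S(k,r)$ is the Stirling number of the second kind (the number of partitions of $\{1,\dots,k\}$ into $r$ nonempty unlabelled sets); $\frac{S(k,r)r!}{r^k}m$ is the expected size of a uniformly random $r$-cut. *)

theory Defs
  imports Complex_Main "HOL-Combinatorics.Stirling" "HOL-Library.Disjoint_Sets"
begin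

definition uniform_hypergraph :: "nat \<Rightarrow> 'a set \<Rightarrow> 'a set set \<Rightarrow> bool" where
  "uniform_hypergraph k V E \<longleftrightarrow> finite V \<and> (\<forall>e\<in>E. e \<subseteq> V \<and> card e = k)"

(* The labels are 0,...,r-1.  Parts may be empty, as in a uniformly random r-cut, where
   each vertex is put independently into one of the r parts. *)
definition is_cut :: "nat \<Rightarrow> 'a set \<Rightarrow> (nat \<Rightarrow> 'a set) \<Rightarrow> bool" where
  "is_cut r V P \<longleftrightarrow> disjoint_family_on P {..<r} \<and> (\<Union>i<r. P i) = V"

definition cut_size :: "nat \<Rightarrow> 'a set set \<Rightarrow> (nat \<Rightarrow> 'a set) \<Rightarrow> nat" where
  "cut_size r E P = card {e \<in> E. \<forall>i<r. e \<inter> P i \<noteq> {}}"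

definition excess :: "nat \<Rightarrow> nat \<Rightarrow> 'a set set \<Rightarrow> (nat \<Rightarrow> 'a set) \<Rightarrow> real" where
  "excess k r E P =
     real (cut_size r E P) - real (Stirling k r) * fact r / real r ^ k * real (card E)"

end

theory Submission
  imports Defs "HOL-Analysis.Convex"
begin

text \<open>
  Colour every vertex \<open>v\<close> with a small bias \<open>s v \<in> [-1, 1]\<close> in favour of colour \<open>0\<close>. The expected
  excess is then a polynomial \<open>f(s)\<close>, the sum over all edges \<open>e\<close> and all nonempty \<open>S \<subseteq> e\<close> of
  \<open>c(|S|)\<close> times the product of \<open>s\<close> over \<open>S\<close>; here \<open>c(2) < 0\<close>, and \<open>c(l) \<noteq> 0\<close> for \<open>l = 3\<close> (if \<open>r \<ge> 3\<close>)
  or \<open>l = 4\<close> (if \<open>r = 2\<close>, \<open>k \<ge> 4\<close>). Let \<open>q = m\<^sup>1\<^sup>/\<^sup>9\<close> and suppose \<open>f \<le> \<tau> = \<delta> q\<^sup>5\<close> on \<open>[-1, 1]\<^sup>V\<close>.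

  Opposite random signs on the pairs of a greedy maximum-codegree matching exploit \<open>c(2)\<close> and give
  weights \<open>z\<close> of total \<open>O(\<tau>)\<close> with \<open>codeg u v \<le> max (z u) (z v)\<close>. Hence few edges have two heavy vertices
  (\<open>z > q\<close>), and light vertices have degree at most \<open>q\<^sup>6\<close>. Random signs on the heavy vertices, answered
  by the light ones according to their codegrees, show that few edges contain a pair of codegree above \<open>q\<^sup>2\<close>.

  On the remaining edges choose a set \<open>Y\<close> of light vertices, random signs off \<open>Y\<close>, and let each vertex
  of \<open>Y\<close> answer with \<open>\<epsilon> q\<^sup>-\<^sup>4\<close> times the sum of the monomials of degree \<open>l - 1\<close> in its link. The terms with
  one vertex in \<open>Y\<close> gain about \<open>\<epsilon> q\<^sup>5\<close>. Those with two lose \<open>O(\<epsilon>\<^sup>2 q\<^sup>5)\<close> since all codegrees involved are at most \<open>q\<^sup>2\<close>;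
  those with four or more lose \<open>O(\<epsilon>\<^sup>4 q\<^sup>5)\<close> by hypercontractivity, which also makes answers outside
  \<open>[-1, 1]\<close> negligible; those with three vanish after a random rescaling of all answers. A small \<open>\<epsilon>\<close> contradicts \<open>f \<le> \<tau>\<close>.
\<close>

section \<open>The expected excess of a biased random cut\<close>

text \<open>The exponent 5/9 comes from a balance. Ignore constants and let tau bound the
  polynomial. Total weight tau leaves at most tau / t vertices heavier than t and tau^2 / t edges
  with two of them, so t is set to tau^2 / m. Light vertices then have degree at most tau t = tau^3
  / m, and the answers of light to heavy vertices allow the codegree threshold tau^4 / m^2. The
  final answers, of scale eta, gain eta m, which reaches tau for eta = tau / m. At this scale both
  losses, eta^2 m (tau^4 / m^2)^2 for two answers and m (eta^2 tau^3 / m)^2 for four, equal tau^10 /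
  m^5. This stays below tau up to tau = m^(5/9).

  The final step wants a nonzero coefficient of degree at least 3. Two answers correlate only if
  their links do; when the links have at least two vertices, every such coincidence costs two
  codegree factors, hence the square above. Equal one-vertex links would merely give two edges with
  a common vertex. The conditions on k and r provide such a coefficient.\<close>

lemma sum_Pow_card:
  fixes g :: "nat \<Rightarrow> real"
  assumes "finite A"
  shows "(\<Sum>I\<in>Pow A. g (card I)) = (\<Sum>i\<le>card A. real (card A choose i) * g i)"
proof -
  have "(\<Sum>I\<in>Pow A. g (card I)) = (\<Sum>i\<le>card A. \<Sum>I\<in>{I \<in> Pow A. card I = i}. g (card I))"
    using assms by (intro sum.group[symmetric]) (auto intro: card_mono)
  also have "\<dots> = (\<Sum>i\<le>card A. real (card A choose i) * g i)"
  proof (rule sum.cong[OF refl])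
    fix i
    have "(\<Sum>I\<in>{I \<in> Pow A. card I = i}. g (card I)) = (\<Sum>I\<in>{I \<in> Pow A. card I = i}. g i)"
      by (rule sum.cong) auto
    then show "(\<Sum>I\<in>{I \<in> Pow A. card I = i}. g (card I)) = real (card A choose i) * g i"
      using n_subsets[OF assms, of i] by simp
  qed
  finally show ?thesis .
qed

lemma sum_Pow_minus_one:
  fixes A :: "'b set"
  assumes "finite A"
  shows "(\<Sum>I\<in>Pow A. (-1::real) ^ card I) = (if A = {} then 1 else 0)"
proof -
  have "(\<Sum>I\<in>Pow A. (-1::real) ^ card I) = (\<Prod>i\<in>A. (-1) + 1)"
    using prod_add[OF assms, of "\<lambda>_. -1::real" "\<lambda>_. 1"] by simp
  then show ?thesis using assms by (simp add: power_0_left)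
qed

text \<open>The number of surjections from an a-set onto an n-set, by inclusion-exclusion over the
  set of missed values.\<close>

definition surj_count :: "nat \<Rightarrow> nat \<Rightarrow> real" where
  "surj_count a n = (\<Sum>i\<le>n. (-1) ^ i * real (n choose i) * real (n - i) ^ a)"

text \<open>Choose the image of the last element: the remaining elements either already hit every
  value or miss exactly this one. In the alternating sum this is absorption of the factor n - i
  followed by Pascal's rule.\<close>

lemma surj_count_rec:
  assumes "n > 0"
  shows "surj_count (Suc a) n = real n * (surj_count a n + surj_count a (n - 1))"
proof -
  obtain p where n: "n = Suc p" using assms gr0_conv_Suc by auto
  have absorb: "real (n choose i) * real (n - i) = real n * real (p choose i)" for i
  proof (cases "i \<le> p")
    case True
    have "(n - i) * (n choose i) = n * (p choose i)"
      using binomial_absorb_comp[of n i] n by simp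
    then show ?thesis by (metis mult.commute of_nat_mult)
  next
    case False
    then show ?thesis using n by (cases "i = n") auto
  qed
  have "surj_count (Suc a) n = (\<Sum>i\<le>n. real n * ((-1) ^ i * real (p choose i) * real (n - i) ^ a))"
    unfolding surj_count_def
  proof (rule sum.cong[OF refl])
    fix i
    have "(-1) ^ i * real (n choose i) * real (n - i) ^ Suc a
        = (-1) ^ i * (real (n choose i) * real (n - i)) * real (n - i) ^ a" by simp
    then show "(-1) ^ i * real (n choose i) * real (n - i) ^ Suc a
        = real n * ((-1) ^ i * real (p choose i) * real (n - i) ^ a)"
      unfolding absorb by simp
  qed
  also have "\<dots> = real n * (\<Sum>i\<le>n. (-1) ^ i * real (p choose i) * real (n - i) ^ a)"
    by (simp add: sum_distrib_left)
  also have "(\<Sum>i\<le>n. (-1) ^ i * real (p choose i) * real (n - i) ^ a)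
      = surj_count a n + surj_count a p"
  proof -
    have 1: "surj_count a n = real n ^ a
        + (\<Sum>i\<le>p. (-1) ^ Suc i * real (n choose Suc i) * real (n - Suc i) ^ a)"
      unfolding surj_count_def n by (subst sum.atMost_Suc_shift) simp
    have 2: "(\<Sum>i\<le>n. (-1) ^ i * real (p choose i) * real (n - i) ^ a) = real n ^ a
        + (\<Sum>i\<le>p. (-1) ^ Suc i * real (p choose Suc i) * real (n - Suc i) ^ a)"
      unfolding n by (subst sum.atMost_Suc_shift) simp
    have "(\<Sum>i\<le>p. (-1) ^ Suc i * real (p choose Suc i) * real (n - Suc i) ^ a) =
      (\<Sum>i\<le>p. (-1) ^ Suc i * real (n choose Suc i) * real (n - Suc i) ^ a) + surj_count a p"
      unfolding surj_count_def sum.distrib[symmetric]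
      by (rule sum.cong) (auto simp: n algebra_simps)
    then show ?thesis unfolding 1 2 by simp
  qed
  finally show ?thesis using n by simp
qed

lemma surj_count_Stirling: "surj_count a n = fact n * real (Stirling a n)"
proof (induction a arbitrary: n)
  case 0
  have "surj_count 0 n = (\<Sum>i\<le>n. (-1) ^ i * real (n choose i))"
    unfolding surj_count_def by simp
  also have "\<dots> = (if n = 0 then 1 else 0)"
    using choose_alternating_sum[of n, where ?'a = real] by (auto simp: mult.commute)
  finally show ?case by (cases n) auto
next
  case (Suc a)
  show ?case
  proof (cases n)
    case 0
    then show ?thesis by (simp add: surj_count_def)
  next
    case (Suc p)
    then show ?thesis
      using surj_count_rec[of n a] Suc.IH by (simp add: algebra_simps)
  qed
qed

lemma surj_count_nonneg: "surj_count a n \<ge> 0"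
  by (simp add: surj_count_Stirling)

lemma Stirling_pos: "0 < n \<Longrightarrow> n \<le> a \<Longrightarrow> Stirling a n > 0"
proof (induction a arbitrary: n)
  case (Suc a)
  then show ?case by (cases n; cases "n = 1"; cases "n = Suc a") (auto simp: Suc_le_eq)
qed auto

lemma surj_count_pos: "0 < n \<Longrightarrow> n \<le> a \<Longrightarrow> surj_count a n > 0"
  using Stirling_pos by (simp add: surj_count_Stirling)

text \<open>The colour of \<open>v\<close> is \<open>0\<close> with probability \<open>1/r + (r - 1) s v / r\<^sup>2\<close> and each other colour with
  probability \<open>1/r - s v / r\<^sup>2\<close>; \<open>bias r I\<close> is the coefficient of \<open>s v\<close> in the probability that
  the colour lies in \<open>I\<close>.\<close>

definition bias :: "nat \<Rightarrow> nat set \<Rightarrow> real" where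
  "bias r I = (if 0 \<in> I then real r - real (card I) else - real (card I)) / real r ^ 2"

text \<open>Inclusion-exclusion over the set I of colours that an edge misses. A vertex avoids I
  with probability 1 - |I|/r - \<open>bias r I\<close> s v; multiplying this over the k vertices of
  an edge, a monomial in j of the variables receives this coefficient.\<close>

definition bias_coeff :: "nat \<Rightarrow> nat \<Rightarrow> nat \<Rightarrow> real" where
  "bias_coeff k r j = (\<Sum>I\<in>Pow {..<r}. (-1) ^ card I * (- bias r I) ^ j *
     (1 - real (card I) / real r) ^ (k - j))"

text \<open>The sets I are split according to whether they contain colour 0. If they do, with i
  further elements, then the bias and the probability of avoiding I have the same numerator n - i,
  so the powers j and k - j merge into \<open>surj_count k n\<close>. If they do not, absorption
  turns n choose i into r choose i at the price of one more factor r - i; this explains the exponent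
  \<open>Suc (k - j)\<close> and makes the added term i = r vanish.\<close>

lemma bias_coeff_eq:
  assumes "r = Suc n" "j \<le> k"
  shows "bias_coeff k r j = (1 / real r ^ 2) ^ j * (1 / real r ^ (k - j)) *
    (1 / real r * (\<Sum>i\<le>r. (-1) ^ i * real (r choose i) * (real i ^ j * real (r - i) ^ Suc (k - j)))
      - (-1) ^ j * surj_count k n)"
proof -
  define g where "g I = (-1) ^ card I * (- bias r I) ^ j * (1 - real (card I) / real r) ^ (k - j)" for I
  have ins: "{..<r} = insert 0 {1..<r}" using assms by auto
  have "bias_coeff k r j = (\<Sum>I\<in>Pow {1..<r}. g I) + (\<Sum>I\<in>insert 0 ` Pow {1..<r}. g I)"
    unfolding bias_coeff_def g_def[symmetric] ins Pow_insert
    by (rule sum.union_disjoint) auto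
  also have "(\<Sum>I\<in>insert 0 ` Pow {1..<r}. g I) = (\<Sum>I\<in>Pow {1..<r}. g (insert 0 I))"
    by (subst sum.reindex) (auto intro!: inj_on_inverseI[of _ "\<lambda>I. I - {0}"])
  finally have split: "bias_coeff k r j = (\<Sum>I\<in>Pow {1..<r}. g I) + (\<Sum>I\<in>Pow {1..<r}. g (insert 0 I))" .
  have r0: "real r > 0" using assms by simp
  have A: "(\<Sum>I\<in>Pow {1..<r}. g I) = (\<Sum>I\<in>Pow {1..<r}.
      (\<lambda>i. (-1) ^ i * (real i / real r ^ 2) ^ j * (1 - real i / real r) ^ (k - j)) (card I))"
    by (rule sum.cong) (auto simp: g_def bias_def)
  have cA: "card {1..<r} = n" using assms by simp
  have fr: "1 - real i / real r = real (r - i) / real r" if "i \<le> r" for i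
    using that r0 by (simp add: field_simps of_nat_diff)
  have B: "(\<Sum>I\<in>Pow {1..<r}. g (insert 0 I)) = (\<Sum>I\<in>Pow {1..<r}.
      (\<lambda>i. (-1) ^ Suc i * (- (real (n - i) / real r ^ 2)) ^ j * (real (n - i) / real r) ^ (k - j)) (card I))"
  proof (rule sum.cong[OF refl])
    fix I assume I: "I \<in> Pow {1..<r}"
    then have fin: "finite I" and nz: "0 \<notin> I" by (auto intro: finite_subset)
    have le: "card I \<le> n" using I card_mono[of "{1..<r}" I] cA by auto
    have c: "card (insert 0 I) = Suc (card I)" using fin nz by simp
    show "g (insert 0 I) = (\<lambda>i. (-1) ^ Suc i * (- (real (n - i) / real r ^ 2)) ^ j * (real (n - i) / real r) ^ (k - j)) (card I)"
      using fr[of "Suc (card I)"] le assms unfolding g_def c bias_def by (simp add: of_nat_diff)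
  qed
  have absorb: "real (n choose i) = real (r choose i) * real (r - i) / real r" if "i \<le> n" for i
  proof -
    have "(r - i) * (r choose i) = r * (n choose i)"
      using binomial_absorb_comp[of r i] assms by simp
    then have "real (r - i) * real (r choose i) = real r * real (n choose i)"
      by (metis of_nat_mult)
    then show ?thesis using r0 by (simp add: field_simps)
  qed
  have A': "(\<Sum>I\<in>Pow {1..<r}. g I) = (1 / real r ^ 2) ^ j * (1 / real r ^ (k - j)) *
     (1 / real r * (\<Sum>i\<le>r. (-1) ^ i * real (r choose i) * (real i ^ j * real (r - i) ^ Suc (k - j))))"
  proof -
    have "(\<Sum>i\<le>r. (-1) ^ i * real (r choose i) * (real i ^ j * real (r - i) ^ Suc (k - j)))
      = (\<Sum>i\<le>n. (-1) ^ i * real (r choose i) * (real i ^ j * real (r - i) ^ Suc (k - j)))"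
      unfolding assms(1) sum.atMost_Suc by simp
    moreover have "real (n choose i) * ((-1) ^ i * (real i / real r ^ 2) ^ j * (1 - real i / real r) ^ (k - j)) =
      (1 / real r ^ 2) ^ j * (1 / real r ^ (k - j)) *
        (1 / real r * ((-1) ^ i * real (r choose i) * (real i ^ j * real (r - i) ^ Suc (k - j))))"
      if "i \<in> {..n}" for i
    proof -
      have i: "i \<le> n" "i \<le> r" using that assms(1) by auto
      show ?thesis unfolding absorb[OF i(1)] fr[OF i(2)] power_divide power_Suc
        by (simp add: divide_simps del: of_nat_diff)
    qed
    ultimately show ?thesis
      unfolding trans[OF A sum_Pow_card[OF finite_atLeastLessThan]] cA
      by (simp only: sum_distrib_left cong: sum.cong)
  qed
  have B': "(\<Sum>I\<in>Pow {1..<r}. g (insert 0 I)) = (1 / real r ^ 2) ^ j * (1 / real r ^ (k - j)) *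
     (- ((-1) ^ j * surj_count k n))"
    unfolding trans[OF B sum_Pow_card[OF finite_atLeastLessThan]] cA surj_count_def sum_distrib_left sum_negf[symmetric]
  proof (rule sum.cong[OF refl])
    fix i
    have e: "real (n - i) ^ k = real (n - i) ^ j * real (n - i) ^ (k - j)"
      using assms by (simp add: power_add[symmetric])
    have m: "(- (real (n - i) / real r ^ 2)) ^ j = (-1) ^ j * real (n - i) ^ j / (real r ^ 2) ^ j"
      by (metis mult_minus1 power_divide power_mult_distrib times_divide_eq_right)
    show "real (n choose i) * ((-1) ^ Suc i * (- (real (n - i) / real r ^ 2)) ^ j * (real (n - i) / real r) ^ (k - j))
      = (1 / real r ^ 2) ^ j * (1 / real r ^ (k - j)) * (- ((-1) ^ j * ((-1) ^ i * real (n choose i) * real (n - i) ^ k)))"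
      unfolding e m by (simp add: power_divide)
  qed
  show ?thesis unfolding split A' B' by (simp add: algebra_simps)
qed

text \<open>Write i = r - (r - i) and expand the power: only surjection counts with consecutive
  exponents remain, and their recurrence can then simplify the coefficients.\<close>

lemma alternating_sum_pow_mult:
  shows "(\<Sum>i\<le>r. (-1) ^ i * real (r choose i) * (real i ^ 2 * real (r - i) ^ a)) =
      real r ^ 2 * surj_count a r - 2 * real r * surj_count (a + 1) r + surj_count (a + 2) r"
    and "(\<Sum>i\<le>r. (-1) ^ i * real (r choose i) * (real i ^ 3 * real (r - i) ^ a)) =
      real r ^ 3 * surj_count a r - 3 * real r ^ 2 * surj_count (a + 1) r
        + 3 * real r * surj_count (a + 2) r - surj_count (a + 3) r"
proof -
  define c y where "c i = (-1) ^ i * real (r choose i)" and "y i = real (r - i)" for i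
  have T: "surj_count b r = (\<Sum>i\<le>r. c i * y i ^ b)" for b
    unfolding surj_count_def c_def y_def ..
  have i: "(\<Sum>i\<le>r. (-1) ^ i * real (r choose i) * (real i ^ j * real (r - i) ^ a)) =
      (\<Sum>i\<le>r. c i * ((real r - y i) ^ j * y i ^ a))" for j
    unfolding c_def y_def by (rule sum.cong) auto
  have 2: "c * ((R - y) ^ 2 * y ^ a) = R ^ 2 * (c * y ^ a) - 2 * R * (c * y ^ (a + 1)) + c * y ^ (a + 2)"
    for c y R :: real
    by (simp add: algebra_simps power2_eq_square)
  have 3: "c * ((R - y) ^ 3 * y ^ a) = R ^ 3 * (c * y ^ a) - 3 * R ^ 2 * (c * y ^ (a + 1))
      + 3 * R * (c * y ^ (a + 2)) - c * y ^ (a + 3)" for c y R :: real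
    by (simp add: power_add algebra_simps power2_eq_square power3_eq_cube)
  show "(\<Sum>i\<le>r. (-1) ^ i * real (r choose i) * (real i ^ 2 * real (r - i) ^ a)) =
      real r ^ 2 * surj_count a r - 2 * real r * surj_count (a + 1) r + surj_count (a + 2) r"
    unfolding i 2 T by (simp only: sum_subtractf sum.distrib sum_distrib_left)
  show "(\<Sum>i\<le>r. (-1) ^ i * real (r choose i) * (real i ^ 3 * real (r - i) ^ a)) =
      real r ^ 3 * surj_count a r - 3 * real r ^ 2 * surj_count (a + 1) r
        + 3 * real r * surj_count (a + 2) r - surj_count (a + 3) r"
    unfolding i 3 T by (simp only: sum_subtractf sum.distrib sum_distrib_left)
qed

text \<open>Without bias the cut is uniform, so the constant term is what the excess subtracts. This
  is why \<open>edge_poly\<close> omits the empty set.\<close>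

lemma bias_coeff_0:
  assumes "r > 0"
  shows "bias_coeff k r 0 = real (Stirling k r) * fact r / real r ^ k"
proof -
  obtain n where n: "r = Suc n" using assms gr0_conv_Suc by auto
  have rec: "surj_count (Suc k) r = real r * (surj_count k r + surj_count k n)"
    using surj_count_rec[OF assms, of k] n by simp
  have "(\<Sum>i\<le>r. (-1) ^ i * real (r choose i) * (real i ^ 0 * real (r - i) ^ Suc (k - 0))) = surj_count (Suc k) r"
    unfolding surj_count_def by simp
  then have "bias_coeff k r 0 = 1 / real r ^ k * surj_count k r"
    unfolding bias_coeff_eq[OF n le0] rec using assms by (simp add: field_simps del: of_nat_Suc)
  then show ?thesis by (simp add: surj_count_Stirling)
qed

text \<open>Two applications of the recurrence cancel everything except -r
  \<open>surj_count (k - 1) (r - 1)\<close>, up to a positive factor. The sign is strict since 1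
  \<le> r - 1 \<le> k - 1.\<close>

lemma bias_coeff_2:
  assumes "r \<ge> 2" "k \<ge> r"
  shows "bias_coeff k r 2 < 0"
proof -
  define n where "n = r - 1"
  have n: "r = Suc n" using assms unfolding n_def by auto
  define a where "a = k - 1"
  have a: "Suc (k - 2) = a" "k = Suc a" "a + 1 = Suc a" "a + 2 = Suc (Suc a)" using assms unfolding a_def by auto
  have r1: "surj_count (Suc a) r = real r * (surj_count a r + surj_count a n)"
    using surj_count_rec[of r a] n by simp
  have r2: "surj_count (Suc (Suc a)) r = real r * (surj_count (Suc a) r + surj_count (Suc a) n)"
    using surj_count_rec[of r "Suc a"] n by simp
  have "1 / real r * (real r ^ 2 * surj_count a r - 2 * real r * surj_count (a + 1) r + surj_count (a + 2) r)
      - surj_count k n = - real r * surj_count a n"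
    unfolding a r2 r1 using n by (simp add: field_simps power2_eq_square)
  then have eq: "bias_coeff k r 2 = (1 / real r ^ 2) ^ 2 * (1 / real r ^ (k - 2)) * (- real r * surj_count a n)"
    using assms by (subst bias_coeff_eq[OF n]) (auto simp: a(1) alternating_sum_pow_mult simp del: of_nat_diff)
  have "surj_count a n > 0" using assms n unfolding a_def by (intro surj_count_pos) auto
  then have "(1 / real r ^ 2) ^ 2 * (1 / real r ^ (k - 2)) * (real r * surj_count a n) > 0"
    using n by (intro mult_pos_pos) auto
  then show ?thesis unfolding eq by simp
qed

text \<open>The recurrence reduces the coefficient, up to a positive factor, to (r - 2)
  \<open>surj_count a n\<close> + 2 n \<open>surj_count a (n - 1)\<close> with n = r - 1 and a = k -
  2. The second summand is positive because r \<ge> 3 makes n - 1 positive.\<close>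

lemma bias_coeff_3:
  assumes "r \<ge> 3" "k \<ge> r"
  shows "bias_coeff k r 3 > 0"
proof -
  define n where "n = r - 1"
  have n: "r = Suc n" using assms unfolding n_def by auto
  define a where "a = k - 2"
  have a: "Suc (k - 3) = a" "k = Suc (Suc a)" "a + 1 = Suc a" "a + 2 = Suc (Suc a)" "a + 3 = Suc (Suc (Suc a))"
    using assms unfolding a_def by auto
  have r1: "surj_count (Suc a) r = real r * (surj_count a r + surj_count a n)"
    using surj_count_rec[of r a] n by simp
  have r2: "surj_count (Suc (Suc a)) r = real r * (surj_count (Suc a) r + surj_count (Suc a) n)"
    using surj_count_rec[of r "Suc a"] n by simp
  have r3: "surj_count (Suc (Suc (Suc a))) r = real r * (surj_count (Suc (Suc a)) r + surj_count (Suc (Suc a)) n)"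
    using surj_count_rec[of r "Suc (Suc a)"] n by simp
  have r4: "surj_count (Suc a) n = real n * (surj_count a n + surj_count a (n - 1))"
    using surj_count_rec[of n a] n assms by simp
  have "1 / real r * (real r ^ 3 * surj_count a r - 3 * real r ^ 2 * surj_count (a + 1) r
        + 3 * real r * surj_count (a + 2) r - surj_count (a + 3) r) + surj_count k n
      = real r * (2 * surj_count (Suc a) n - real r * surj_count a n)"
    unfolding a r3 r2 r1 using n by (simp add: field_simps power2_eq_square power3_eq_cube)
  also have "2 * surj_count (Suc a) n - real r * surj_count a n
      = (real r - 2) * surj_count a n + 2 * real n * surj_count a (n - 1)"
    unfolding r4 using n by (simp add: algebra_simps)
  finally have eq: "bias_coeff k r 3 = (1 / real r ^ 2) ^ 3 * (1 / real r ^ (k - 3)) *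
      (real r * ((real r - 2) * surj_count a n + 2 * real n * surj_count a (n - 1)))"
    using assms by (subst bias_coeff_eq[OF n]) (auto simp: a(1) alternating_sum_pow_mult simp del: of_nat_diff)
  have "surj_count a (n - 1) > 0" using assms n unfolding a_def by (intro surj_count_pos) auto
  moreover have "(real r - 2) * surj_count a n \<ge> 0" using assms surj_count_nonneg by simp
  ultimately have "(real r - 2) * surj_count a n + 2 * real n * surj_count a (n - 1) > 0"
    using n assms by (intro add_nonneg_pos mult_pos_pos) auto
  then show ?thesis unfolding eq using n by (intro mult_pos_pos) auto
qed

text \<open>With two colours, exchanging them replaces s by -s, so the coefficients of odd degree
  vanish and degree 4 is the first candidate beyond degree 2. Only i = 1 survives in the alternating
  sum.\<close>

lemma bias_coeff_4:
  assumes "k \<ge> 4"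
  shows "bias_coeff k 2 4 \<noteq> 0"
proof -
  have s: "surj_count k 1 = 1" using assms by (simp add: surj_count_def)
  have "(\<Sum>i\<le>2. (-1) ^ i * real (2 choose i) * (real i ^ 4 * real (2 - i) ^ Suc (k - 4))) = -2"
    by (simp add: numeral_2_eq_2)
  then show ?thesis
    using assms s bias_coeff_eq[of 2 1 4 k] by simp
qed

section \<open>From the bias polynomial to an actual cut\<close>

definition edge_poly :: "(nat \<Rightarrow> real) \<Rightarrow> 'a set set \<Rightarrow> ('a \<Rightarrow> real) \<Rightarrow> real" where
  "edge_poly c E s = (\<Sum>e\<in>E. \<Sum>S\<in>Pow e - {{}}. c (card S) * (\<Prod>v\<in>S. s v))"

text \<open>A set I contributes exactly when it consists of missed colours, and the alternating sum
  over subsets of the missed colours detects whether there are any.\<close>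

lemma surjective_indicator:
  fixes f :: "'a \<Rightarrow> nat"
  assumes "finite e"
  shows "(\<Sum>I\<in>Pow {..<r}. (-1) ^ card I * (\<Prod>v\<in>e. if f v \<in> I then 0 else 1))
    = (if \<forall>i<r. \<exists>v\<in>e. f v = i then 1 else (0::real))"
proof -
  define N where "N = {..<r} - f ` e"
  have "(\<Sum>I\<in>Pow {..<r}. (-1) ^ card I * (\<Prod>v\<in>e. if f v \<in> I then 0 else 1))
     = (\<Sum>I\<in>Pow {..<r}. if I \<in> Pow N then (-1::real) ^ card I else 0)"
  proof (rule sum.cong[OF refl])
    fix I assume I: "I \<in> Pow {..<r}"
    show "(-1) ^ card I * (\<Prod>v\<in>e. if f v \<in> I then 0 else 1) = (if I \<in> Pow N then (-1::real) ^ card I else 0)"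
    proof (cases "I \<in> Pow N")
      case True
      then have "f v \<notin> I" if "v \<in> e" for v using that unfolding N_def by auto
      then show ?thesis using True by simp
    next
      case False
      then obtain v where "v \<in> e" "f v \<in> I" using I unfolding N_def by auto
      then have "(\<Prod>v\<in>e. if f v \<in> I then 0 else 1) = (0::real)"
        using assms by (intro prod_zero) auto
      then show ?thesis using False by simp
    qed
  qed
  also have "\<dots> = (\<Sum>I\<in>Pow {..<r} \<inter> Pow N. (-1) ^ card I)"
    by (rule sum.inter_restrict[symmetric]) simp
  also have "Pow {..<r} \<inter> Pow N = Pow N" unfolding N_def by auto
  also have "(\<Sum>I\<in>Pow N. (-1::real) ^ card I) = (if N = {} then 1 else 0)"
    by (rule sum_Pow_minus_one) (simp add: N_def)
  also have "N = {} \<longleftrightarrow> (\<forall>i<r. \<exists>v\<in>e. f v = i)" unfolding N_def by blast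
  finally show ?thesis .
qed

text \<open>First-moment argument with independent colours. After inclusion-exclusion only the
  events that an edge avoids a set of colours are needed, and these factor over the
  vertices.\<close>

lemma exists_cut_ge_expectation:
  fixes p :: "'a \<Rightarrow> nat \<Rightarrow> real"
  assumes V: "finite V" and E: "\<And>e. e \<in> E \<Longrightarrow> e \<subseteq> V"
    and p0: "\<And>v i. v \<in> V \<Longrightarrow> i < r \<Longrightarrow> p v i \<ge> 0"
    and p1: "\<And>v. v \<in> V \<Longrightarrow> (\<Sum>i<r. p v i) = 1"
  shows "\<exists>P. is_cut r V P \<and> real (cut_size r E P) \<ge>
    (\<Sum>e\<in>E. \<Sum>I\<in>Pow {..<r}. (-1) ^ card I * (\<Prod>v\<in>e. 1 - (\<Sum>i\<in>I. p v i)))"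
proof -
  define \<Phi> where "\<Phi> = PiE V (\<lambda>_. {..<r})"
  define w where "w f = (\<Prod>v\<in>V. p v (f v))" for f
  define cs where "cs f = (\<Sum>e\<in>E. \<Sum>I\<in>Pow {..<r}. (-1) ^ card I * (\<Prod>v\<in>e. if f v \<in> I then 0 else (1::real)))"
    for f :: "'a \<Rightarrow> nat"
  have finE: "finite E" using E V by (meson PowI finite_Pow_iff finite_subset subsetI)
  have fin\<Phi>: "finite \<Phi>" unfolding \<Phi>_def using V by (intro finite_PiE) auto
  have w0: "w f \<ge> 0" if "f \<in> \<Phi>" for f
    using that p0 unfolding w_def \<Phi>_def by (intro prod_nonneg) (auto simp: PiE_def Pi_def)
  have w1: "(\<Sum>f\<in>\<Phi>. w f) = 1"
    using prod_sum_PiE[of V "\<lambda>_. {..<r}" p] V p1 unfolding w_def \<Phi>_def by simp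
  have exp: "(\<Sum>f\<in>\<Phi>. w f * (\<Prod>v\<in>e. if f v \<in> I then 0 else 1)) = (\<Prod>v\<in>e. 1 - (\<Sum>i\<in>I. p v i))"
    if e: "e \<in> E" and I: "I \<subseteq> {..<r}" for e I
  proof -
    \<comment> \<open>The forbidden colours get weight 0 on \<open>e\<close>; the weighted sum over
      colourings then factors over all of \<open>V\<close>, and every vertex outside
      \<open>e\<close> contributes 1.\<close>
    define q where "q v i = p v i * (if v \<in> e \<and> i \<in> I then 0 else 1)" for v i
    have "(\<Sum>f\<in>\<Phi>. w f * (\<Prod>v\<in>e. if f v \<in> I then 0 else 1)) = (\<Sum>f\<in>\<Phi>. \<Prod>v\<in>V. q v (f v))"
    proof (rule sum.cong[OF refl])
      fix f
      have "(\<Prod>v\<in>e. if f v \<in> I then 0 else (1::real)) = (\<Prod>v\<in>V. if v \<in> e \<and> f v \<in> I then 0 else 1)"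
        by (rule prod.mono_neutral_cong_left) (use V E[OF e] in auto)
      then show "w f * (\<Prod>v\<in>e. if f v \<in> I then 0 else 1) = (\<Prod>v\<in>V. q v (f v))"
        unfolding w_def q_def by (simp add: prod.distrib)
    qed
    also have "\<dots> = (\<Prod>v\<in>V. \<Sum>i<r. q v i)"
      unfolding \<Phi>_def using V by (subst prod_sum_PiE) auto
    also have "\<dots> = (\<Prod>v\<in>e. 1 - (\<Sum>i\<in>I. p v i))"
    proof (rule prod.mono_neutral_cong_right[OF V E[OF e]])
      show "\<forall>v\<in>V - e. (\<Sum>i<r. q v i) = 1" using p1 unfolding q_def by simp
      fix v assume v: "v \<in> e"
      have "(\<Sum>i<r. q v i) = (\<Sum>i\<in>{..<r} - I. p v i)"
        unfolding q_def using v by (intro sum.mono_neutral_cong_right) auto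
      also have "\<dots> = 1 - (\<Sum>i\<in>I. p v i)"
        using p1[of v] v E[OF e] I by (subst sum_diff) auto
      finally show "(\<Sum>i<r. q v i) = 1 - (\<Sum>i\<in>I. p v i)" .
    qed
    finally show ?thesis .
  qed
  define X where "X = (\<Sum>e\<in>E. \<Sum>I\<in>Pow {..<r}. (-1) ^ card I * (\<Prod>v\<in>e. 1 - (\<Sum>i\<in>I. p v i)))"
  have "(\<Sum>f\<in>\<Phi>. w f * cs f) = (\<Sum>f\<in>\<Phi>. \<Sum>e\<in>E. \<Sum>I\<in>Pow {..<r}.
      (-1) ^ card I * (w f * (\<Prod>v\<in>e. if f v \<in> I then 0 else 1)))"
    unfolding cs_def by (simp add: sum_distrib_left algebra_simps)
  also have "\<dots> = (\<Sum>e\<in>E. \<Sum>f\<in>\<Phi>. \<Sum>I\<in>Pow {..<r}.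
      (-1) ^ card I * (w f * (\<Prod>v\<in>e. if f v \<in> I then 0 else 1)))"
    by (rule sum.swap)
  also have "\<dots> = (\<Sum>e\<in>E. \<Sum>I\<in>Pow {..<r}. \<Sum>f\<in>\<Phi>.
      (-1) ^ card I * (w f * (\<Prod>v\<in>e. if f v \<in> I then 0 else 1)))"
    by (intro sum.cong refl sum.swap)
  also have "\<dots> = X"
    unfolding X_def sum_distrib_left[symmetric] by (intro sum.cong refl) (simp add: exp)
  finally have avg: "(\<Sum>f\<in>\<Phi>. w f * cs f) = X" .
  have "\<exists>f\<in>\<Phi>. cs f \<ge> X"
  proof (rule ccontr)
    assume "\<not> ?thesis"
    then have less: "cs f < X" if "f \<in> \<Phi>" for f using that by auto
    \<comment> \<open>Weights may vanish, so strictness of the averaging inequality needs a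
      colouring of positive weight; one exists because the weights sum to 1.\<close>
    obtain g where g: "g \<in> \<Phi>" "w g > 0"
    proof -
      have "\<not> (\<forall>f\<in>\<Phi>. w f = 0)"
      proof
        assume "\<forall>f\<in>\<Phi>. w f = 0"
        then show False using w1 sum.neutral[of \<Phi> w] by simp
      qed
      then show ?thesis using w0 that by (auto simp: less_le)
    qed
    have "(\<Sum>f\<in>\<Phi>. w f * cs f) < (\<Sum>f\<in>\<Phi>. w f * X)"
      using fin\<Phi> w0 less g
      by (intro sum_strict_mono_ex1) (auto intro!: mult_left_mono bexI[of _ g] mult_strict_left_mono intro: less_imp_le)
    then show False using avg w1 by (simp add: sum_distrib_right[symmetric])
  qed
  then obtain f where f: "f \<in> \<Phi>" "cs f \<ge> X" by auto
  define P where "P i = {v \<in> V. f v = i}" for i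
  have cut: "is_cut r V P"
    using f(1) unfolding is_cut_def P_def disjoint_family_on_def \<Phi>_def by (auto simp: PiE_def Pi_def)
  have "cs f = (\<Sum>e\<in>E. if \<forall>i<r. e \<inter> P i \<noteq> {} then 1 else 0)"
    unfolding cs_def
  proof (rule sum.cong[OF refl])
    fix e assume e: "e \<in> E"
    have "(\<forall>i<r. \<exists>v\<in>e. f v = i) \<longleftrightarrow> (\<forall>i<r. e \<inter> P i \<noteq> {})"
      using E[OF e] unfolding P_def by blast
    then show "(\<Sum>I\<in>Pow {..<r}. (-1) ^ card I * (\<Prod>v\<in>e. if f v \<in> I then 0 else 1))
      = (if \<forall>i<r. e \<inter> P i \<noteq> {} then 1 else (0::real))"
      using surjective_indicator[of e f r] finite_subset[OF E[OF e] V] by simp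
  qed
  also have "\<dots> = real (cut_size r E P)"
    unfolding cut_size_def using sum.inter_filter[OF finE, of "\<lambda>_. 1::real"] by simp
  finally have "real (cut_size r E P) \<ge> X" using f by simp
  then show ?thesis using cut unfolding X_def by auto
qed

lemma exists_cut_excess_ge:
  fixes s :: "'a \<Rightarrow> real"
  assumes H: "uniform_hypergraph k V E" and r: "2 \<le> r" "r \<le> k" and s: "\<And>v. \<bar>s v\<bar> \<le> 1"
  shows "\<exists>P. is_cut r V P \<and> excess k r E P \<ge> edge_poly (bias_coeff k r) E s"
proof -
  define p where "p v i = (if i = 0 then 1 / real r + (real r - 1) * s v / real r ^ 2
     else 1 / real r - s v / real r ^ 2)" for v and i :: nat
  have V: "finite V" and E: "\<And>e. e \<in> E \<Longrightarrow> e \<subseteq> V" and ce: "\<And>e. e \<in> E \<Longrightarrow> card e = k"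
    using H unfolding uniform_hypergraph_def by auto
  have r0: "real r > 0" using r by simp
  have pI: "(\<Sum>i\<in>I. p v i) = real (card I) / real r + bias r I * s v" if "I \<subseteq> {..<r}" for I v
  proof -
    have fin: "finite I" using that finite_subset by blast
    show ?thesis
    proof (cases "0 \<in> I")
      case True
      then have c: "real (card (I - {0})) = real (card I) - 1"
        using fin card_Suc_Diff1[OF fin True] by (simp add: of_nat_diff[symmetric])
      have "(\<Sum>i\<in>I. p v i) = p v 0 + (\<Sum>i\<in>I - {0}. p v i)"
        by (rule sum.remove[OF fin True])
      also have "(\<Sum>i\<in>I - {0}. p v i) = (\<Sum>i\<in>I - {0}. 1 / real r - s v / real r ^ 2)"
        by (rule sum.cong) (auto simp: p_def)
      also have "\<dots> = (real (card I) - 1) * (1 / real r - s v / real r ^ 2)"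
        unfolding sum_constant c ..
      finally have eq: "(\<Sum>i\<in>I. p v i) = p v 0 + (real (card I) - 1) * (1 / real r - s v / real r ^ 2)" .
      show ?thesis unfolding eq using True r0
        by (simp add: p_def bias_def field_simps power2_eq_square)
    next
      case False
      then have "(\<Sum>i\<in>I. p v i) = (\<Sum>i\<in>I. 1 / real r - s v / real r ^ 2)"
        by (intro sum.cong) (auto simp: p_def)
      then show ?thesis using False r0
        by (simp add: bias_def field_simps power2_eq_square)
    qed
  qed
  \<comment> \<open>The scaling by 1 / r^2 is chosen for this: for |s v| \<le> 1 the numerators r +
    (r - 1) s v and r - s v cannot become negative.\<close>
  have p0: "p v i \<ge> 0" if "i < r" for v i
  proof -
    have a: "- 1 \<le> s v" "s v \<le> 1" using s[of v] by auto
    have "(real r - 1) * (- 1) \<le> (real r - 1) * s v"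
      using a r by (intro mult_left_mono) auto
    then have "real r + (real r - 1) * s v \<ge> 0" using r by simp
    moreover have "p v 0 = (real r + (real r - 1) * s v) / real r ^ 2"
      "i \<noteq> 0 \<Longrightarrow> p v i = (real r - s v) / real r ^ 2"
      using r0 by (simp_all add: p_def field_simps power2_eq_square)
    ultimately show ?thesis using a r by (cases "i = 0") auto
  qed
  have p1: "(\<Sum>i<r. p v i) = 1" for v
    using pI[of "{..<r}" v] r by (simp add: bias_def)
  have "\<exists>P. is_cut r V P \<and> real (cut_size r E P) \<ge>
    (\<Sum>e\<in>E. \<Sum>I\<in>Pow {..<r}. (-1) ^ card I * (\<Prod>v\<in>e. 1 - (\<Sum>i\<in>I. p v i)))"
    by (rule exists_cut_ge_expectation) (use V E p0 p1 in auto)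
  then obtain P where P: "is_cut r V P" and ge: "real (cut_size r E P) \<ge>
    (\<Sum>e\<in>E. \<Sum>I\<in>Pow {..<r}. (-1) ^ card I * (\<Prod>v\<in>e. 1 - (\<Sum>i\<in>I. p v i)))"
    by (elim exE conjE)
  have edge: "(\<Sum>I\<in>Pow {..<r}. (-1) ^ card I * (\<Prod>v\<in>e. 1 - (\<Sum>i\<in>I. p v i))) =
     bias_coeff k r 0 + (\<Sum>S\<in>Pow e - {{}}. bias_coeff k r (card S) * (\<Prod>v\<in>S. s v))" if e: "e \<in> E" for e
  proof -
    have fe: "finite e" using finite_subset[OF E[OF e] V] .
    have "(\<Sum>I\<in>Pow {..<r}. (-1) ^ card I * (\<Prod>v\<in>e. 1 - (\<Sum>i\<in>I. p v i)))
       = (\<Sum>I\<in>Pow {..<r}. \<Sum>S\<in>Pow e. ((-1) ^ card I * (- bias r I) ^ card S *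
     (1 - real (card I) / real r) ^ (k - card S)) * (\<Prod>v\<in>S. s v))"
    proof (rule sum.cong[OF refl])
      fix I assume I: "I \<in> Pow {..<r}"
      have "(\<Prod>v\<in>e. 1 - (\<Sum>i\<in>I. p v i)) = (\<Prod>v\<in>e. - bias r I * s v + (1 - real (card I) / real r))"
        using pI I by (intro prod.cong) auto
      also have "\<dots> = (\<Sum>S\<in>Pow e. (\<Prod>v\<in>S. - bias r I * s v) * (\<Prod>v\<in>e - S. 1 - real (card I) / real r))"
        by (rule prod_add[OF fe])
      also have "\<dots> = (\<Sum>S\<in>Pow e. (- bias r I) ^ card S * (1 - real (card I) / real r) ^ (k - card S) * (\<Prod>v\<in>S. s v))"
      proof (rule sum.cong[OF refl])
        fix S assume "S \<in> Pow e"
        then have "card (e - S) = k - card S" using ce[OF e] fe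
          by (metis PowD card_Diff_subset finite_subset)
        then show "(\<Prod>v\<in>S. - bias r I * s v) * (\<Prod>v\<in>e - S. 1 - real (card I) / real r)
          = (- bias r I) ^ card S * (1 - real (card I) / real r) ^ (k - card S) * (\<Prod>v\<in>S. s v)"
          by (subst prod.distrib) simp
      qed
      finally show "(-1) ^ card I * (\<Prod>v\<in>e. 1 - (\<Sum>i\<in>I. p v i)) = (\<Sum>S\<in>Pow e. ((-1) ^ card I * (- bias r I) ^ card S *
        (1 - real (card I) / real r) ^ (k - card S)) * (\<Prod>v\<in>S. s v))"
        by (simp add: sum_distrib_left mult.assoc)
    qed
    also have "\<dots> = (\<Sum>S\<in>Pow e. bias_coeff k r (card S) * (\<Prod>v\<in>S. s v))"
      unfolding bias_coeff_def sum_distrib_right by (rule sum.swap)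
    also have "\<dots> = bias_coeff k r 0 + (\<Sum>S\<in>Pow e - {{}}. bias_coeff k r (card S) * (\<Prod>v\<in>S. s v))"
      using fe by (subst sum.remove[of _ "{}"]) auto
    finally show ?thesis .
  qed
  have "(\<Sum>e\<in>E. \<Sum>I\<in>Pow {..<r}. (-1) ^ card I * (\<Prod>v\<in>e. 1 - (\<Sum>i\<in>I. p v i)))
      = real (card E) * bias_coeff k r 0 + edge_poly (bias_coeff k r) E s"
    unfolding edge_poly_def by (simp add: edge sum.distrib)
  then have "excess k r E P \<ge> edge_poly (bias_coeff k r) E s"
    using ge r unfolding excess_def by (simp add: bias_coeff_0 mult.commute)
  then show ?thesis using P by blast
qed

section \<open>Averages over random signs\<close>

text \<open>A set X encodes a vector of signs, with -1 exactly on X. Thus \<open>chi A\<close> is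
  the Walsh character of A, and \<open>avg R\<close> below is the expectation over independent
  uniform signs on R.\<close>

definition chi :: "'a set \<Rightarrow> 'a set \<Rightarrow> real" where
  "chi A X = (\<Prod>a\<in>A. if a \<in> X then -1 else 1)"

definition avg :: "'a set \<Rightarrow> ('a set \<Rightarrow> real) \<Rightarrow> real" where
  "avg R f = (\<Sum>X\<in>Pow R. f X) / 2 ^ card R"

lemma chi_empty [simp]: "chi {} X = 1" by (simp add: chi_def)

lemma chi_insert: "finite A \<Longrightarrow> a \<notin> A \<Longrightarrow> chi (insert a A) X = (if a \<in> X then -1 else 1) * chi A X"
  by (simp add: chi_def)

lemma abs_chi: "\<bar>chi A X\<bar> = 1"
  unfolding chi_def abs_prod by (rule prod.neutral) auto

lemma chi_mult:
  assumes "finite A" "finite B"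
  shows "chi A X * chi B X = chi (sym_diff A B) X"
proof -
  have A: "chi A X = chi (A - B) X * chi (A \<inter> B) X"
    using assms unfolding chi_def by (subst prod.union_disjoint[symmetric]) (auto intro: prod.cong)
  have B: "chi B X = chi (B - A) X * chi (A \<inter> B) X"
    using assms unfolding chi_def by (subst prod.union_disjoint[symmetric]) (auto intro: prod.cong)
  have "chi (A \<inter> B) X * chi (A \<inter> B) X = 1"
    using abs_chi[of "A \<inter> B" X] by (metis abs_mult_self_eq mult_1)
  then have "chi A X * chi B X = chi (A - B) X * chi (B - A) X"
    unfolding A B by simp
  also have "\<dots> = chi (sym_diff A B) X"
    using assms unfolding chi_def by (subst prod.union_disjoint[symmetric]) auto
  finally show ?thesis .
qed

lemma chi_outside: "a \<notin> A \<Longrightarrow> chi A (insert a X) = chi A X"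
  unfolding chi_def by (rule prod.cong) auto

lemma avg_insert:
  assumes "finite R" "a \<notin> R"
  shows "avg (insert a R) f = (avg R f + avg R (\<lambda>X. f (insert a X))) / 2"
proof -
  have "(\<Sum>X\<in>Pow (insert a R). f X) = (\<Sum>X\<in>Pow R. f X) + (\<Sum>X\<in>insert a ` Pow R. f X)"
    unfolding Pow_insert by (rule sum.union_disjoint) (use assms in auto)
  also have "(\<Sum>X\<in>insert a ` Pow R. f X) = (\<Sum>X\<in>Pow R. f (insert a X))"
    by (subst sum.reindex) (use assms in \<open>auto intro!: inj_on_inverseI[of _ "\<lambda>X. X - {a}"]\<close>)
  finally show ?thesis using assms unfolding avg_def by (simp add: field_simps)
qed

lemma avg_add: "avg R (\<lambda>X. f X + g X) = avg R f + avg R g"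
  unfolding avg_def by (simp add: sum.distrib add_divide_distrib)

lemma avg_cmult: "avg R (\<lambda>X. c * f X) = c * avg R f"
  unfolding avg_def by (simp add: sum_distrib_left)

lemma avg_sum: "avg R (\<lambda>X. \<Sum>i\<in>I. f i X) = (\<Sum>i\<in>I. avg R (f i))"
  unfolding avg_def by (subst sum.swap) (simp add: sum_divide_distrib)

lemma avg_const: "finite R \<Longrightarrow> avg R (\<lambda>_. c) = c"
  unfolding avg_def by (simp add: card_Pow)

lemma avg_mono: "(\<And>X. X \<subseteq> R \<Longrightarrow> f X \<le> g X) \<Longrightarrow> avg R f \<le> avg R g"
  unfolding avg_def by (intro divide_right_mono sum_mono) auto

lemma avg_cong: "(\<And>X. X \<subseteq> R \<Longrightarrow> f X = g X) \<Longrightarrow> avg R f = avg R g"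
  unfolding avg_def by (intro arg_cong2[of _ _ _ _ "(/)"] sum.cong) auto

lemma avg_nonneg: "(\<And>X. X \<subseteq> R \<Longrightarrow> 0 \<le> f X) \<Longrightarrow> 0 \<le> avg R f"
  unfolding avg_def by (intro divide_nonneg_nonneg sum_nonneg) auto

lemma abs_avg_le: "\<bar>avg R f\<bar> \<le> avg R (\<lambda>X. \<bar>f X\<bar>)"
  unfolding avg_def by (simp add: divide_right_mono sum_abs)

text \<open>Flipping the sign of one element of a nonempty A reverses the character, so the values
  cancel in pairs.\<close>

lemma avg_chi:
  assumes "finite R" "A \<subseteq> R"
  shows "avg R (chi A) = (if A = {} then 1 else 0)"
proof (cases "A = {}")
  case True
  then show ?thesis using avg_const[OF assms(1), of 1] by (simp add: chi_def cong: avg_cong)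
next
  case False
  then obtain a where a: "a \<in> A" by auto
  define B where "B = A - {a}"
  have R: "R = insert a (R - {a})" and A: "A = insert a B" "a \<notin> B" "finite B"
    using a assms finite_subset unfolding B_def by auto
  have "avg R (chi A) = (avg (R - {a}) (chi A) + avg (R - {a}) (\<lambda>X. chi A (insert a X))) / 2"
    by (subst R, rule avg_insert) (use assms in auto)
  also have "avg (R - {a}) (\<lambda>X. chi A (insert a X)) = avg (R - {a}) (\<lambda>X. (- 1) * chi A X)"
    by (rule avg_cong) (auto simp: A chi_insert chi_outside)
  also have "\<dots> = (- 1) * avg (R - {a}) (chi A)" by (rule avg_cmult)
  finally show ?thesis using False by simp
qed

lemma avg_chi_mult:
  assumes "finite R" "A \<subseteq> R" "B \<subseteq> R"
  shows "avg R (\<lambda>X. chi A X * chi B X) = (if A = B then 1 else 0)"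
proof -
  have fin: "finite A" "finite B" using assms finite_subset by auto
  have "avg R (\<lambda>X. chi A X * chi B X) = avg R (chi (sym_diff A B))"
    by (rule avg_cong) (simp add: chi_mult fin)
  also have "\<dots> = (if A = B then 1 else 0)"
    using assms by (subst avg_chi) auto
  finally show ?thesis .
qed

section \<open>Hypercontractivity for functions of low degree\<close>

lemma avg_Cauchy_Schwarz:
  "(avg R (\<lambda>X. f X * g X))\<^sup>2 \<le> avg R (\<lambda>X. (f X)\<^sup>2) * avg R (\<lambda>X. (g X)\<^sup>2)"
proof -
  have "(\<Sum>X\<in>Pow R. f X * g X)\<^sup>2 / (2 ^ card R * 2 ^ card R)
     \<le> ((\<Sum>X\<in>Pow R. (f X)\<^sup>2) * (\<Sum>X\<in>Pow R. (g X)\<^sup>2)) / (2 ^ card R * 2 ^ card R)"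
    by (intro divide_right_mono Cauchy_Schwarz_ineq_sum) auto
  then show ?thesis unfolding avg_def by (simp add: power_divide power2_eq_square)
qed

text \<open>The span of the characters of degree at most d. Adding one character at a time, with
  repetitions allowed, makes closure under sums, products and restriction of a single sign direct
  inductions, without any appeal to uniqueness of coefficients.\<close>

inductive lowdeg :: "'a set \<Rightarrow> nat \<Rightarrow> ('a set \<Rightarrow> real) \<Rightarrow> bool" for R d where
  zero: "lowdeg R d (\<lambda>X. 0)"
| add: "lowdeg R d f \<Longrightarrow> A \<subseteq> R \<Longrightarrow> card A \<le> d \<Longrightarrow> lowdeg R d (\<lambda>X. f X + \<alpha> * chi A X)"

lemma lowdeg_plus:
  assumes "lowdeg R d g" "lowdeg R d f"
  shows "lowdeg R d (\<lambda>X. f X + g X)"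
  using assms
proof (induction rule: lowdeg.induct)
  case zero
  then show ?case by simp
next
  case (add g A \<alpha>)
  have "lowdeg R d (\<lambda>X. (f X + g X) + \<alpha> * chi A X)"
    by (intro lowdeg.add add)
  then show ?case by (simp add: add.assoc)
qed

lemma lowdeg_cong: "lowdeg R d f \<Longrightarrow> (\<And>X. f X = g X) \<Longrightarrow> lowdeg R d g"
  by (metis ext)

lemma lowdeg_sum_chi:
  assumes "finite \<A>" "\<And>A. A \<in> \<A> \<Longrightarrow> A \<subseteq> R \<and> card A \<le> d"
  shows "lowdeg R d (\<lambda>X. \<Sum>A\<in>\<A>. chi A X)"
  using assms
proof (induction \<A> rule: finite_induct)
  case empty
  then show ?case by (simp add: lowdeg.zero)
next
  case (insert A \<A>)
  have "lowdeg R d (\<lambda>X. (\<Sum>A\<in>\<A>. chi A X) + 1 * chi A X)"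
    by (rule lowdeg.add) (use insert in auto)
  then show ?case using insert.hyps by (simp add: add.commute)
qed

lemma lowdeg_mult_chi:
  assumes "finite R" "lowdeg R d f" "B \<subseteq> R" "card B \<le> d'"
  shows "lowdeg R (d + d') (\<lambda>X. c * chi B X * f X)"
  using assms(2)
proof (induction rule: lowdeg.induct)
  case zero
  then show ?case by (simp add: lowdeg.zero)
next
  case (add f A \<alpha>)
  have fin: "finite A" "finite B" using add.hyps assms finite_subset by auto
  have "card (sym_diff A B) \<le> card (A - B) + card (B - A)" by (rule card_Un_le)
  also have "\<dots> \<le> card A + card B" using fin by (intro add_mono card_mono) auto
  finally have "card (sym_diff A B) \<le> d + d'" using assms add.hyps by simp
  then have "lowdeg R (d + d') (\<lambda>X. c * chi B X * f X + (c * \<alpha>) * chi (sym_diff A B) X)"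
    by (intro lowdeg.add add) (use add.hyps assms in auto)
  then show ?case by (rule lowdeg_cong) (simp add: chi_mult[symmetric] fin algebra_simps)
qed

lemma lowdeg_mult:
  assumes "finite R" "lowdeg R d' g" "lowdeg R d f"
  shows "lowdeg R (d + d') (\<lambda>X. f X * g X)"
  using assms(2)
proof (induction rule: lowdeg.induct)
  case zero
  then show ?case by (simp add: lowdeg.zero)
next
  case (add g B \<beta>)
  have "lowdeg R (d + d') (\<lambda>X. f X * g X + \<beta> * chi B X * f X)"
    by (rule lowdeg_plus[OF lowdeg_mult_chi[OF assms(1,3)]]) (use add in auto)
  then show ?case by (rule lowdeg_cong) (simp add: algebra_simps)
qed

lemma lowdeg_power:
  assumes "finite R" "lowdeg R d f"
  shows "lowdeg R (d * 2 ^ j) (\<lambda>X. f X ^ (2 ^ j))"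
proof (induction j)
  case 0
  then show ?case using assms by simp
next
  case (Suc j)
  have "lowdeg R (d * 2 ^ j + d * 2 ^ j) (\<lambda>X. f X ^ (2 ^ j) * f X ^ (2 ^ j))"
    by (rule lowdeg_mult[OF assms(1) Suc Suc])
  then show ?case by (simp add: power_add[symmetric] mult_2 distrib_left)
qed

text \<open>The expansion f = g + x h in the sign x of \<open>a\<close>, where h has smaller degree.
  Degree 0 is treated apart: truncated subtraction would still admit a constant h, and the factor
  gained from the drop in degree in \<open>bonami\<close> would be lost.\<close>

lemma lowdeg_split:
  assumes "finite R" "a \<notin> R" "lowdeg (insert a R) d f"
  shows "\<exists>g h. lowdeg R d g \<and> (if d = 0 then h = (\<lambda>_. 0) else lowdeg R (d - 1) h) \<and>
    (\<forall>X. a \<notin> X \<longrightarrow> f X = g X + h X \<and> f (insert a X) = g X - h X)"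
  using assms(3)
proof (induction rule: lowdeg.induct)
  case zero
  show ?case
    by (rule exI[of _ "\<lambda>_. 0"], rule exI[of _ "\<lambda>_. 0"]) (auto intro: lowdeg.zero)
next
  case (add f A \<alpha>)
  then obtain g h where gh: "lowdeg R d g" "if d = 0 then h = (\<lambda>_. 0) else lowdeg R (d - 1) h"
    "\<And>X. a \<notin> X \<Longrightarrow> f X = g X + h X" "\<And>X. a \<notin> X \<Longrightarrow> f (insert a X) = g X - h X" by auto
  have fA: "finite A" using add.hyps assms finite_subset by (metis finite_insert)
  show ?case
  proof (cases "a \<in> A")
    case False
    then have "lowdeg R d (\<lambda>X. g X + \<alpha> * chi A X)"
      by (intro lowdeg.add gh) (use add.hyps in auto)
    then show ?thesis using gh False
      by (intro exI[of _ "\<lambda>X. g X + \<alpha> * chi A X"] exI[of _ h]) (auto simp: chi_outside)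
  next
    case True
    define B where "B = A - {a}"
    have A: "A = insert a B" "a \<notin> B" "finite B" using True fA unfolding B_def by auto
    have cA: "card A = Suc (card B)" using A by simp
    then have d: "d \<noteq> 0" using add.hyps by auto
    have "lowdeg R (d - 1) (\<lambda>X. h X + \<alpha> * chi B X)"
      by (rule lowdeg.add) (use gh d add.hyps cA in \<open>auto simp: B_def\<close>)
    then show ?thesis using gh d A
      by (intro exI[of _ g] exI[of _ "\<lambda>X. h X + \<alpha> * chi B X"])
         (auto simp: chi_insert chi_outside algebra_simps)
  qed
qed

text \<open>Bonami's lemma, by induction on the number of signs. With f = g + x h the fourth moment
  is E g^4 + 6 E g^2 h^2 + E h^4. Since h has degree at most d - 1, its fourth moment is smaller by
  a factor 9; under Cauchy-Schwarz this becomes a factor 3 for the mixed term, turning 6 into 2, and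
  the square of G + H results.\<close>

lemma bonami:
  assumes "finite R" "lowdeg R d f"
  shows "avg R (\<lambda>X. f X ^ 4) \<le> 9 ^ d * (avg R (\<lambda>X. (f X)\<^sup>2))\<^sup>2"
  using assms
proof (induction R arbitrary: d f rule: finite_induct)
  case empty
  have "f {} ^ 4 \<le> 9 ^ d * f {} ^ 4"
    using mult_right_mono[of 1 "9 ^ d" "f {} ^ 4"] by simp
  then show ?case by (simp add: avg_def power_mult[symmetric])
next
  case (insert a R)
  obtain g h where g: "lowdeg R d g" and h: "if d = 0 then h = (\<lambda>_. 0) else lowdeg R (d - 1) h"
    and f: "\<And>X. a \<notin> X \<Longrightarrow> f X = g X + h X" "\<And>X. a \<notin> X \<Longrightarrow> f (insert a X) = g X - h X"
    using lowdeg_split[OF insert.hyps(1,2) insert.prems] by blast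
  have aX: "a \<notin> X" if "X \<subseteq> R" for X using that insert.hyps by auto
  define G H where "G = avg R (\<lambda>X. (g X)\<^sup>2)" and "H = avg R (\<lambda>X. (h X)\<^sup>2)"
  have G0: "G \<ge> 0" and H0: "H \<ge> 0" unfolding G_def H_def by (auto intro: avg_nonneg)
  have g4: "avg R (\<lambda>X. g X ^ 4) \<le> 9 ^ d * G\<^sup>2" unfolding G_def by (rule insert.IH[OF g])
  have h4: "9 * avg R (\<lambda>X. h X ^ 4) \<le> 9 ^ d * H\<^sup>2"
  proof (cases "d = 0")
    case True
    then show ?thesis using h avg_const[OF insert.hyps(1), of 0] H0 by simp
  next
    case False
    then have "avg R (\<lambda>X. h X ^ 4) \<le> 9 ^ (d - 1) * H\<^sup>2"
      unfolding H_def using h by (intro insert.IH) auto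
    moreover have "(9::real) ^ d = 9 * 9 ^ (d - 1)" using False by (metis power_eq_if)
    ultimately show ?thesis by simp
  qed
  have mix: "3 * avg R (\<lambda>X. (g X)\<^sup>2 * (h X)\<^sup>2) \<le> 9 ^ d * (G * H)"
  proof (rule power2_le_imp_le)
    have "(3 * avg R (\<lambda>X. (g X)\<^sup>2 * (h X)\<^sup>2))\<^sup>2 = 9 * (avg R (\<lambda>X. (g X)\<^sup>2 * (h X)\<^sup>2))\<^sup>2"
      by (simp add: power_mult_distrib)
    also have "\<dots> \<le> 9 * (avg R (\<lambda>X. ((g X)\<^sup>2)\<^sup>2) * avg R (\<lambda>X. ((h X)\<^sup>2)\<^sup>2))"
      by (intro mult_left_mono avg_Cauchy_Schwarz) auto
    also have "\<dots> = avg R (\<lambda>X. g X ^ 4) * (9 * avg R (\<lambda>X. h X ^ 4))"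
      by (simp add: power_mult[symmetric])
    also have "\<dots> \<le> (9 ^ d * G\<^sup>2) * (9 ^ d * H\<^sup>2)"
      by (intro mult_mono g4 h4) (auto intro!: avg_nonneg)
    finally show "(3 * avg R (\<lambda>X. (g X)\<^sup>2 * (h X)\<^sup>2))\<^sup>2 \<le> (9 ^ d * (G * H))\<^sup>2"
      by (simp add: power2_eq_square algebra_simps)
  qed (use G0 H0 in auto)
  have "avg (insert a R) (\<lambda>X. f X ^ 4) = (avg R (\<lambda>X. (g X + h X) ^ 4) + avg R (\<lambda>X. (g X - h X) ^ 4)) / 2"
    unfolding avg_insert[OF insert.hyps(1,2)] using f aX by (simp cong: avg_cong)
  also have "\<dots> = avg R (\<lambda>X. (1/2) * ((g X + h X) ^ 4 + (g X - h X) ^ 4))"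
    unfolding avg_cmult avg_add by simp
  also have "\<dots> = avg R (\<lambda>X. g X ^ 4 + (6 * ((g X)\<^sup>2 * (h X)\<^sup>2) + h X ^ 4))"
    by (rule avg_cong) (simp add: power4_eq_xxxx power2_eq_square algebra_simps)
  also have "\<dots> = avg R (\<lambda>X. g X ^ 4) + (6 * avg R (\<lambda>X. (g X)\<^sup>2 * (h X)\<^sup>2) + avg R (\<lambda>X. h X ^ 4))"
    unfolding avg_add avg_cmult ..
  also have "\<dots> \<le> 9 ^ d * G\<^sup>2 + (2 * (9 ^ d * (G * H)) + 9 ^ d * H\<^sup>2)"
  proof -
    have "avg R (\<lambda>X. h X ^ 4) \<le> 9 * avg R (\<lambda>X. h X ^ 4)"
      using avg_nonneg[of R "\<lambda>X. h X ^ 4"] by simp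
    then show ?thesis using g4 mix h4 by linarith
  qed
  also have "\<dots> = 9 ^ d * (G + H)\<^sup>2" by (simp add: power2_eq_square algebra_simps)
  also have "G + H = avg (insert a R) (\<lambda>X. (f X)\<^sup>2)"
  proof -
    have "avg (insert a R) (\<lambda>X. (f X)\<^sup>2) = (avg R (\<lambda>X. (g X + h X)\<^sup>2) + avg R (\<lambda>X. (g X - h X)\<^sup>2)) / 2"
      unfolding avg_insert[OF insert.hyps(1,2)] using f aX by (simp cong: avg_cong)
    also have "\<dots> = avg R (\<lambda>X. (1/2) * ((g X + h X)\<^sup>2 + (g X - h X)\<^sup>2))"
      unfolding avg_cmult avg_add by simp
    also have "\<dots> = avg R (\<lambda>X. (g X)\<^sup>2 + (h X)\<^sup>2)"
      by (rule avg_cong) (simp add: power2_eq_square algebra_simps)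
    finally show ?thesis unfolding G_def H_def avg_add by simp
  qed
  finally show ?case .
qed

text \<open>Bonami's lemma is applied repeatedly to f, f^2, f^4 and so on; each squaring doubles the
  degree. What matters is the order of the quantifiers: the constant depends on d and j, not on the
  number of signs.\<close>

lemma moment_bound:
  "\<exists>\<kappa>\<ge>1. \<forall>(R::'a set) f. finite R \<longrightarrow> lowdeg R d f \<longrightarrow>
     avg R (\<lambda>X. f X ^ (2 ^ Suc j)) \<le> \<kappa> * (avg R (\<lambda>X. (f X)\<^sup>2)) ^ (2 ^ j)"
proof (induction j)
  case 0
  show ?case by (rule exI[of _ 1]) simp
next
  case (Suc j)
  then obtain \<kappa> where \<kappa>: "\<kappa> \<ge> 1" "\<And>(R::'a set) f. finite R \<Longrightarrow> lowdeg R d f \<Longrightarrow>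
     avg R (\<lambda>X. f X ^ (2 ^ Suc j)) \<le> \<kappa> * (avg R (\<lambda>X. (f X)\<^sup>2)) ^ (2 ^ j)" by blast
  show ?case
  proof (intro exI[of _ "9 ^ (d * 2 ^ j) * \<kappa>\<^sup>2"] conjI allI impI)
    show "9 ^ (d * 2 ^ j) * \<kappa>\<^sup>2 \<ge> 1"
      using \<kappa>(1) mult_mono[of 1 "9 ^ (d * 2 ^ j)" 1 "\<kappa>\<^sup>2"] by (simp add: one_le_power)
    fix R :: "'a set" and f assume R: "finite R" and f: "lowdeg R d f"
    have "avg R (\<lambda>X. f X ^ (2 ^ Suc (Suc j))) = avg R (\<lambda>X. (f X ^ (2 ^ j)) ^ 4)"
      by (simp add: power_mult[symmetric] mult.commute)
    also have "\<dots> \<le> 9 ^ (d * 2 ^ j) * (avg R (\<lambda>X. (f X ^ (2 ^ j))\<^sup>2))\<^sup>2"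
      by (rule bonami[OF R lowdeg_power[OF R f]])
    also have "avg R (\<lambda>X. (f X ^ (2 ^ j))\<^sup>2) = avg R (\<lambda>X. f X ^ (2 ^ Suc j))"
      by (simp add: power_mult[symmetric] mult.commute)
    also have "9 ^ (d * 2 ^ j) * (avg R (\<lambda>X. f X ^ (2 ^ Suc j)))\<^sup>2
       \<le> 9 ^ (d * 2 ^ j) * (\<kappa> * (avg R (\<lambda>X. (f X)\<^sup>2)) ^ (2 ^ j))\<^sup>2"
      using \<kappa>(2)[OF R f] by (intro mult_left_mono power_mono) (auto intro!: avg_nonneg simp: power_mult)
    also have "\<dots> = 9 ^ (d * 2 ^ j) * \<kappa>\<^sup>2 * (avg R (\<lambda>X. (f X)\<^sup>2)) ^ (2 ^ Suc j)"
      by (simp add: power_mult_distrib power_mult[symmetric] mult.commute)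
    finally show "avg R (\<lambda>X. f X ^ (2 ^ Suc (Suc j)))
      \<le> 9 ^ (d * 2 ^ j) * \<kappa>\<^sup>2 * (avg R (\<lambda>X. (f X)\<^sup>2)) ^ (2 ^ Suc j)" .
  qed
qed

section \<open>Codegrees\<close>

text \<open>A pair of maximum weight is removed repeatedly and both its ends receive that weight as
  \<open>z\<close>. A pair of vertices is accounted for when the first of its ends disappears, since
  at that moment the removed pair was at least as heavy. \<open>Y\<close> holds one end of each
  removed pair and \<open>\<pi>\<close> gives the partner.\<close>

lemma greedy_matching:
  fixes w :: "'a \<Rightarrow> 'a \<Rightarrow> nat"
  assumes "finite V" and sym: "\<And>u v. w u v = w v u"
  shows "\<exists>Y \<pi> z. Y \<subseteq> V \<and> \<pi> ` Y \<subseteq> V \<and> inj_on \<pi> Y \<and> \<pi> ` Y \<inter> Y = {} \<and>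
    (\<Sum>v\<in>V. z v) = 2 * (\<Sum>u\<in>Y. w u (\<pi> u)) \<and>
    (\<forall>u\<in>V. \<forall>v\<in>V. u \<noteq> v \<longrightarrow> w u v \<le> max (z u) (z v))"
  using assms(1)
proof (induction "card V" arbitrary: V rule: less_induct)
  case less
  show ?case
  proof (cases "\<exists>u\<in>V. \<exists>v\<in>V. u \<noteq> v")
    case False
    then show ?thesis
      by (intro exI[of _ "{}"] exI[of _ id] exI[of _ "\<lambda>_. 0"]) auto
  next
    case True
    define Q where "Q = {(u, v). u \<in> V \<and> v \<in> V \<and> u \<noteq> v}"
    have Q: "finite Q" "Q \<noteq> {}"
      using True less.prems unfolding Q_def by (auto intro: finite_subset[of _ "V \<times> V"])
    have "Max (case_prod w ` Q) \<in> case_prod w ` Q" using Q by (intro Max_in) auto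
    then obtain x where x: "x \<in> Q" "case_prod w x = Max (case_prod w ` Q)" by auto
    obtain a b where ab: "x = (a, b)" by (cases x)
    have a: "a \<in> V" "b \<in> V" "a \<noteq> b" using x(1) unfolding ab Q_def by auto
    have top: "w u v \<le> w a b" if "u \<in> V" "v \<in> V" "u \<noteq> v" for u v
    proof -
      have "case_prod w (u, v) \<le> case_prod w x"
        unfolding x(2) by (rule Max_ge) (use Q that in \<open>auto simp: Q_def intro!: image_eqI[of _ _ "(u, v)"]\<close>)
      then show ?thesis unfolding ab by simp
    qed
    define V' where "V' = V - {a, b}"
    have V: "V = insert a (insert b V')" "a \<notin> insert b V'" "b \<notin> V'" "finite V'"
      using a less.prems unfolding V'_def by auto
    then have cV: "card V' < card V" by simp
    obtain Y \<pi> z where IH: "Y \<subseteq> V'" "\<pi> ` Y \<subseteq> V'" "inj_on \<pi> Y" "\<pi> ` Y \<inter> Y = {}"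
      "(\<Sum>v\<in>V'. z v) = 2 * (\<Sum>u\<in>Y. w u (\<pi> u))"
      "\<forall>u\<in>V'. \<forall>v\<in>V'. u \<noteq> v \<longrightarrow> w u v \<le> max (z u) (z v)"
      using less.hyps[OF cV V(4)] by (elim exE conjE)
    have nY: "a \<notin> Y" "b \<notin> Y" "a \<notin> \<pi> ` Y" "b \<notin> \<pi> ` Y" and fY: "finite Y"
      using IH V by (auto intro: finite_subset)
    define \<pi>' where "\<pi>' = \<pi>(a := b)"
    define z' where "z' = z(a := w a b, b := w a b)"
    have im: "\<pi>' ` Y = \<pi> ` Y" "\<pi>' a = b" using nY unfolding \<pi>'_def by auto
    show ?thesis
    proof (intro exI[of _ "insert a Y"] exI[of _ \<pi>'] exI[of _ z'] conjI)
      show "insert a Y \<subseteq> V" "\<pi>' ` insert a Y \<subseteq> V" using im IH V by auto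
      have "inj_on \<pi>' Y" using IH(3) nY unfolding \<pi>'_def by (simp add: inj_on_def)
      then show "inj_on \<pi>' (insert a Y)" using im nY by auto
      show "\<pi>' ` insert a Y \<inter> insert a Y = {}" using im nY IH(4) a by auto
      have "(\<Sum>v\<in>V. z' v) = z' a + (z' b + (\<Sum>v\<in>V'. z' v))" using V by simp
      also have "(\<Sum>v\<in>V'. z' v) = (\<Sum>v\<in>V'. z v)"
        using V unfolding z'_def by (intro sum.cong) auto
      also have "z' a + (z' b + (\<Sum>v\<in>V'. z v)) = 2 * (w a b + (\<Sum>u\<in>Y. w u (\<pi> u)))"
        using a IH unfolding z'_def by simp
      also have "(\<Sum>u\<in>Y. w u (\<pi> u)) = (\<Sum>u\<in>Y. w u (\<pi>' u))"
        using nY unfolding \<pi>'_def by (intro sum.cong) auto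
      finally show "(\<Sum>v\<in>V. z' v) = 2 * (\<Sum>u\<in>insert a Y. w u (\<pi>' u))"
        using fY nY im by simp
      show "\<forall>u\<in>V. \<forall>v\<in>V. u \<noteq> v \<longrightarrow> w u v \<le> max (z' u) (z' v)"
      proof (intro ballI impI)
        fix u v assume uv: "u \<in> V" "v \<in> V" "u \<noteq> v"
        show "w u v \<le> max (z' u) (z' v)"
        proof (cases "u \<in> V' \<and> v \<in> V'")
          case True
          then have "z' u = z u" "z' v = z v" using V unfolding z'_def by auto
          then show ?thesis using IH(6) True uv by simp
        next
          case False
          then have "z' u = w a b \<or> z' v = w a b" using uv V unfolding z'_def by auto
          then show ?thesis using top[OF uv] by auto
        qed
      qed
    qed
  qed
qed

lemma card_UN_le_mult:
  assumes "finite I" "\<And>i. i \<in> I \<Longrightarrow> real (card (A i)) \<le> B"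
  shows "real (card (\<Union>i\<in>I. A i)) \<le> real (card I) * B"
proof -
  have "real (card (\<Union>i\<in>I. A i)) \<le> real (\<Sum>i\<in>I. card (A i))"
    using card_UN_le[OF assms(1)] by (metis of_nat_le_iff)
  also have "\<dots> \<le> (\<Sum>i\<in>I. B)" unfolding of_nat_sum by (intro sum_mono assms)
  finally show ?thesis by simp
qed

section \<open>Random signs with answers\<close>

lemma sum_Pow_one_element:
  assumes "finite e"
  shows "(\<Sum>S\<in>{S \<in> Pow e. card (S \<inter> Y) = 1}. F S) = (\<Sum>u\<in>e \<inter> Y. \<Sum>P\<in>Pow (e - Y). F (insert u P))"
proof -
  have "(\<Sum>u\<in>e \<inter> Y. \<Sum>P\<in>Pow (e - Y). F (insert u P)) = (\<Sum>x\<in>(e \<inter> Y) \<times> Pow (e - Y). F (insert (fst x) (snd x)))"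
    by (simp add: sum.cartesian_product case_prod_beta)
  also have "\<dots> = (\<Sum>S\<in>{S \<in> Pow e. card (S \<inter> Y) = 1}. F S)"
  proof (rule sum.reindex_bij_betw, unfold bij_betw_def, intro conjI)
    show "inj_on (\<lambda>x. insert (fst x) (snd x)) ((e \<inter> Y) \<times> Pow (e - Y))"
    proof (rule inj_onI)
      fix x y assume x: "x \<in> (e \<inter> Y) \<times> Pow (e - Y)" and y: "y \<in> (e \<inter> Y) \<times> Pow (e - Y)"
        and eq: "insert (fst x) (snd x) = insert (fst y) (snd y)"
      have "insert (fst x) (snd x) \<inter> Y = {fst x}" "insert (fst y) (snd y) \<inter> Y = {fst y}" using x y by auto
      moreover have "insert (fst x) (snd x) - Y = snd x" "insert (fst y) (snd y) - Y = snd y" using x y by auto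
      ultimately show "x = y" using eq by (metis prod_eqI singleton_inject)
    qed
    show "(\<lambda>x. insert (fst x) (snd x)) ` ((e \<inter> Y) \<times> Pow (e - Y)) = {S \<in> Pow e. card (S \<inter> Y) = 1}"
    proof (intro equalityI subsetI)
      fix S assume "S \<in> (\<lambda>x. insert (fst x) (snd x)) ` ((e \<inter> Y) \<times> Pow (e - Y))"
      then obtain u P where S: "S = insert u P" "u \<in> e \<inter> Y" "P \<subseteq> e - Y" by auto
      then have "S \<inter> Y = {u}" "S \<in> Pow e" by auto
      then show "S \<in> {S \<in> Pow e. card (S \<inter> Y) = 1}" by simp
    next
      fix S assume S: "S \<in> {S \<in> Pow e. card (S \<inter> Y) = 1}"
      then obtain u where u: "S \<inter> Y = {u}" by (auto simp: card_1_singleton_iff)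
      then have "S = insert u (S - Y)" by auto
      moreover have "(u, S - Y) \<in> (e \<inter> Y) \<times> Pow (e - Y)" using S u by auto
      ultimately show "S \<in> (\<lambda>x. insert (fst x) (snd x)) ` ((e \<inter> Y) \<times> Pow (e - Y))"
        by (intro image_eqI[of _ _ "(u, S - Y)"]) auto
    qed
  qed
  finally show ?thesis by simp
qed

text \<open>Random signs \<open>chi {v}\<close> are put on \<open>R\<close>, random functions \<open>y u\<close> of these signs on \<open>Y\<close>, and
  \<open>0\<close> elsewhere.\<close>

definition mixed :: "'a set \<Rightarrow> 'a set \<Rightarrow> ('a \<Rightarrow> 'a set \<Rightarrow> real) \<Rightarrow> 'a set \<Rightarrow> 'a \<Rightarrow> real" where
  "mixed R Y y X v = (if v \<in> Y then y v X else if v \<in> R then chi {v} X else 0)"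

lemma prod_mixed:
  assumes "finite S" "R \<inter> Y = {}"
  shows "(\<Prod>v\<in>S. mixed R Y y X v) =
    (if S \<subseteq> R \<union> Y then chi (S - Y) X * (\<Prod>u\<in>S \<inter> Y. y u X) else 0)"
proof (cases "S \<subseteq> R \<union> Y")
  case False
  then obtain v where "v \<in> S" "v \<notin> R" "v \<notin> Y" by auto
  then have "(\<Prod>v\<in>S. mixed R Y y X v) = 0"
    using assms by (intro prod_zero) (auto simp: mixed_def intro!: bexI[of _ v])
  then show ?thesis using False by simp
next
  case True
  have "(\<Prod>v\<in>S. mixed R Y y X v) = (\<Prod>v\<in>S - Y. mixed R Y y X v) * (\<Prod>v\<in>S \<inter> Y. mixed R Y y X v)"
    using assms(1) by (subst prod.union_disjoint[symmetric]) (auto intro: prod.cong)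
  also have "(\<Prod>v\<in>S - Y. mixed R Y y X v) = chi (S - Y) X"
    unfolding chi_def mixed_def using True by (intro prod.cong) auto
  also have "(\<Prod>v\<in>S \<inter> Y. mixed R Y y X v) = (\<Prod>u\<in>S \<inter> Y. y u X)"
    unfolding mixed_def by (intro prod.cong) auto
  finally show ?thesis using True by simp
qed

section \<open>What an upper bound on the polynomial says about codegrees\<close>

locale uniform_poly =
  fixes k :: nat and c :: "nat \<Rightarrow> real" and E :: "'a set set" and C :: real
  assumes finE: "finite E" and card_edge: "\<And>e. e \<in> E \<Longrightarrow> card e = k" and k3: "3 \<le> k"
    and c2: "c 2 < 0" and cC: "\<And>j. j \<le> k \<Longrightarrow> \<bar>c j\<bar> \<le> C"
begin

text \<open>Isolated vertices are dropped, so |V| is at most k times the number of edges; this later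
  bounds the number of answers.\<close>

definition V where "V = \<Union>E"
definition codeg where "codeg u v = card {e \<in> E. u \<in> e \<and> v \<in> e}"
definition deg where "deg v = card {e \<in> E. v \<in> e}"

lemma fin_edge: "e \<in> E \<Longrightarrow> finite e"
  using card_edge k3 by (metis card.infinite not_numeral_le_zero)

lemma finV: "finite V" unfolding V_def using finE fin_edge by auto

lemma edge_V: "e \<in> E \<Longrightarrow> e \<subseteq> V" unfolding V_def by auto

lemma card_V_le: "card V \<le> k * card E"
proof -
  have "card V \<le> (\<Sum>e\<in>E. card e)" unfolding V_def by (rule card_Union_le_sum_card)
  then show ?thesis using card_edge by (simp add: mult.commute)
qed

lemma C_pos: "C > 0" using cC[of 2] c2 k3 by linarith

lemma card_Pow_edge: "e \<in> E \<Longrightarrow> card (Pow e) = 2 ^ k"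
  using fin_edge card_edge by (simp add: card_Pow)

lemma codeg_sym: "codeg u v = codeg v u"
  unfolding codeg_def by (rule arg_cong[where f = card]) auto

lemma sum_codeg_le: "finite W \<Longrightarrow> (\<Sum>v\<in>W. codeg u v) \<le> k * deg u"
proof -
  assume W: "finite W"
  have "(\<Sum>v\<in>W. codeg u v) = (\<Sum>v\<in>W. \<Sum>e\<in>{e. e \<in> {e \<in> E. u \<in> e} \<and> v \<in> e}. 1)"
    unfolding codeg_def by (intro sum.cong) (auto intro!: arg_cong[where f = card])
  also have "\<dots> = (\<Sum>e\<in>{e \<in> E. u \<in> e}. \<Sum>v\<in>{v. v \<in> W \<and> v \<in> e}. 1)"
    by (rule sum.swap_restrict[symmetric]) (use W finE in auto)
  also have "\<dots> \<le> (\<Sum>e\<in>{e \<in> E. u \<in> e}. k)"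
  proof (rule sum_mono)
    fix e assume e: "e \<in> {e \<in> E. u \<in> e}"
    have "card {v. v \<in> W \<and> v \<in> e} \<le> card e" using e fin_edge by (intro card_mono) auto
    then show "(\<Sum>v\<in>{v. v \<in> W \<and> v \<in> e}. 1) \<le> k" using e card_edge by simp
  qed
  finally show ?thesis unfolding deg_def by (simp add: mult.commute)
qed

lemma sum_edges_vertices:
  fixes f :: "'a \<Rightarrow> real"
  assumes "finite Y"
  shows "(\<Sum>e\<in>E. \<Sum>u\<in>e \<inter> Y. f u) = (\<Sum>u\<in>Y. real (deg u) * f u)"
proof -
  have "(\<Sum>e\<in>E. \<Sum>u\<in>e \<inter> Y. f u) = (\<Sum>e\<in>E. \<Sum>u\<in>{u. u \<in> Y \<and> u \<in> e}. f u)"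
    by (intro sum.cong) auto
  also have "\<dots> = (\<Sum>u\<in>Y. \<Sum>e\<in>{e. e \<in> E \<and> u \<in> e}. f u)"
    by (rule sum.swap_restrict) (use assms finE in auto)
  finally show ?thesis unfolding deg_def by simp
qed

lemma sum_edges_pairs:
  fixes f :: "'a \<times> 'a \<Rightarrow> real"
  assumes "finite Q"
  shows "(\<Sum>e\<in>E. \<Sum>x\<in>{x \<in> Q. fst x \<in> e \<and> snd x \<in> e}. f x) = (\<Sum>x\<in>Q. real (codeg (fst x) (snd x)) * f x)"
proof -
  have "(\<Sum>e\<in>E. \<Sum>x\<in>{x. x \<in> Q \<and> (fst x \<in> e \<and> snd x \<in> e)}. f x)
      = (\<Sum>x\<in>Q. \<Sum>e\<in>{e. e \<in> E \<and> (fst x \<in> e \<and> snd x \<in> e)}. f x)"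
    by (rule sum.swap_restrict) (use assms finE in auto)
  then show ?thesis unfolding codeg_def by simp
qed

text \<open>Nonempty sets S without a vertex in Y average to 0, being characters. Those with one
  vertex u in Y are \<open>insert u P\<close> and measure the correlation of the answer of u with
  the character of P: this is the gain. The sets with two or more vertices in Y form the second sum,
  which has to be controlled as a loss.\<close>

lemma avg_edge_poly_mixed:
  assumes R: "R \<subseteq> V" and RY: "R \<inter> Y = {}"
  shows "avg V (\<lambda>X. edge_poly c E (mixed R Y y X)) =
    (\<Sum>e\<in>E. (\<Sum>u\<in>e \<inter> Y. \<Sum>P\<in>Pow (e \<inter> R). c (Suc (card P)) * avg V (\<lambda>X. chi P X * y u X))
     + (\<Sum>S\<in>{S \<in> Pow (e \<inter> (R \<union> Y)). 2 \<le> card (S \<inter> Y)}. c (card S) * avg V (\<lambda>X. chi (S - Y) X * (\<Prod>u\<in>S \<inter> Y. y u X))))"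
proof -
  have "avg V (\<lambda>X. edge_poly c E (mixed R Y y X)) =
     (\<Sum>e\<in>E. \<Sum>S\<in>Pow e - {{}}. c (card S) * avg V (\<lambda>X. \<Prod>v\<in>S. mixed R Y y X v))"
    unfolding edge_poly_def avg_sum avg_cmult ..
  also have "\<dots> = (\<Sum>e\<in>E. (\<Sum>u\<in>e \<inter> Y. \<Sum>P\<in>Pow (e \<inter> R). c (Suc (card P)) * avg V (\<lambda>X. chi P X * y u X))
     + (\<Sum>S\<in>{S \<in> Pow (e \<inter> (R \<union> Y)). 2 \<le> card (S \<inter> Y)}. c (card S) * avg V (\<lambda>X. chi (S - Y) X * (\<Prod>u\<in>S \<inter> Y. y u X))))"
  proof (rule sum.cong[OF refl])
    fix e assume e: "e \<in> E"
    have fe: "finite e" using fin_edge[OF e] .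
    define F where "F S = c (card S) * (if S \<subseteq> R \<union> Y then avg V (\<lambda>X. chi (S - Y) X * (\<Prod>u\<in>S \<inter> Y. y u X)) else 0)" for S
    have F0: "avg V (\<lambda>X. 0) = 0" unfolding avg_def by simp
    have "(\<Sum>S\<in>Pow e - {{}}. c (card S) * avg V (\<lambda>X. \<Prod>v\<in>S. mixed R Y y X v)) = (\<Sum>S\<in>Pow e - {{}}. F S)"
    proof (rule sum.cong[OF refl])
      fix S assume "S \<in> Pow e - {{}}"
      then have "finite S" using fe finite_subset by auto
      then show "c (card S) * avg V (\<lambda>X. \<Prod>v\<in>S. mixed R Y y X v) = F S"
        unfolding F_def by (cases "S \<subseteq> R \<union> Y") (simp_all only: prod_mixed[OF _ RY] F0 if_True if_False)
    qed
    also have "\<dots> = (\<Sum>S\<in>{S \<in> Pow e. card (S \<inter> Y) = 1} \<union> {S \<in> Pow e. 2 \<le> card (S \<inter> Y)}. F S)"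
    proof (rule sum.mono_neutral_right)
      show "\<forall>S\<in>(Pow e - {{}}) - ({S \<in> Pow e. card (S \<inter> Y) = 1} \<union> {S \<in> Pow e. 2 \<le> card (S \<inter> Y)}). F S = 0"
      proof
        fix S assume S: "S \<in> (Pow e - {{}}) - ({S \<in> Pow e. card (S \<inter> Y) = 1} \<union> {S \<in> Pow e. 2 \<le> card (S \<inter> Y)})"
        then have "card (S \<inter> Y) = 0" by auto
        moreover have "finite (S \<inter> Y)" using S fe finite_subset[of S e] by auto
        ultimately have SY: "S \<inter> Y = {}" by simp
        then have "F S = c (card S) * (if S \<subseteq> R then avg V (chi S) else 0)"
          unfolding F_def by (simp add: Diff_triv) (auto intro!: arg_cong[where f = "avg V"])
        moreover have "S \<noteq> {}" using S by auto
        ultimately show "F S = 0" using R avg_chi[OF finV, of S] by auto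
      qed
    qed (use fe in auto)
    also have "\<dots> = (\<Sum>S\<in>{S \<in> Pow e. card (S \<inter> Y) = 1}. F S) + (\<Sum>S\<in>{S \<in> Pow e. 2 \<le> card (S \<inter> Y)}. F S)"
      using fe by (intro sum.union_disjoint) auto
    also have "(\<Sum>S\<in>{S \<in> Pow e. card (S \<inter> Y) = 1}. F S) = (\<Sum>u\<in>e \<inter> Y. \<Sum>P\<in>Pow (e - Y). F (insert u P))"
      by (rule sum_Pow_one_element[OF fe])
    also have "\<dots> = (\<Sum>u\<in>e \<inter> Y. \<Sum>P\<in>Pow (e \<inter> R). c (Suc (card P)) * avg V (\<lambda>X. chi P X * y u X))"
    proof (rule sum.cong[OF refl])
      fix u assume u: "u \<in> e \<inter> Y"
      show "(\<Sum>P\<in>Pow (e - Y). F (insert u P)) = (\<Sum>P\<in>Pow (e \<inter> R). c (Suc (card P)) * avg V (\<lambda>X. chi P X * y u X))"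
      proof (rule sum.mono_neutral_cong_right)
        show "\<forall>P\<in>Pow (e - Y) - Pow (e \<inter> R). F (insert u P) = 0" unfolding F_def by auto
        fix P assume P: "P \<in> Pow (e \<inter> R)"
        then have "insert u P \<inter> Y = {u}" "insert u P - Y = P" "u \<notin> P" "finite P" "insert u P \<subseteq> R \<union> Y"
          using u RY fe by (auto intro: finite_subset)
        then show "F (insert u P) = c (Suc (card P)) * avg V (\<lambda>X. chi P X * y u X)"
          unfolding F_def by simp
      qed (use fe RY in auto)
    qed
    also have "(\<Sum>S\<in>{S \<in> Pow e. 2 \<le> card (S \<inter> Y)}. F S) = (\<Sum>S\<in>{S \<in> Pow (e \<inter> (R \<union> Y)). 2 \<le> card (S \<inter> Y)}.
        c (card S) * avg V (\<lambda>X. chi (S - Y) X * (\<Prod>u\<in>S \<inter> Y. y u X)))"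
      by (rule sum.mono_neutral_cong_right) (use fe in \<open>auto simp: F_def\<close>)
    finally show "(\<Sum>S\<in>Pow e - {{}}. c (card S) * avg V (\<lambda>X. \<Prod>v\<in>S. mixed R Y y X v)) =
      (\<Sum>u\<in>e \<inter> Y. \<Sum>P\<in>Pow (e \<inter> R). c (Suc (card P)) * avg V (\<lambda>X. chi P X * y u X))
     + (\<Sum>S\<in>{S \<in> Pow (e \<inter> (R \<union> Y)). 2 \<le> card (S \<inter> Y)}. c (card S) * avg V (\<lambda>X. chi (S - Y) X * (\<Prod>u\<in>S \<inter> Y. y u X)))" .
  qed
  finally show ?thesis .
qed

lemma higher_levels_le:
  assumes e: "e \<in> E" and "\<S> \<subseteq> Pow e" and "\<And>S. S \<in> \<S> \<Longrightarrow> \<bar>a S\<bar> \<le> Q" and "0 \<le> Q"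
  shows "\<bar>\<Sum>S\<in>\<S>. c (card S) * a S\<bar> \<le> 2 ^ k * C * Q"
proof -
  have "\<bar>\<Sum>S\<in>\<S>. c (card S) * a S\<bar> \<le> (\<Sum>S\<in>\<S>. \<bar>c (card S) * a S\<bar>)" by (rule sum_abs)
  also have "\<dots> \<le> (\<Sum>S\<in>\<S>. C * Q)"
  proof (rule sum_mono)
    fix S assume S: "S \<in> \<S>"
    then have "card S \<le> k" using assms(2) card_mono[OF fin_edge[OF e], of S] card_edge[OF e] by auto
    then show "\<bar>c (card S) * a S\<bar> \<le> C * Q"
      unfolding abs_mult using assms(3)[OF S] cC C_pos by (intro mult_mono) auto
  qed
  also have "\<dots> = real (card \<S>) * (C * Q)" by simp
  also have "\<dots> \<le> 2 ^ k * (C * Q)"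
  proof (rule mult_right_mono)
    have "card \<S> \<le> card (Pow e)" using assms(2) fin_edge[OF e] by (intro card_mono) auto
    then show "real (card \<S>) \<le> 2 ^ k"
      using card_Pow_edge[OF e] by (metis of_nat_le_iff of_nat_numeral of_nat_power)
  qed (use C_pos assms in auto)
  finally show ?thesis by (simp add: mult.assoc)
qed

lemma avg_edge_poly_le:
  assumes ub: "\<And>s. (\<And>v. \<bar>s v\<bar> \<le> 1) \<Longrightarrow> edge_poly c E s \<le> \<tau>" and s: "\<And>X v. \<bar>s X v\<bar> \<le> 1"
  shows "avg V (\<lambda>X. edge_poly c E (s X)) \<le> \<tau>"
proof -
  have "avg V (\<lambda>X. edge_poly c E (s X)) \<le> avg V (\<lambda>_. \<tau>)" by (intro avg_mono ub s)
  then show ?thesis by (simp add: avg_const finV)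
qed

text \<open>In each matched pair one end repeats the random sign of the other, negated and scaled by
  \<open>\<epsilon>\<close>. A term with one vertex in Y survives only on a matched pair, with value
  \<open>\<epsilon>\<close> |c 2|. A term with more survives only on a union of matched pairs, so
  its edge contains such a pair and the loss, of order \<open>\<epsilon>\<close>^2, can be charged
  to it. Summed over the edges, the number of contained pairs is the total codegree of the matching,
  which is half the total weight.\<close>

lemma vertex_weights:
  assumes ub: "\<And>s. (\<And>v. \<bar>s v\<bar> \<le> 1) \<Longrightarrow> edge_poly c E s \<le> \<tau>"
  obtains z :: "'a \<Rightarrow> nat" where
    "\<And>u v. u \<in> V \<Longrightarrow> v \<in> V \<Longrightarrow> u \<noteq> v \<Longrightarrow> codeg u v \<le> max (z u) (z v)"
    "(c 2)\<^sup>2 * real (\<Sum>v\<in>V. z v) \<le> 8 * (2 ^ k * C) * \<tau>"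
proof -
  obtain Y \<pi> z where Y: "Y \<subseteq> V" "\<pi> ` Y \<subseteq> V" "inj_on \<pi> Y" "\<pi> ` Y \<inter> Y = {}"
    and sz: "(\<Sum>v\<in>V. z v) = 2 * (\<Sum>u\<in>Y. codeg u (\<pi> u))"
    and z: "\<forall>u\<in>V. \<forall>v\<in>V. u \<noteq> v \<longrightarrow> codeg u v \<le> max (z u) (z v)"
    using greedy_matching[of V codeg, OF finV codeg_sym] by (elim exE conjE)
  have fY: "finite Y" using Y finV finite_subset by blast
  define A where "A = 2 ^ k * C"
  have A: "A > 0" unfolding A_def using C_pos by simp
  \<comment> \<open>The maximiser of \<open>\<epsilon>\<close> |c 2| - \<open>\<epsilon>\<close>^2
    A, with maximum (c 2)^2 / (4 A). It is at most 1 because |c 2| \<le> A.\<close>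
  define \<epsilon> where "\<epsilon> = - c 2 / (2 * A)"
  have cA: "- c 2 \<le> A"
  proof -
    have "- c 2 \<le> C" using cC[of 2] k3 by linarith
    also have "C \<le> 2 ^ k * C" using C_pos by simp
    finally show ?thesis unfolding A_def .
  qed
  have \<epsilon>: "0 < \<epsilon>" "\<epsilon> \<le> 1" unfolding \<epsilon>_def using c2 A cA by (auto simp: field_simps)
  define y where "y u = (\<lambda>X. - \<epsilon> * chi {\<pi> u} X)" for u
  define R where "R = \<pi> ` Y"
  define N where "N e = {u \<in> Y. u \<in> e \<and> \<pi> u \<in> e}" for e
  have fN: "finite (N e)" for e unfolding N_def using fY by auto
  have bd: "\<bar>mixed R Y y X v\<bar> \<le> 1" for X v
    using \<epsilon> unfolding mixed_def y_def by (auto simp: abs_mult abs_chi)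
  have prody: "(\<Prod>u\<in>T. y u X) = (- \<epsilon>) ^ card T * chi (\<pi> ` T) X" if "T \<subseteq> Y" for T X
  proof -
    have "inj_on \<pi> T" using Y(3) that inj_on_subset by blast
    then show ?thesis unfolding y_def chi_def by (simp only: prod.distrib prod_constant) (simp add: prod.reindex)
  qed
  have "real (card (N e)) * (\<epsilon> * (- c 2) - \<epsilon>\<^sup>2 * A) \<le>
     (\<Sum>u\<in>e \<inter> Y. \<Sum>P\<in>Pow (e \<inter> R). c (Suc (card P)) * avg V (\<lambda>X. chi P X * y u X))
     + (\<Sum>S\<in>{S \<in> Pow (e \<inter> (R \<union> Y)). 2 \<le> card (S \<inter> Y)}. c (card S) * avg V (\<lambda>X. chi (S - Y) X * (\<Prod>u\<in>S \<inter> Y. y u X)))"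
    if e: "e \<in> E" for e
  proof -
    have fe: "finite e" using fin_edge[OF e] .
    have l1: "(\<Sum>P\<in>Pow (e \<inter> R). c (Suc (card P)) * avg V (\<lambda>X. chi P X * y u X)) = (if u \<in> N e then \<epsilon> * (- c 2) else 0)"
      if u: "u \<in> e \<inter> Y" for u
    proof -
      have av: "avg V (\<lambda>X. chi P X * y u X) = (if P = {\<pi> u} then - \<epsilon> else 0)" if "P \<in> Pow (e \<inter> R)" for P
      proof -
        have "avg V (\<lambda>X. chi P X * y u X) = avg V (\<lambda>X. - \<epsilon> * (chi P X * chi {\<pi> u} X))"
          unfolding y_def by (simp add: algebra_simps)
        also have "\<dots> = - \<epsilon> * (if P = {\<pi> u} then 1 else 0)"
          unfolding avg_cmult using that u Y edge_V[OF e]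
          by (subst avg_chi_mult[OF finV]) auto
        finally show ?thesis by simp
      qed
      have "(\<Sum>P\<in>Pow (e \<inter> R). c (Suc (card P)) * avg V (\<lambda>X. chi P X * y u X))
         = (\<Sum>P\<in>Pow (e \<inter> R). if P = {\<pi> u} then c 2 * (- \<epsilon>) else 0)"
        by (intro sum.cong refl) (auto simp: av numeral_2_eq_2)
      also have "\<dots> = (if {\<pi> u} \<in> Pow (e \<inter> R) then c 2 * (- \<epsilon>) else 0)"
        using fe by (subst sum.delta) auto
      also have "{\<pi> u} \<in> Pow (e \<inter> R) \<longleftrightarrow> u \<in> N e" using u unfolding N_def R_def by auto
      finally show ?thesis by (simp add: mult.commute)
    qed
    have "(\<Sum>u\<in>e \<inter> Y. \<Sum>P\<in>Pow (e \<inter> R). c (Suc (card P)) * avg V (\<lambda>X. chi P X * y u X))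
       = (\<Sum>u\<in>e \<inter> Y. if u \<in> N e then \<epsilon> * (- c 2) else 0)"
      by (intro sum.cong refl l1)
    also have "\<dots> = (\<Sum>u\<in>N e. \<epsilon> * (- c 2))"
      by (rule sum.mono_neutral_cong_right) (use fe in \<open>auto simp: N_def\<close>)
    finally have L1: "(\<Sum>u\<in>e \<inter> Y. \<Sum>P\<in>Pow (e \<inter> R). c (Suc (card P)) * avg V (\<lambda>X. chi P X * y u X))
       = real (card (N e)) * (\<epsilon> * (- c 2))" by simp
    have "\<bar>\<Sum>S\<in>{S \<in> Pow (e \<inter> (R \<union> Y)). 2 \<le> card (S \<inter> Y)}. c (card S) * avg V (\<lambda>X. chi (S - Y) X * (\<Prod>u\<in>S \<inter> Y. y u X))\<bar>
      \<le> 2 ^ k * C * (\<epsilon>\<^sup>2 * real (card (N e)))"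
    proof (rule higher_levels_le[OF e])
      fix S assume S: "S \<in> {S \<in> Pow (e \<inter> (R \<union> Y)). 2 \<le> card (S \<inter> Y)}"
      have "avg V (\<lambda>X. chi (S - Y) X * (\<Prod>u\<in>S \<inter> Y. y u X))
         = avg V (\<lambda>X. (- \<epsilon>) ^ card (S \<inter> Y) * (chi (S - Y) X * chi (\<pi> ` (S \<inter> Y)) X))"
        by (simp add: prody algebra_simps)
      also have "\<dots> = (- \<epsilon>) ^ card (S \<inter> Y) * (if S - Y = \<pi> ` (S \<inter> Y) then 1 else 0)"
        unfolding avg_cmult using S Y edge_V[OF e] by (subst avg_chi_mult[OF finV]) auto
      finally have av: "avg V (\<lambda>X. chi (S - Y) X * (\<Prod>u\<in>S \<inter> Y. y u X))
         = (- \<epsilon>) ^ card (S \<inter> Y) * (if S - Y = \<pi> ` (S \<inter> Y) then 1 else 0)" .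
      show "\<bar>avg V (\<lambda>X. chi (S - Y) X * (\<Prod>u\<in>S \<inter> Y. y u X))\<bar> \<le> \<epsilon>\<^sup>2 * real (card (N e))"
      proof (cases "S - Y = \<pi> ` (S \<inter> Y)")
        case True
        have "S \<inter> Y \<noteq> {}" using S by auto
        then obtain u where u: "u \<in> S \<inter> Y" by auto
        then have "\<pi> u \<in> S" using True by auto
        then have "u \<in> N e" using u S unfolding N_def by auto
        then have "1 \<le> card (N e)" using fN by (metis Suc_leI card_gt_0_iff empty_iff One_nat_def)
        then have n: "1 \<le> real (card (N e))" by simp
        have "\<bar>(- \<epsilon>) ^ card (S \<inter> Y)\<bar> = \<epsilon> ^ card (S \<inter> Y)" using \<epsilon> by (simp add: power_abs)
        also have "\<dots> \<le> \<epsilon>\<^sup>2" using S \<epsilon> by (intro power_decreasing) auto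
        also have "\<dots> \<le> \<epsilon>\<^sup>2 * real (card (N e))" using mult_left_mono[OF n, of "\<epsilon>\<^sup>2"] by simp
        finally show ?thesis unfolding av using True by simp
      next
        case False
        then show ?thesis unfolding av by simp
      qed
    qed auto
    then show ?thesis unfolding L1 A_def by (simp add: algebra_simps)
  qed
  then have "(\<Sum>e\<in>E. real (card (N e)) * (\<epsilon> * (- c 2) - \<epsilon>\<^sup>2 * A)) \<le> avg V (\<lambda>X. edge_poly c E (mixed R Y y X))"
    unfolding avg_edge_poly_mixed[OF Y(2)[folded R_def] Y(4)[folded R_def]] by (intro sum_mono)
  also have "\<dots> \<le> \<tau>" by (rule avg_edge_poly_le[OF ub bd])
  finally have le: "(\<Sum>e\<in>E. real (card (N e))) * (\<epsilon> * (- c 2) - \<epsilon>\<^sup>2 * A) \<le> \<tau>"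
    by (simp add: sum_distrib_right)
  have "(\<Sum>e\<in>E. real (card (N e))) = real (\<Sum>u\<in>Y. codeg u (\<pi> u))"
  proof -
    have "(\<Sum>e\<in>E. real (card (N e))) = (\<Sum>e\<in>E. \<Sum>u\<in>{u. u \<in> Y \<and> (u \<in> e \<and> \<pi> u \<in> e)}. 1)"
      unfolding N_def by simp
    also have "\<dots> = (\<Sum>u\<in>Y. \<Sum>e\<in>{e. e \<in> E \<and> (u \<in> e \<and> \<pi> u \<in> e)}. 1)"
      by (rule sum.swap_restrict) (use fY finE in auto)
    finally show ?thesis unfolding codeg_def by simp
  qed
  moreover have "\<epsilon> * (- c 2) - \<epsilon>\<^sup>2 * A = (c 2)\<^sup>2 / (4 * A)"
    unfolding \<epsilon>_def using A by (simp add: field_simps power2_eq_square)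
  ultimately have "real (\<Sum>u\<in>Y. codeg u (\<pi> u)) * ((c 2)\<^sup>2 / (4 * A)) \<le> \<tau>" using le by simp
  then have "(c 2)\<^sup>2 * real (\<Sum>v\<in>V. z v) \<le> 8 * A * \<tau>"
    unfolding sz using A by (simp add: field_simps)
  then show thesis using that[of z] z unfolding A_def by blast
qed

text \<open>Each u in L answers the signs on R with -\<open>\<eta>\<close> times their sum weighted
  by the codegrees along Q. Only one-element sets P correlate with a linear answer, so the gain is
  \<open>\<eta>\<close> |c 2| times the sum of squared codegrees. The loss is governed by the second
  moments of the answers, weighted by degrees, hence at most of order D \<open>\<eta>\<close>^2
  times the same sum.\<close>

lemma heavy_light_bound:
  assumes ub: "\<And>s. (\<And>v. \<bar>s v\<bar> \<le> 1) \<Longrightarrow> edge_poly c E s \<le> \<tau>"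
    and R: "R \<subseteq> V" and L: "L \<subseteq> V" and RL: "R \<inter> L = {}"
    and D: "\<And>u. u \<in> L \<Longrightarrow> real (deg u) \<le> D" "D > 0" and Q: "Q \<subseteq> R \<times> L"
  shows "(c 2)\<^sup>2 * (\<Sum>(a, u)\<in>Q. real (codeg a u) ^ 2) \<le> 4 * (2 ^ k * C) * k * D * \<tau>"
proof -
  define A where "A = 2 ^ k * C"
  have A: "A > 0" unfolding A_def using C_pos by simp
  have cA: "- c 2 \<le> A"
  proof -
    have "- c 2 \<le> C" using cC[of 2] k3 by linarith
    also have "C \<le> 2 ^ k * C" using C_pos by simp
    finally show ?thesis unfolding A_def .
  qed
  have fR: "finite R" "finite L" using R L finV finite_subset by auto
  define b where "b a u = (if (a, u) \<in> Q then real (codeg a u) else 0)" for a u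
  have b0: "b a u \<ge> 0" for a u unfolding b_def by simp
  define \<Gamma> where "\<Gamma> = (\<Sum>u\<in>L. \<Sum>a\<in>R. (b a u)\<^sup>2)"
  have \<Gamma>: "\<Gamma> = (\<Sum>(a, u)\<in>Q. real (codeg a u) ^ 2)"
  proof -
    have "\<Gamma> = (\<Sum>a\<in>R. \<Sum>u\<in>L. (b a u)\<^sup>2)" unfolding \<Gamma>_def by (rule sum.swap)
    also have "\<dots> = (\<Sum>(a, u)\<in>R \<times> L. (b a u)\<^sup>2)" by (rule sum.cartesian_product)
    also have "\<dots> = (\<Sum>(a, u)\<in>Q. real (codeg a u) ^ 2)"
      by (rule sum.mono_neutral_cong_right) (use fR Q in \<open>auto simp: b_def\<close>)
    finally show ?thesis .
  qed
  have \<Gamma>0: "\<Gamma> \<ge> 0" unfolding \<Gamma>_def by (intro sum_nonneg) auto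
  \<comment> \<open>Two demands meet here. The codegrees at u sum to at most k D, so
    \<open>\<eta>\<close> k D \<le> 1 keeps the answers in [-1, 1]; and A D \<open>\<eta>\<close>
    \<le> |c 2| / 2 keeps the loss below half the gain.\<close>
  define \<eta> where "\<eta> = - c 2 / (2 * A * k * D)"
  have kD: "real k * D > 0" using k3 D by simp
  have \<eta>: "\<eta> > 0" "\<eta> * (k * D) \<le> 1"
    unfolding \<eta>_def using c2 A cA kD D k3 by (auto simp: field_simps)
  define y where "y u = (\<lambda>X. - \<eta> * (\<Sum>a\<in>R. b a u * chi {a} X))" for u
  have ybd: "\<bar>y u X\<bar> \<le> 1" if u: "u \<in> L" for u X
  proof -
    have "\<bar>\<Sum>a\<in>R. b a u * chi {a} X\<bar> \<le> (\<Sum>a\<in>R. \<bar>b a u * chi {a} X\<bar>)" by (rule sum_abs)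
    also have "\<dots> \<le> (\<Sum>a\<in>R. real (codeg u a))"
      by (intro sum_mono) (auto simp: abs_mult abs_chi b_def codeg_sym)
    also have "\<dots> \<le> real (k * deg u)" using sum_codeg_le[OF fR(1), of u] by (metis of_nat_sum of_nat_le_iff)
    also have "\<dots> \<le> k * D" using D(1)[OF u] by (simp add: mult_left_mono)
    finally have "\<bar>\<Sum>a\<in>R. b a u * chi {a} X\<bar> \<le> k * D" .
    then have "\<eta> * \<bar>\<Sum>a\<in>R. b a u * chi {a} X\<bar> \<le> \<eta> * (k * D)" using \<eta> by (intro mult_left_mono) auto
    moreover have "\<bar>y u X\<bar> = \<eta> * \<bar>\<Sum>a\<in>R. b a u * chi {a} X\<bar>"
      using \<eta> unfolding y_def by (simp add: abs_mult)
    ultimately show ?thesis using \<eta> by linarith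
  qed
  have bd: "\<bar>mixed R L y X v\<bar> \<le> 1" for X v
    using ybd unfolding mixed_def by (auto simp: abs_chi)
  have ychi: "avg V (\<lambda>X. chi P X * y u X) = - \<eta> * (\<Sum>a\<in>R. b a u * (if P = {a} then 1 else 0))" if "P \<subseteq> V" for P u
  proof -
    have "avg V (\<lambda>X. chi P X * y u X) = avg V (\<lambda>X. - \<eta> * (\<Sum>a\<in>R. b a u * (chi P X * chi {a} X)))"
      unfolding y_def by (simp add: algebra_simps sum_distrib_left)
    also have "\<dots> = - \<eta> * (\<Sum>a\<in>R. b a u * avg V (\<lambda>X. chi P X * chi {a} X))"
      unfolding avg_cmult avg_sum ..
    also have "(\<Sum>a\<in>R. b a u * avg V (\<lambda>X. chi P X * chi {a} X)) = (\<Sum>a\<in>R. b a u * (if P = {a} then 1 else 0))"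
      by (intro sum.cong refl arg_cong2[where f = "(*)"] avg_chi_mult[OF finV that]) (use R in auto)
    finally show ?thesis .
  qed
  define q where "q u = avg V (\<lambda>X. (y u X)\<^sup>2)" for u
  have q0: "q u \<ge> 0" for u unfolding q_def by (rule avg_nonneg) auto
  have q: "q u = \<eta>\<^sup>2 * (\<Sum>a\<in>R. (b a u)\<^sup>2)" for u
  proof -
    have "q u = avg V (\<lambda>X. - \<eta> * (\<Sum>a\<in>R. b a u * (chi {a} X * y u X)))"
      unfolding q_def y_def by (simp add: power2_eq_square sum_distrib_left sum_distrib_right algebra_simps)
    also have "\<dots> = - \<eta> * (\<Sum>a\<in>R. b a u * avg V (\<lambda>X. chi {a} X * y u X))"
      unfolding avg_cmult avg_sum ..
    also have "(\<Sum>a\<in>R. b a u * avg V (\<lambda>X. chi {a} X * y u X)) = (\<Sum>a\<in>R. b a u * (- \<eta> * b a u))"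
    proof (rule sum.cong[OF refl])
      fix a assume a: "a \<in> R"
      have "(\<Sum>a'\<in>R. b a' u * (if {a} = {a'} then 1 else 0)) = (\<Sum>a'\<in>R. if a' = a then b a u else 0)"
        by (intro sum.cong) auto
      also have "\<dots> = b a u" using a fR by simp
      finally show "b a u * avg V (\<lambda>X. chi {a} X * y u X) = b a u * (- \<eta> * b a u)"
        using ychi[of "{a}" u] a R by auto
    qed
    finally show ?thesis by (simp add: sum_distrib_left power2_eq_square algebra_simps sum_negf)
  qed
  have "\<eta> * (- c 2) * (\<Sum>x\<in>{x \<in> R \<times> L. fst x \<in> e \<and> snd x \<in> e}. b (fst x) (snd x)) - A * (\<Sum>u\<in>e \<inter> L. q u)
    \<le> (\<Sum>u\<in>e \<inter> L. \<Sum>P\<in>Pow (e \<inter> R). c (Suc (card P)) * avg V (\<lambda>X. chi P X * y u X))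
     + (\<Sum>S\<in>{S \<in> Pow (e \<inter> (R \<union> L)). 2 \<le> card (S \<inter> L)}. c (card S) * avg V (\<lambda>X. chi (S - L) X * (\<Prod>u\<in>S \<inter> L. y u X)))"
    if e: "e \<in> E" for e
  proof -
    have fe: "finite e" using fin_edge[OF e] .
    have l1: "(\<Sum>P\<in>Pow (e \<inter> R). c (Suc (card P)) * avg V (\<lambda>X. chi P X * y u X)) = (\<Sum>a\<in>e \<inter> R. \<eta> * (- c 2) * b a u)" for u
    proof -
      have "(\<Sum>P\<in>Pow (e \<inter> R). c (Suc (card P)) * avg V (\<lambda>X. chi P X * y u X))
         = (\<Sum>P\<in>Pow (e \<inter> R). c (Suc (card P)) * (- \<eta> * (\<Sum>a\<in>R. b a u * (if P = {a} then 1 else 0))))"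
        by (intro sum.cong refl) (use ychi edge_V[OF e] in auto)
      also have "\<dots> = (\<Sum>P\<in>Pow (e \<inter> R). \<Sum>a\<in>R. if P = {a} then \<eta> * (- c 2) * b a u else 0)"
        unfolding sum_distrib_left by (intro sum.cong refl) (auto simp: numeral_2_eq_2)
      also have "\<dots> = (\<Sum>a\<in>R. \<Sum>P\<in>Pow (e \<inter> R). if P = {a} then \<eta> * (- c 2) * b a u else 0)"
        by (rule sum.swap)
      also have "\<dots> = (\<Sum>a\<in>R. if a \<in> e then \<eta> * (- c 2) * b a u else 0)"
        by (intro sum.cong refl) (use fe in \<open>subst sum.delta, auto\<close>)
      also have "\<dots> = (\<Sum>a\<in>e \<inter> R. \<eta> * (- c 2) * b a u)"
        by (rule sum.mono_neutral_cong_right) (use fR in auto)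
      finally show ?thesis .
    qed
    have "(\<Sum>u\<in>e \<inter> L. \<Sum>P\<in>Pow (e \<inter> R). c (Suc (card P)) * avg V (\<lambda>X. chi P X * y u X))
      = (\<Sum>u\<in>e \<inter> L. \<Sum>a\<in>e \<inter> R. \<eta> * (- c 2) * b a u)" unfolding l1 ..
    also have "\<dots> = (\<Sum>a\<in>e \<inter> R. \<Sum>u\<in>e \<inter> L. \<eta> * (- c 2) * b a u)" by (rule sum.swap)
    also have "\<dots> = (\<Sum>(a, u)\<in>(e \<inter> R) \<times> (e \<inter> L). \<eta> * (- c 2) * b a u)" by (rule sum.cartesian_product)
    also have "(e \<inter> R) \<times> (e \<inter> L) = {x \<in> R \<times> L. fst x \<in> e \<and> snd x \<in> e}" by auto
    finally have L1: "(\<Sum>u\<in>e \<inter> L. \<Sum>P\<in>Pow (e \<inter> R). c (Suc (card P)) * avg V (\<lambda>X. chi P X * y u X))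
      = \<eta> * (- c 2) * (\<Sum>x\<in>{x \<in> R \<times> L. fst x \<in> e \<and> snd x \<in> e}. b (fst x) (snd x))"
      by (simp only: case_prod_beta sum_distrib_left)
    have "\<bar>\<Sum>S\<in>{S \<in> Pow (e \<inter> (R \<union> L)). 2 \<le> card (S \<inter> L)}. c (card S) * avg V (\<lambda>X. chi (S - L) X * (\<Prod>u\<in>S \<inter> L. y u X))\<bar>
      \<le> 2 ^ k * C * (\<Sum>u\<in>e \<inter> L. q u)"
    proof (rule higher_levels_le[OF e])
      fix S assume S: "S \<in> {S \<in> Pow (e \<inter> (R \<union> L)). 2 \<le> card (S \<inter> L)}"
      \<comment> \<open>Two answers suffice for the bound: all other factors are at most 1 in
        absolute value, and a product of two is at most the sum of their squares.\<close>
      have "2 \<le> card (S \<inter> L)" using S by auto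
      then obtain T where T: "T \<subseteq> S \<inter> L" "card T = 2" by (rule obtain_subset_with_card_n)
      then obtain u v where uv: "T = {u, v}" "u \<noteq> v" by (auto simp: card_2_iff)
      have fS: "finite (S \<inter> L)" using fR by auto
      have "\<bar>chi (S - L) X * (\<Prod>u\<in>S \<inter> L. y u X)\<bar> \<le> (\<Sum>u\<in>e \<inter> L. (y u X)\<^sup>2)" for X
      proof -
        have "\<bar>chi (S - L) X * (\<Prod>u\<in>S \<inter> L. y u X)\<bar> = (\<Prod>u\<in>S \<inter> L. \<bar>y u X\<bar>)"
          by (simp add: abs_mult abs_chi abs_prod)
        also have "\<dots> = (\<Prod>u\<in>T. \<bar>y u X\<bar>) * (\<Prod>u\<in>S \<inter> L - T. \<bar>y u X\<bar>)"
          using T fS by (metis prod.subset_diff mult.commute)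
        also have "\<dots> \<le> (\<Prod>u\<in>T. \<bar>y u X\<bar>) * 1"
          by (intro mult_left_mono prod_le_1 prod_nonneg) (use ybd in auto)
        also have "\<dots> = \<bar>y u X\<bar> * \<bar>y v X\<bar>" using uv by simp
        also have "\<dots> \<le> (y u X)\<^sup>2 + (y v X)\<^sup>2"
        proof -
          have "0 \<le> \<bar>y u X\<bar> * \<bar>y v X\<bar>" by simp
          then show ?thesis using sum_squares_bound[of "\<bar>y u X\<bar>" "\<bar>y v X\<bar>"]
            unfolding power2_abs by linarith
        qed
        also have "\<dots> = (\<Sum>u\<in>T. (y u X)\<^sup>2)" using uv by simp
        also have "\<dots> \<le> (\<Sum>u\<in>e \<inter> L. (y u X)\<^sup>2)"
          by (rule sum_mono2) (use T S fe in auto)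
        finally show ?thesis .
      qed
      then have "avg V (\<lambda>X. \<bar>chi (S - L) X * (\<Prod>u\<in>S \<inter> L. y u X)\<bar>) \<le> avg V (\<lambda>X. \<Sum>u\<in>e \<inter> L. (y u X)\<^sup>2)"
        by (intro avg_mono)
      then show "\<bar>avg V (\<lambda>X. chi (S - L) X * (\<Prod>u\<in>S \<inter> L. y u X))\<bar> \<le> (\<Sum>u\<in>e \<inter> L. q u)"
        unfolding q_def avg_sum by (rule order_trans[OF abs_avg_le])
    qed (use q0 in \<open>auto intro: sum_nonneg\<close>)
    then show ?thesis unfolding L1 A_def by simp
  qed
  then have "(\<Sum>e\<in>E. \<eta> * (- c 2) * (\<Sum>x\<in>{x \<in> R \<times> L. fst x \<in> e \<and> snd x \<in> e}. b (fst x) (snd x)) - A * (\<Sum>u\<in>e \<inter> L. q u))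
      \<le> avg V (\<lambda>X. edge_poly c E (mixed R L y X))"
    unfolding avg_edge_poly_mixed[OF R RL] by (intro sum_mono)
  also have "\<dots> \<le> \<tau>" by (rule avg_edge_poly_le[OF ub bd])
  finally have le: "\<eta> * (- c 2) * (\<Sum>e\<in>E. \<Sum>x\<in>{x \<in> R \<times> L. fst x \<in> e \<and> snd x \<in> e}. b (fst x) (snd x))
      - A * (\<Sum>e\<in>E. \<Sum>u\<in>e \<inter> L. q u) \<le> \<tau>"
    unfolding sum_subtractf sum_distrib_left .
  have "(\<Sum>e\<in>E. \<Sum>x\<in>{x \<in> R \<times> L. fst x \<in> e \<and> snd x \<in> e}. b (fst x) (snd x))
     = (\<Sum>x\<in>R \<times> L. real (codeg (fst x) (snd x)) * b (fst x) (snd x))"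
    by (rule sum_edges_pairs) (use fR in auto)
  also have "\<dots> = \<Gamma>" unfolding \<Gamma>
    by (rule sum.mono_neutral_cong_right) (use fR Q in \<open>auto simp: b_def power2_eq_square\<close>)
  finally have g: "(\<Sum>e\<in>E. \<Sum>x\<in>{x \<in> R \<times> L. fst x \<in> e \<and> snd x \<in> e}. b (fst x) (snd x)) = \<Gamma>" .
  have "(\<Sum>e\<in>E. \<Sum>u\<in>e \<inter> L. q u) = (\<Sum>u\<in>L. real (deg u) * q u)" by (rule sum_edges_vertices[OF fR(2)])
  also have "\<dots> \<le> (\<Sum>u\<in>L. D * q u)" by (intro sum_mono mult_right_mono D q0)
  also have "\<dots> = \<eta>\<^sup>2 * D * \<Gamma>" unfolding q \<Gamma>_def by (simp add: sum_distrib_left algebra_simps)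
  finally have "A * (\<Sum>e\<in>E. \<Sum>u\<in>e \<inter> L. q u) \<le> A * (\<eta>\<^sup>2 * D * \<Gamma>)" using A by (intro mult_left_mono) auto
  also have "\<dots> = \<eta> * \<Gamma> * (\<eta> * D * A)" by (simp add: power2_eq_square)
  also have "\<dots> \<le> \<eta> * \<Gamma> * (- c 2 / 2)"
  proof (rule mult_left_mono)
    have "\<eta> * D * A = (- c 2 / 2) / k" unfolding \<eta>_def using A D k3 by (simp add: field_simps)
    also have "\<dots> \<le> - c 2 / 2" using c2 k3 by (simp add: field_simps)
    finally show "\<eta> * D * A \<le> - c 2 / 2" .
  qed (use \<eta> \<Gamma>0 in auto)
  finally have "\<eta> * (- c 2) * \<Gamma> - \<eta> * \<Gamma> * (- c 2 / 2) \<le> \<tau>" using le unfolding g by linarith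
  then have "\<eta> * (- c 2 / 2) * \<Gamma> \<le> \<tau>" by (simp add: algebra_simps)
  moreover have \<eta>c: "\<eta> * (- c 2 / 2) = (c 2)\<^sup>2 / (4 * A * k * D)"
    unfolding \<eta>_def by (simp add: power2_eq_square)
  ultimately have "(c 2)\<^sup>2 / (4 * A * k * D) * \<Gamma> \<le> \<tau>" by (simp only: \<eta>c)
  then have "(c 2)\<^sup>2 * \<Gamma> / (4 * A * k * D) \<le> \<tau>" by (simp only: times_divide_eq_left)
  moreover have W: "4 * A * k * D > 0" using A D k3 by simp
  ultimately have "(c 2)\<^sup>2 * \<Gamma> \<le> 4 * A * k * D * \<tau>" using pos_divide_le_eq[OF W] by (simp add: mult.commute)
  then show ?thesis unfolding \<Gamma> A_def .
qed

end

section \<open>Answers of low degree\<close>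

context uniform_poly
begin

section \<open>Counting the coincidences behind correlated answers\<close>

lemma card_offdiag_le: "finite f \<Longrightarrow> card f = k \<Longrightarrow> real (card {x \<in> f \<times> f. fst x \<noteq> snd x}) \<le> real k ^ 2"
proof -
  assume f: "finite f" "card f = k"
  have "card {x \<in> f \<times> f. fst x \<noteq> snd x} \<le> card (f \<times> f)" using f by (intro card_mono) auto
  also have "\<dots> = k ^ 2" using f by (simp add: card_cartesian_product power2_eq_square)
  finally have "real (card {x \<in> f \<times> f. fst x \<noteq> snd x}) \<le> real (k ^ 2)" by (simp only: of_nat_le_iff)
  then show ?thesis by simp
qed

text \<open>In both alternatives two of the three edges are fixed by a pair of vertices inside an
  edge chosen earlier. If f and g share a pair, choose f, the pair, then g, and finally e through
  the two vertices of Y. Otherwise choose f and a pair through which e passes, then a pair in e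
  through which g passes. Each choice of an edge through a pair costs a factor
  \<open>\<theta>\<close>, each choice of a pair a factor k^2.\<close>

lemma card_triples_le:
  assumes F: "F \<subseteq> E" and FY: "\<And>f. f \<in> F \<Longrightarrow> card (f \<inter> Y) = 1"
    and F\<theta>: "\<And>f u v. f \<in> F \<Longrightarrow> u \<in> f \<Longrightarrow> v \<in> f \<Longrightarrow> u \<noteq> v \<Longrightarrow> real (codeg u v) \<le> \<theta>"
    and Y\<theta>: "\<And>u v. u \<in> Y \<Longrightarrow> v \<in> Y \<Longrightarrow> u \<noteq> v \<Longrightarrow> real (codeg u v) \<le> \<theta>"
    and \<theta>: "0 \<le> \<theta>"
  defines "T \<equiv> {(f, g, e). f \<in> F \<and> g \<in> F \<and> e \<in> E \<and> (\<exists>u v. u \<noteq> v \<and> u \<in> f \<inter> Y \<and> v \<in> g \<inter> Y \<and> u \<in> e \<and> v \<in> e \<and>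
      ((\<exists>a b. a \<noteq> b \<and> a \<in> f \<inter> g \<and> b \<in> f \<inter> g) \<or> (\<exists>a b. a \<in> f \<inter> e \<and> a \<noteq> u \<and> b \<in> g \<inter> e \<and> b \<noteq> v)))}"
  shows "finite T" "real (card T) \<le> 2 * real (card E) * real k ^ 4 * \<theta>\<^sup>2"
proof -
  have finF: "finite F" using F finE finite_subset by blast
  have "T \<subseteq> E \<times> E \<times> E" unfolding T_def using F by auto
  then show "finite T" using finE by (meson finite_SigmaI finite_subset)
  have cF: "real (card F) \<le> real (card E)" using F finE by (simp add: card_mono)
  have fF: "finite f" "card f = k" if "f \<in> F" for f using that F fin_edge card_edge by auto
  define P where "P f = {x \<in> f \<times> f. fst x \<noteq> snd x}" for f :: "'a set"
  have P: "finite (P f)" "real (card (P f)) \<le> real k ^ 2" if "f \<in> E" for f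
    unfolding P_def using card_offdiag_le[OF fin_edge[OF that] card_edge[OF that]] fin_edge[OF that] by auto
  define I1 where "I1 f g = {e \<in> E. \<exists>u\<in>f \<inter> Y. \<exists>v\<in>g \<inter> Y. u \<noteq> v \<and> u \<in> e \<and> v \<in> e}" for f g
  define T1 where "T1 = (\<Union>f\<in>F. \<Union>x\<in>P f. \<Union>g\<in>{g \<in> F. fst x \<in> g \<and> snd x \<in> g}. (\<lambda>e. (f, g, e)) ` I1 f g)"
  define T2 where "T2 = (\<Union>f\<in>F. \<Union>x\<in>P f. \<Union>e\<in>{e \<in> E. fst x \<in> e \<and> snd x \<in> e}. \<Union>y\<in>P e.
     (\<lambda>g. (f, g, e)) ` {g \<in> F. fst y \<in> g \<and> snd y \<in> g})"
  have "T \<subseteq> T1 \<union> T2"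
  proof
    fix t assume "t \<in> T"
    obtain f g e where fge: "t = (f, g, e)" by (cases t)
    have "f \<in> F \<and> g \<in> F \<and> e \<in> E \<and> (\<exists>u v. u \<noteq> v \<and> u \<in> f \<inter> Y \<and> v \<in> g \<inter> Y \<and> u \<in> e \<and> v \<in> e \<and>
      ((\<exists>a b. a \<noteq> b \<and> a \<in> f \<inter> g \<and> b \<in> f \<inter> g) \<or> (\<exists>a b. a \<in> f \<inter> e \<and> a \<noteq> u \<and> b \<in> g \<inter> e \<and> b \<noteq> v)))"
      using \<open>t \<in> T\<close> unfolding T_def fge mem_Collect_eq prod.case .
    then obtain u v where t: "t = (f, g, e)" "f \<in> F" "g \<in> F" "e \<in> E" "u \<noteq> v" "u \<in> f \<inter> Y" "v \<in> g \<inter> Y" "u \<in> e" "v \<in> e"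
      and alt: "(\<exists>a b. a \<noteq> b \<and> a \<in> f \<inter> g \<and> b \<in> f \<inter> g) \<or> (\<exists>a b. a \<in> f \<inter> e \<and> a \<noteq> u \<and> b \<in> g \<inter> e \<and> b \<noteq> v)"
      using fge by (elim exE conjE) (rule that; assumption)
    from alt show "t \<in> T1 \<union> T2"
    proof
      assume "\<exists>a b. a \<noteq> b \<and> a \<in> f \<inter> g \<and> b \<in> f \<inter> g"
      then obtain a b where ab: "a \<noteq> b" "a \<in> f \<inter> g" "b \<in> f \<inter> g" by auto
      have "(a, b) \<in> P f" "e \<in> I1 f g" unfolding P_def I1_def using ab t by auto
      then have "t \<in> T1" unfolding T1_def t(1) using ab t by (auto intro!: bexI[of _ f] bexI[of _ "(a, b)"])
      then show ?thesis by simp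
    next
      assume "\<exists>a b. a \<in> f \<inter> e \<and> a \<noteq> u \<and> b \<in> g \<inter> e \<and> b \<noteq> v"
      then obtain a b where ab: "a \<in> f \<inter> e" "a \<noteq> u" "b \<in> g \<inter> e" "b \<noteq> v" by auto
      have "(u, a) \<in> P f" "(v, b) \<in> P e" unfolding P_def using ab t by auto
      moreover have "e \<in> {e \<in> E. fst (u, a) \<in> e \<and> snd (u, a) \<in> e}" "g \<in> {g \<in> F. fst (v, b) \<in> g \<and> snd (v, b) \<in> g}"
        using ab t by auto
      ultimately have "t \<in> T2" unfolding T2_def t(1) UN_iff using t(2) by blast
      then show ?thesis by simp
    qed
  qed
  moreover have fT: "finite T1" "finite T2"
    unfolding T1_def T2_def I1_def using finF finE P(1) F by (auto intro!: finite_UN_I)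
  ultimately have "card T \<le> card T1 + card T2"
    by (meson card_Un_le card_mono finite_UnI order_trans)
  then have cT: "real (card T) \<le> real (card T1) + real (card T2)" by (metis of_nat_add of_nat_le_iff)
  \<comment> \<open>Since f and g meet Y in one vertex each, u and v are determined by f and g; if
    they coincide there is no admissible e.\<close>
  have I1: "real (card ((\<lambda>e. (f, g, e)) ` I1 f g)) \<le> \<theta>" if fg: "f \<in> F" "g \<in> F" for f g
  proof -
    obtain u where u: "f \<inter> Y = {u}" using FY[OF fg(1)] by (auto simp: card_1_singleton_iff)
    obtain v where v: "g \<inter> Y = {v}" using FY[OF fg(2)] by (auto simp: card_1_singleton_iff)
    note uv = u v
    have "card ((\<lambda>e. (f, g, e)) ` I1 f g) = card (I1 f g)" by (rule card_image) (auto simp: inj_on_def)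
    also have "real \<dots> \<le> \<theta>"
    proof (cases "u = v")
      case True
      then have "I1 f g = {}" unfolding I1_def uv by auto
      then show ?thesis using \<theta> by simp
    next
      case False
      then have "I1 f g = {e \<in> E. u \<in> e \<and> v \<in> e}" unfolding I1_def uv by auto
      then show ?thesis using Y\<theta>[of u v] False uv unfolding codeg_def by auto
    qed
    finally show ?thesis .
  qed
  have T1: "real (card T1) \<le> real (card F) * (real k ^ 2 * (\<theta> * \<theta>))"
    unfolding T1_def
  proof (rule card_UN_le_mult[OF finF])
    fix f assume f: "f \<in> F"
    have "real (card (\<Union>x\<in>P f. \<Union>g\<in>{g \<in> F. fst x \<in> g \<and> snd x \<in> g}. (\<lambda>e. (f, g, e)) ` I1 f g))
        \<le> real (card (P f)) * (\<theta> * \<theta>)"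
    proof (rule card_UN_le_mult)
      fix x assume x: "x \<in> P f"
      have "real (card {g \<in> F. fst x \<in> g \<and> snd x \<in> g}) \<le> real (codeg (fst x) (snd x))"
        unfolding codeg_def using F finE by (auto intro!: card_mono)
      also have "\<dots> \<le> \<theta>" using F\<theta>[OF f] x unfolding P_def by auto
      finally have "real (card {g \<in> F. fst x \<in> g \<and> snd x \<in> g}) \<le> \<theta>" .
      moreover have "real (card (\<Union>g\<in>{g \<in> F. fst x \<in> g \<and> snd x \<in> g}. (\<lambda>e. (f, g, e)) ` I1 f g))
        \<le> real (card {g \<in> F. fst x \<in> g \<and> snd x \<in> g}) * \<theta>"
        by (rule card_UN_le_mult) (use finF I1 f in auto)
      ultimately show "real (card (\<Union>g\<in>{g \<in> F. fst x \<in> g \<and> snd x \<in> g}. (\<lambda>e. (f, g, e)) ` I1 f g)) \<le> \<theta> * \<theta>"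
        using \<theta> by (meson mult_right_mono order_trans)
    qed (use P F f in auto)
    also have "\<dots> \<le> real k ^ 2 * (\<theta> * \<theta>)" using P(2)[of f] F f \<theta> by (intro mult_right_mono) auto
    finally show "real (card (\<Union>x\<in>P f. \<Union>g\<in>{g \<in> F. fst x \<in> g \<and> snd x \<in> g}. (\<lambda>e. (f, g, e)) ` I1 f g))
      \<le> real k ^ 2 * (\<theta> * \<theta>)" .
  qed
  have T2: "real (card T2) \<le> real (card F) * (real k ^ 2 * (\<theta> * (real k ^ 2 * \<theta>)))"
    unfolding T2_def
  proof (rule card_UN_le_mult[OF finF])
    fix f assume f: "f \<in> F"
    have "real (card (\<Union>x\<in>P f. \<Union>e\<in>{e \<in> E. fst x \<in> e \<and> snd x \<in> e}. \<Union>y\<in>P e.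
         (\<lambda>g. (f, g, e)) ` {g \<in> F. fst y \<in> g \<and> snd y \<in> g}))
        \<le> real (card (P f)) * (\<theta> * (real k ^ 2 * \<theta>))"
    proof (rule card_UN_le_mult)
      fix x assume x: "x \<in> P f"
      have e\<theta>: "real (card {e \<in> E. fst x \<in> e \<and> snd x \<in> e}) \<le> \<theta>"
        using F\<theta>[OF f] x unfolding P_def codeg_def by auto
      have "real (card (\<Union>e\<in>{e \<in> E. fst x \<in> e \<and> snd x \<in> e}. \<Union>y\<in>P e.
         (\<lambda>g. (f, g, e)) ` {g \<in> F. fst y \<in> g \<and> snd y \<in> g}))
         \<le> real (card {e \<in> E. fst x \<in> e \<and> snd x \<in> e}) * (real k ^ 2 * \<theta>)"
      proof (rule card_UN_le_mult)
        fix e assume "e \<in> {e \<in> E. fst x \<in> e \<and> snd x \<in> e}"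
        then have e: "e \<in> E" by auto
        have "real (card (\<Union>y\<in>P e. (\<lambda>g. (f, g, e)) ` {g \<in> F. fst y \<in> g \<and> snd y \<in> g})) \<le> real (card (P e)) * \<theta>"
        proof (rule card_UN_le_mult[OF P(1)[OF e]])
          fix y assume y: "y \<in> P e"
          have "card ((\<lambda>g. (f, g, e)) ` {g \<in> F. fst y \<in> g \<and> snd y \<in> g}) = card {g \<in> F. fst y \<in> g \<and> snd y \<in> g}"
            by (rule card_image) (auto simp: inj_on_def)
          also have "real \<dots> \<le> \<theta>"
          \<comment> \<open>The pair lies in an arbitrary edge e of \<open>E\<close>, where its
            codegree might be large. As soon as some g in \<open>F\<close> contains it, the bound
            for pairs inside edges of \<open>F\<close> applies.\<close>
          proof (cases "{g \<in> F. fst y \<in> g \<and> snd y \<in> g} = {}")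
            case True
            then show ?thesis using \<theta> by (metis card.empty of_nat_0)
          next
            case False
            then obtain g where g: "g \<in> F" "fst y \<in> g" "snd y \<in> g" by auto
            have "real (card {g \<in> F. fst y \<in> g \<and> snd y \<in> g}) \<le> real (codeg (fst y) (snd y))"
              unfolding codeg_def using F finE by (auto intro!: card_mono)
            also have "\<dots> \<le> \<theta>" using F\<theta>[OF g] y unfolding P_def by auto
            finally show ?thesis .
          qed
          finally show "real (card ((\<lambda>g. (f, g, e)) ` {g \<in> F. fst y \<in> g \<and> snd y \<in> g})) \<le> \<theta>" .
        qed
        also have "\<dots> \<le> real k ^ 2 * \<theta>" using P(2)[OF e] \<theta> by (intro mult_right_mono)
        finally show "real (card (\<Union>y\<in>P e. (\<lambda>g. (f, g, e)) ` {g \<in> F. fst y \<in> g \<and> snd y \<in> g})) \<le> real k ^ 2 * \<theta>" .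
      qed (use finE in auto)
      also have "\<dots> \<le> \<theta> * (real k ^ 2 * \<theta>)" using e\<theta> \<theta> by (intro mult_right_mono) auto
      finally show "real (card (\<Union>e\<in>{e \<in> E. fst x \<in> e \<and> snd x \<in> e}. \<Union>y\<in>P e.
         (\<lambda>g. (f, g, e)) ` {g \<in> F. fst y \<in> g \<and> snd y \<in> g})) \<le> \<theta> * (real k ^ 2 * \<theta>)" .
    qed (use P F f in auto)
    also have "\<dots> \<le> real k ^ 2 * (\<theta> * (real k ^ 2 * \<theta>))" using P(2)[of f] F f \<theta> by (intro mult_right_mono) auto
    finally show "real (card (\<Union>x\<in>P f. \<Union>e\<in>{e \<in> E. fst x \<in> e \<and> snd x \<in> e}. \<Union>y\<in>P e.
         (\<lambda>g. (f, g, e)) ` {g \<in> F. fst y \<in> g \<and> snd y \<in> g})) \<le> real k ^ 2 * (\<theta> * (real k ^ 2 * \<theta>))" .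
  qed
  have k24: "real k ^ 2 \<le> real k ^ 4" using k3 by (intro power_increasing) auto
  have "real (card T1) \<le> real (card E) * (real k ^ 4 * (\<theta> * \<theta>))"
    using T1 by (rule order_trans) (use cF k24 \<theta> in \<open>auto intro!: mult_mono\<close>)
  moreover have "real (card T2) \<le> real (card E) * (real k ^ 4 * (\<theta> * \<theta>))"
  proof (rule order_trans[OF T2])
    have "real k ^ 2 * (\<theta> * (real k ^ 2 * \<theta>)) = real k ^ 4 * (\<theta> * \<theta>)"
      by (simp add: power4_eq_xxxx power2_eq_square)
    then show "real (card F) * (real k ^ 2 * (\<theta> * (real k ^ 2 * \<theta>))) \<le> real (card E) * (real k ^ 4 * (\<theta> * \<theta>))"
      using cF \<theta> by (simp only:) (auto intro!: mult_mono)
  qed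
  ultimately show "real (card T) \<le> 2 * real (card E) * real k ^ 4 * \<theta>\<^sup>2"
    using cT by (simp add: power2_eq_square)
qed

text \<open>A crude bound, meant for the exceptional signs where some answer leaves [-1, 1].\<close>

lemma abs_edge_poly_le:
  assumes "\<And>v. \<bar>s v\<bar> \<le> G" "1 \<le> G"
  shows "\<bar>edge_poly c E s\<bar> \<le> real (card E) * (2 ^ k * C * G ^ k)"
proof -
  have "\<bar>edge_poly c E s\<bar> \<le> (\<Sum>e\<in>E. \<bar>\<Sum>S\<in>Pow e - {{}}. c (card S) * (\<Prod>v\<in>S. s v)\<bar>)"
    unfolding edge_poly_def by (rule sum_abs)
  also have "\<dots> \<le> (\<Sum>e\<in>E. 2 ^ k * C * G ^ k)"
  proof (rule sum_mono)
    fix e assume e: "e \<in> E"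
    show "\<bar>\<Sum>S\<in>Pow e - {{}}. c (card S) * (\<Prod>v\<in>S. s v)\<bar> \<le> 2 ^ k * C * G ^ k"
    proof (rule higher_levels_le[OF e])
      fix S assume "S \<in> Pow e - {{}}"
      then have "card S \<le> k" using card_mono[OF fin_edge[OF e], of S] card_edge[OF e] by auto
      have "\<bar>\<Prod>v\<in>S. s v\<bar> \<le> (\<Prod>v\<in>S. G)" unfolding abs_prod by (rule prod_mono) (use assms in auto)
      also have "\<dots> = G ^ card S" by simp
      also have "\<dots> \<le> G ^ k" using \<open>card S \<le> k\<close> assms by (intro power_increasing) auto
      finally show "\<bar>\<Prod>v\<in>S. s v\<bar> \<le> G ^ k" .
    qed (use assms in auto)
  qed
  finally show ?thesis by simp
qed

text \<open>A set rather than a multiset: a monomial lying in several edges still has coefficient 1.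
  The second moment of \<open>link_poly\<close> is therefore the number of monomials, at most 2^k
  times the degree.\<close>

definition links where
  "links Y F l u = {A \<in> Pow (V - Y). card A = l - 1 \<and> (\<exists>f\<in>F. insert u A \<subseteq> f)}"

definition link_poly where
  "link_poly Y F l u X = (\<Sum>A\<in>links Y F l u. chi A X)"

lemma links_props:
  assumes F: "F \<subseteq> E"
  shows finite_links: "finite (links Y F l u)"
    and card_links_le: "card (links Y F l u) \<le> 2 ^ k * deg u"
    and avg_chi_link_poly: "\<And>P. P \<subseteq> V \<Longrightarrow> avg V (\<lambda>X. chi P X * link_poly Y F l u X) = (if P \<in> links Y F l u then 1 else 0)"
    and avg_link_poly_square: "avg V (\<lambda>X. (link_poly Y F l u X)\<^sup>2) = card (links Y F l u)"
    and abs_link_poly_le: "\<bar>link_poly Y F l u X\<bar> \<le> card (links Y F l u)"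
    and lowdeg_link_poly: "l \<le> k \<Longrightarrow> lowdeg V k (link_poly Y F l u)"
proof -
  show fA: "finite (links Y F l u)" unfolding links_def using finV by auto
  have "links Y F l u \<subseteq> (\<Union>f\<in>{e \<in> E. u \<in> e}. Pow f)" unfolding links_def using F by auto
  then have "card (links Y F l u) \<le> card (\<Union>f\<in>{e \<in> E. u \<in> e}. Pow f)"
    using finE fin_edge by (intro card_mono) auto
  also have "\<dots> \<le> (\<Sum>f\<in>{e \<in> E. u \<in> e}. card (Pow f))" using finE by (intro card_UN_le) auto
  also have "\<dots> = (\<Sum>f\<in>{e \<in> E. u \<in> e}. 2 ^ k)" by (intro sum.cong) (auto simp: card_Pow_edge)
  finally show "card (links Y F l u) \<le> 2 ^ k * deg u" unfolding deg_def by (simp add: mult.commute)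
  show ortho: "avg V (\<lambda>X. chi P X * link_poly Y F l u X) = (if P \<in> links Y F l u then 1 else 0)" if P: "P \<subseteq> V" for P
  proof -
    have "avg V (\<lambda>X. chi P X * link_poly Y F l u X) = (\<Sum>A\<in>links Y F l u. avg V (\<lambda>X. chi P X * chi A X))"
      unfolding link_poly_def sum_distrib_left avg_sum ..
    also have "\<dots> = (\<Sum>A\<in>links Y F l u. if P = A then 1 else 0)"
      by (intro sum.cong refl avg_chi_mult[OF finV P]) (auto simp: links_def)
    also have "\<dots> = (if P \<in> links Y F l u then 1 else 0)" using fA by simp
    finally show ?thesis .
  qed
  have "avg V (\<lambda>X. (link_poly Y F l u X)\<^sup>2) = avg V (\<lambda>X. \<Sum>A\<in>links Y F l u. chi A X * link_poly Y F l u X)"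
    by (simp add: link_poly_def power2_eq_square sum_distrib_right)
  also have "\<dots> = (\<Sum>A\<in>links Y F l u. 1)"
    unfolding avg_sum by (intro sum.cong refl) (subst ortho, auto simp: links_def)
  finally show "avg V (\<lambda>X. (link_poly Y F l u X)\<^sup>2) = card (links Y F l u)" by simp
  have "\<bar>link_poly Y F l u X\<bar> \<le> (\<Sum>A\<in>links Y F l u. \<bar>chi A X\<bar>)" unfolding link_poly_def by (rule sum_abs)
  then show "\<bar>link_poly Y F l u X\<bar> \<le> card (links Y F l u)" by (simp add: abs_chi)
  show "l \<le> k \<Longrightarrow> lowdeg V k (link_poly Y F l u)"
    unfolding link_poly_def[abs_def] by (rule lowdeg_sum_chi[OF fA]) (auto simp: links_def)
qed

text \<open>Expanding both link polynomials, the pair (A, A') contributes only if its symmetric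
  difference is S - Y. Let f and g be edges of F realising the two links. If A = A', then f and g
  share two vertices, because l \<ge> 3 gives A at least two elements. If not, equal sizes give an
  element of each set outside the other; both lie in S, hence in e. So every contribution produces a
  triple as in \<open>card_triples_le\<close>.\<close>

lemma sum_pair_correlations_le:
  fixes Y :: "'a set" and F :: "'a set set" and l :: nat
  assumes F: "F \<subseteq> E" and FY: "\<And>f. f \<in> F \<Longrightarrow> card (f \<inter> Y) = 1"
    and F\<theta>: "\<And>f u v. f \<in> F \<Longrightarrow> u \<in> f \<Longrightarrow> v \<in> f \<Longrightarrow> u \<noteq> v \<Longrightarrow> real (codeg u v) \<le> \<theta>"
    and Y\<theta>: "\<And>u v. u \<in> Y \<Longrightarrow> v \<in> Y \<Longrightarrow> u \<noteq> v \<Longrightarrow> real (codeg u v) \<le> \<theta>"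
    and \<theta>: "0 \<le> \<theta>" and l: "3 \<le> l"
  shows "(\<Sum>e\<in>E. \<Sum>S\<in>{S \<in> Pow e. card (S \<inter> Y) = 2}. \<bar>avg V (\<lambda>X. chi (S - Y) X * (\<Prod>u\<in>S \<inter> Y. link_poly Y F l u X))\<bar>)
    \<le> 8 ^ k * (2 * real (card E) * real k ^ 4 * \<theta>\<^sup>2)"
proof -
  define B where "B S = {(A, A'). \<exists>u v. u \<noteq> v \<and> S \<inter> Y = {u, v} \<and> A \<in> links Y F l u \<and> A' \<in> links Y F l v \<and> sym_diff A A' = S - Y}" for S
  have fA: "finite (links Y F l u)" for u by (rule finite_links[OF F])
  have finB: "finite (B S)" for S
    by (rule finite_subset[of _ "Pow V \<times> Pow V"]) (use finV in \<open>auto simp: B_def links_def\<close>)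
  have bound: "\<bar>avg V (\<lambda>X. chi (S - Y) X * (\<Prod>u\<in>S \<inter> Y. link_poly Y F l u X))\<bar> \<le> real (card (B S))"
    if e: "e \<in> E" and S: "S \<in> {S \<in> Pow e. card (S \<inter> Y) = 2}" for e S
  proof -
    obtain u v where uv: "S \<inter> Y = {u, v}" "u \<noteq> v" using S by (auto simp: card_2_iff)
    have SV: "S - Y \<subseteq> V" using S edge_V[OF e] by auto
    have "avg V (\<lambda>X. chi (S - Y) X * (\<Prod>u\<in>S \<inter> Y. link_poly Y F l u X)) =
        avg V (\<lambda>X. \<Sum>A\<in>links Y F l u. \<Sum>A'\<in>links Y F l v. chi (S - Y) X * chi (sym_diff A A') X)"
    proof (rule avg_cong)
      fix X
      have "chi (S - Y) X * (\<Prod>u\<in>S \<inter> Y. link_poly Y F l u X) = (\<Sum>A\<in>links Y F l u. \<Sum>A'\<in>links Y F l v. chi (S - Y) X * (chi A X * chi A' X))"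
        unfolding uv(1) sum_distrib_left[symmetric] sum_product[symmetric] link_poly_def[symmetric]
        using uv(2) by (simp add: sum_distrib_right[symmetric] link_poly_def[symmetric])
      also have "\<dots> = (\<Sum>A\<in>links Y F l u. \<Sum>A'\<in>links Y F l v. chi (S - Y) X * chi (sym_diff A A') X)"
      proof (intro sum.cong refl)
        fix A A' assume "A \<in> links Y F l u" "A' \<in> links Y F l v"
        then have "finite A" "finite A'" using finV unfolding links_def by (auto intro: finite_subset)
        then show "chi (S - Y) X * (chi A X * chi A' X) = chi (S - Y) X * chi (sym_diff A A') X"
          by (simp add: chi_mult)
      qed
      finally show "chi (S - Y) X * (\<Prod>u\<in>S \<inter> Y. link_poly Y F l u X) = (\<Sum>A\<in>links Y F l u. \<Sum>A'\<in>links Y F l v. chi (S - Y) X * chi (sym_diff A A') X)" .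
    qed
    also have "\<dots> = (\<Sum>A\<in>links Y F l u. \<Sum>A'\<in>links Y F l v. avg V (\<lambda>X. chi (S - Y) X * chi (sym_diff A A') X))"
      unfolding avg_sum ..
    also have "\<dots> = (\<Sum>A\<in>links Y F l u. \<Sum>A'\<in>links Y F l v. if S - Y = sym_diff A A' then 1 else 0)"
      by (intro sum.cong refl avg_chi_mult[OF finV SV]) (auto simp: links_def)
    also have "\<dots> = (\<Sum>(A, A')\<in>links Y F l u \<times> links Y F l v. if S - Y = sym_diff A A' then 1 else 0)"
      by (rule sum.cartesian_product)
    also have "\<dots> = (\<Sum>(A, A')\<in>{x \<in> links Y F l u \<times> links Y F l v. S - Y = sym_diff (fst x) (snd x)}. 1)"
      by (rule sum.mono_neutral_cong_right) (use fA in \<open>auto split: if_splits\<close>)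
    also have "\<dots> = real (card {x \<in> links Y F l u \<times> links Y F l v. S - Y = sym_diff (fst x) (snd x)})"
      by (simp add: case_prod_beta)
    finally have eq: "avg V (\<lambda>X. chi (S - Y) X * (\<Prod>u\<in>S \<inter> Y. link_poly Y F l u X)) = \<dots>" .
    have "{x \<in> links Y F l u \<times> links Y F l v. S - Y = sym_diff (fst x) (snd x)} \<subseteq> B S"
    proof
      fix p assume p: "p \<in> {x \<in> links Y F l u \<times> links Y F l v. S - Y = sym_diff (fst x) (snd x)}"
      obtain A A' where pA: "p = (A, A')" by (cases p)
      have "u \<noteq> v \<and> S \<inter> Y = {u, v} \<and> A \<in> links Y F l u \<and> A' \<in> links Y F l v \<and> sym_diff A A' = S - Y"
        using p uv unfolding pA by (simp only: mem_Collect_eq mem_Sigma_iff fst_conv snd_conv simp_thms)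
      then show "p \<in> B S" unfolding B_def pA mem_Collect_eq prod.case by (intro exI)
    qed
    then show ?thesis unfolding eq using card_mono[OF finB] by simp
  qed
  define T where "T = {(f, g, e). f \<in> F \<and> g \<in> F \<and> e \<in> E \<and> (\<exists>u v. u \<noteq> v \<and> u \<in> f \<inter> Y \<and> v \<in> g \<inter> Y \<and> u \<in> e \<and> v \<in> e \<and>
      ((\<exists>a b. a \<noteq> b \<and> a \<in> f \<inter> g \<and> b \<in> f \<inter> g) \<or> (\<exists>a b. a \<in> f \<inter> e \<and> a \<noteq> u \<and> b \<in> g \<inter> e \<and> b \<noteq> v)))}"
  have T: "finite T" "real (card T) \<le> 2 * real (card E) * real k ^ 4 * \<theta>\<^sup>2"
    unfolding T_def using card_triples_le[OF F FY F\<theta> Y\<theta> \<theta>] by simp_all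
  define W where "W = Sigma E (\<lambda>e. Sigma {S \<in> Pow e. card (S \<inter> Y) = 2} B)"
  \<comment> \<open>A triple of edges leaves at most 2^k choices for each of S, A and A', which
    gives the factor 8^k.\<close>
  define U where "U t = (case t of (f, g, e) \<Rightarrow> {e} \<times> Pow e \<times> Pow f \<times> Pow g)"
    for t :: "'a set \<times> 'a set \<times> 'a set"
  have "W \<subseteq> (\<Union>t\<in>T. U t)"
  proof
    fix w assume "w \<in> W"
    then obtain e S A A' where w: "w = (e, S, A, A')" "e \<in> E" "S \<subseteq> e" "(A, A') \<in> B S"
      unfolding W_def by auto
    then obtain u v where uv: "u \<noteq> v" "S \<inter> Y = {u, v}" "A \<in> links Y F l u" "A' \<in> links Y F l v" "sym_diff A A' = S - Y"
      unfolding B_def by auto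
    obtain f g where fg: "f \<in> F" "insert u A \<subseteq> f" "g \<in> F" "insert v A' \<subseteq> g"
      using uv unfolding links_def by auto
    have AV: "A \<subseteq> V - Y" "A' \<subseteq> V - Y" "card A = l - 1" "card A' = l - 1" using uv unfolding links_def by auto
    have fin: "finite A" "finite A'" using AV finV by (auto intro: finite_subset)
    have alt: "(\<exists>a b. a \<noteq> b \<and> a \<in> f \<inter> g \<and> b \<in> f \<inter> g) \<or> (\<exists>a b. a \<in> f \<inter> e \<and> a \<noteq> u \<and> b \<in> g \<inter> e \<and> b \<noteq> v)"
    proof (cases "A = A'")
      case True
      have "2 \<le> card A" using AV l by simp
      then obtain Z where "Z \<subseteq> A" "card Z = 2" by (rule obtain_subset_with_card_n)
      then obtain a b where "a \<noteq> b" "a \<in> A" "b \<in> A" by (auto simp: card_2_iff)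
      then show ?thesis using True fg by auto
    next
      case False
      then have "\<not> A \<subseteq> A'" "\<not> A' \<subseteq> A" using AV fin by (metis card_subset_eq)+
      then obtain a b where "a \<in> A - A'" "b \<in> A' - A" by auto
      then have ab: "a \<in> S - Y" "b \<in> S - Y" "a \<in> A" "b \<in> A'" using uv(5) by auto
      have "u \<in> Y" "v \<in> Y" using uv(2) by auto
      then have "a \<in> f \<inter> e \<and> a \<noteq> u \<and> b \<in> g \<inter> e \<and> b \<noteq> v" using ab w(3) fg by auto
      then show ?thesis by blast
    qed
    have "u \<in> f \<inter> Y" "v \<in> g \<inter> Y" "u \<in> e" "v \<in> e" using uv(2) fg w(3) by auto
    then have "(f, g, e) \<in> T" unfolding T_def using alt fg w(2) uv(1) by blast
    moreover have "w \<in> U (f, g, e)" unfolding U_def w(1) using w fg by auto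
    ultimately show "w \<in> (\<Union>t\<in>T. U t)" by blast
  qed
  moreover have U: "finite (U t)" "real (card (U t)) = 8 ^ k" if "t \<in> T" for t
  proof -
    obtain f g e where t: "t = (f, g, e)" by (cases t)
    have E: "f \<in> E" "g \<in> E" "e \<in> E" using that F unfolding t T_def by auto
    show "finite (U t)" unfolding t U_def using E fin_edge by auto
    have "card (U t) = 2 ^ k * (2 ^ k * 2 ^ k)"
      unfolding t U_def using E by (simp add: card_cartesian_product card_Pow_edge)
    also have "\<dots> = 8 ^ k" by (simp add: power_mult_distrib[symmetric])
    finally show "real (card (U t)) = 8 ^ k" by simp
  qed
  ultimately have "card W \<le> card (\<Union>t\<in>T. U t)" using T by (intro card_mono) auto
  then have "real (card W) \<le> real (card (\<Union>t\<in>T. U t))" by simp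
  also have "\<dots> \<le> real (card T) * 8 ^ k" by (rule card_UN_le_mult) (use T U in auto)
  finally have W: "real (card W) \<le> real (card T) * 8 ^ k" .
  have "(\<Sum>e\<in>E. \<Sum>S\<in>{S \<in> Pow e. card (S \<inter> Y) = 2}. \<bar>avg V (\<lambda>X. chi (S - Y) X * (\<Prod>u\<in>S \<inter> Y. link_poly Y F l u X))\<bar>)
    \<le> (\<Sum>e\<in>E. \<Sum>S\<in>{S \<in> Pow e. card (S \<inter> Y) = 2}. real (card (B S)))"
    by (intro sum_mono bound)
  also have "\<dots> = real (card W)"
    unfolding W_def using finE fin_edge finB by (subst card_SigmaI) (auto simp: card_SigmaI)
  also have "\<dots> \<le> 8 ^ k * (2 * real (card E) * real k ^ 4 * \<theta>\<^sup>2)"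
    using order_trans[OF W mult_right_mono[OF T(2), of "8 ^ k"]] by (simp add: mult.commute)
  finally show ?thesis .
qed

text \<open>Shows that any upper bound \<open>\<tau>\<close> on the polynomial over [-1, 1] is
  nonnegative, and settles the case without edges.\<close>

lemma edge_poly_zero: "edge_poly c E (\<lambda>_. 0) = 0"
proof -
  have "c (card S) * (\<Prod>v\<in>S. 0) = 0" if "S \<in> Pow e - {{}}" "e \<in> E" for S e
    using that fin_edge[of e] finite_subset[of S e] by (auto simp: power_0_left)
  then show ?thesis unfolding edge_poly_def by (intro sum.neutral ballI)
qed

end

text \<open>All factors are replaced by the largest one. Its exponent lies between 4 and 2 h, so the
  fourth power dominates below 1 and the power 2 h above 1; these are the two moments later supplied
  by hypercontractivity.\<close>

lemma prod_abs_le_sum_powers: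
  fixes y :: "'a \<Rightarrow> real"
  assumes T: "finite T" "4 \<le> card T" "card T \<le> 2 * h"
  shows "(\<Prod>u\<in>T. \<bar>y u\<bar>) \<le> (\<Sum>u\<in>T. y u ^ 4 + y u ^ (2 * h))"
proof -
  have "T \<noteq> {}" using T by auto
  then have "Max ((\<lambda>u. \<bar>y u\<bar>) ` T) \<in> (\<lambda>u. \<bar>y u\<bar>) ` T" using T by (intro Max_in) auto
  then obtain u where u: "u \<in> T" "\<bar>y u\<bar> = Max ((\<lambda>u. \<bar>y u\<bar>) ` T)" by auto
  have "(\<Prod>u\<in>T. \<bar>y u\<bar>) \<le> (\<Prod>v\<in>T. \<bar>y u\<bar>)"
    by (rule prod_mono) (use u T in auto)
  also have "\<dots> = \<bar>y u\<bar> ^ card T" by simp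
  also have "\<dots> \<le> \<bar>y u\<bar> ^ 4 + \<bar>y u\<bar> ^ (2 * h)"
  proof (cases "\<bar>y u\<bar> \<le> 1")
    case True
    then have "\<bar>y u\<bar> ^ card T \<le> \<bar>y u\<bar> ^ 4" using T by (intro power_decreasing) auto
    moreover have "0 \<le> \<bar>y u\<bar> ^ (2 * h)" by simp
    ultimately show ?thesis by linarith
  next
    case False
    then have "\<bar>y u\<bar> ^ card T \<le> \<bar>y u\<bar> ^ (2 * h)" using T by (intro power_increasing) auto
    moreover have "0 \<le> \<bar>y u\<bar> ^ 4" by simp
    ultimately show ?thesis by linarith
  qed
  also have "\<dots> = y u ^ 4 + y u ^ (2 * h)" by (simp add: power_even_abs)
  also have "\<dots> \<le> (\<Sum>u\<in>T. y u ^ 4 + y u ^ (2 * h))"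
    by (rule member_le_sum) (use u T in auto)
  finally show ?thesis .
qed

section \<open>Gain and loss of answers built from links\<close>

context uniform_poly
begin

text \<open>Here x bounds the second moment of an answer. The left side is the gain from the edges
  of F, each meeting Y once. The terms after \<open>\<tau>\<close> bound, in this order, the
  correlations of two answers, the products of four or more answers, and the signs for which some
  answer leaves [-1, 1].\<close>

lemma pseudorandom_bound:
  fixes Y :: "'a set" and F :: "'a set set" and \<tau> \<theta> D \<eta> G \<kappa> :: real and l h :: nat
  assumes ub: "\<And>s. (\<And>v. \<bar>s v\<bar> \<le> 1) \<Longrightarrow> edge_poly c E s \<le> \<tau>"
    and l: "3 \<le> l" "l \<le> k" and Y: "Y \<subseteq> V"
    and F: "F \<subseteq> E" and FY: "\<And>f. f \<in> F \<Longrightarrow> card (f \<inter> Y) = 1"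
    and F\<theta>: "\<And>f u v. f \<in> F \<Longrightarrow> u \<in> f \<Longrightarrow> v \<in> f \<Longrightarrow> u \<noteq> v \<Longrightarrow> real (codeg u v) \<le> \<theta>"
    and Y\<theta>: "\<And>u v. u \<in> Y \<Longrightarrow> v \<in> Y \<Longrightarrow> u \<noteq> v \<Longrightarrow> real (codeg u v) \<le> \<theta>"
    and \<theta>: "0 \<le> \<theta>" and D: "\<And>u. u \<in> Y \<Longrightarrow> real (deg u) \<le> D" "0 \<le> D"
    and \<eta>: "0 < \<eta>" and G: "1 \<le> G" "2 * \<eta> * (2 ^ k * D) \<le> G"
    and h: "k \<le> 2 * h" and \<kappa>: "0 \<le> \<kappa>"
    and m4: "\<And>f. lowdeg V k f \<Longrightarrow> avg V (\<lambda>X. f X ^ 4) \<le> \<kappa> * (avg V (\<lambda>X. (f X)\<^sup>2))\<^sup>2"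
    and mh: "\<And>f. lowdeg V k f \<Longrightarrow> avg V (\<lambda>X. f X ^ (2 * h)) \<le> \<kappa> * (avg V (\<lambda>X. (f X)\<^sup>2)) ^ h"
  defines "x \<equiv> \<eta>\<^sup>2 * (2 ^ k * D)" and "m \<equiv> real (card E)"
  shows "2 / 3 * \<eta> * \<bar>c l\<bar> * real (card F) \<le> \<tau>
    + 4 / 3 * C * \<eta>\<^sup>2 * (8 ^ k * (2 * m * real k ^ 4 * \<theta>\<^sup>2))
    + m * (2 ^ k * (2 ^ k * C * (real k * (\<kappa> * (x\<^sup>2 + x ^ h)))))
    + m * (2 ^ k * C * G ^ k) * (real (card Y) * (2 ^ (2 * h) * (\<kappa> * x ^ h)))"
proof -
  define M where "M = link_poly Y F l"
  \<comment> \<open>The coefficient of degree l may have either sign; its sign is put into the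
    answers so that every linear term is nonnegative.\<close>
  define \<sigma> where "\<sigma> = sgn (c l)"
  define y where "y u X = \<sigma> * \<eta> * M u X" for u X
  define R where "R = V - Y"
  have R: "R \<subseteq> V" "R \<inter> Y = {}" unfolding R_def by auto
  have fY: "finite Y" using Y finV finite_subset by blast
  have \<sigma>: "\<bar>\<sigma>\<bar> \<le> 1" "\<sigma> * c l = \<bar>c l\<bar>" unfolding \<sigma>_def by (auto simp: sgn_if)
  have ev: "\<sigma> ^ (2 * i) \<le> 1" for i using \<sigma>(1) by (simp add: power_mult abs_square_le_1 power_le_one)
  have low: "lowdeg V k (M u)" for u unfolding M_def by (rule lowdeg_link_poly[OF F l(2)])
  have x0: "0 \<le> x" unfolding x_def using D by simp
  have lD: "real (card (links Y F l u)) \<le> 2 ^ k * D" if "u \<in> Y" for u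
  proof -
    have "real (card (links Y F l u)) \<le> real (2 ^ k * deg u)"
      using card_links_le[OF F, of Y l u] by (simp only: of_nat_le_iff)
    also have "\<dots> \<le> 2 ^ k * D" using D(1)[OF that] by simp
    finally show ?thesis .
  qed
  have moment: "avg V (\<lambda>X. y u X ^ (2 * i)) \<le> \<kappa> * x ^ i"
    if "u \<in> Y" and mi: "\<And>f. lowdeg V k f \<Longrightarrow> avg V (\<lambda>X. f X ^ (2 * i)) \<le> \<kappa> * (avg V (\<lambda>X. (f X)\<^sup>2)) ^ i" for u i
  proof -
    have "avg V (\<lambda>X. y u X ^ (2 * i)) = \<sigma> ^ (2 * i) * (\<eta> ^ (2 * i) * avg V (\<lambda>X. M u X ^ (2 * i)))"
      unfolding y_def power_mult_distrib mult.assoc avg_cmult ..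
    also have "\<dots> \<le> 1 * (\<eta> ^ (2 * i) * (\<kappa> * (2 ^ k * D) ^ i))"
    proof (rule mult_mono[OF ev])
      have "avg V (\<lambda>X. M u X ^ (2 * i)) \<le> \<kappa> * (avg V (\<lambda>X. (M u X)\<^sup>2)) ^ i" by (rule mi[OF low])
      also have "avg V (\<lambda>X. (M u X)\<^sup>2) = card (links Y F l u)"
        unfolding M_def by (rule avg_link_poly_square[OF F])
      also have "\<kappa> * real (card (links Y F l u)) ^ i \<le> \<kappa> * (2 ^ k * D) ^ i"
        using lD[OF that(1)] \<kappa> by (intro mult_left_mono power_mono) auto
      finally show "\<eta> ^ (2 * i) * avg V (\<lambda>X. M u X ^ (2 * i)) \<le> \<eta> ^ (2 * i) * (\<kappa> * (2 ^ k * D) ^ i)"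
        using \<eta> by (intro mult_left_mono) auto
    qed (use \<eta> in \<open>auto intro!: mult_nonneg_nonneg avg_nonneg simp: power_mult\<close>)
    also have "\<dots> = \<kappa> * x ^ i" unfolding x_def by (simp add: power_mult_distrib power_mult)
    finally show ?thesis .
  qed
  have mom4: "avg V (\<lambda>X. y u X ^ 4) \<le> \<kappa> * x\<^sup>2" if "u \<in> Y" for u
    using moment[OF that, of 2] m4 by simp
  have momh: "avg V (\<lambda>X. y u X ^ (2 * h)) \<le> \<kappa> * x ^ h" if "u \<in> Y" for u
    using moment[OF that, of h] mh by simp
  define Q where "Q = real k * (\<kappa> * (x\<^sup>2 + x ^ h))"
  have Q0: "0 \<le> Q" unfolding Q_def using \<kappa> x0 by simp

  define a where "a S = avg V (\<lambda>X. chi (S - Y) X * (\<Prod>u\<in>S \<inter> Y. y u X))" for S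
  define b where "b S = avg V (\<lambda>X. chi (S - Y) X * (\<Prod>u\<in>S \<inter> Y. M u X))" for S
  define L where "L e = (\<Sum>u\<in>e \<inter> Y. \<Sum>P\<in>Pow (e \<inter> R). c (Suc (card P)) * avg V (\<lambda>X. chi P X * y u X))" for e
  define \<S> where "\<S> e = {S \<in> Pow (e \<inter> (R \<union> Y)). 2 \<le> card (S \<inter> Y)}" for e
  define \<Phi> where "\<Phi> t = avg V (\<lambda>X. edge_poly c E (mixed R Y (\<lambda>u X. t * y u X) X))" for t
  \<comment> \<open>Scaling all answers by t multiplies a term with i vertices in Y by t^i, so
    averages over a random t act on each i separately.\<close>
  have \<Phi>: "\<Phi> t = (\<Sum>e\<in>E. t * L e + (\<Sum>S\<in>\<S> e. t ^ card (S \<inter> Y) * (c (card S) * a S)))" for t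
  proof -
    have 1: "avg V (\<lambda>X. chi P X * (t * y u X)) = t * avg V (\<lambda>X. chi P X * y u X)" for P u
      unfolding avg_cmult[symmetric] by (simp add: algebra_simps)
    have 2: "avg V (\<lambda>X. chi (S - Y) X * (\<Prod>u\<in>S \<inter> Y. t * y u X)) = t ^ card (S \<inter> Y) * a S" for S
      unfolding a_def avg_cmult[symmetric] by (simp add: prod.distrib algebra_simps)
    show ?thesis unfolding \<Phi>_def avg_edge_poly_mixed[OF R] 1 2 L_def \<S>_def
      by (simp add: sum_distrib_left algebra_simps)
  qed

  text \<open>A common factor that is \<open>1\<close> with probability \<open>8/9\<close> and \<open>-2\<close> with probability \<open>1/9\<close> has positive mean
    and vanishing third moment, which removes the terms with three vertices in \<open>Y\<close>.\<close>
  define w where "w i = (8 + (- 2 :: real) ^ i) / 9" for i :: nat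
  have comb: "(8 * \<Phi> 1 + \<Phi> (- 2)) / 9 = (\<Sum>e\<in>E. 2 / 3 * L e + (\<Sum>S\<in>\<S> e. w (card (S \<inter> Y)) * (c (card S) * a S)))"
  proof -
    have "(8 * \<Phi> 1 + \<Phi> (- 2)) / 9 = (\<Sum>e\<in>E. (8 * (L e + (\<Sum>S\<in>\<S> e. c (card S) * a S))
      + (- 2 * L e + (\<Sum>S\<in>\<S> e. (- 2) ^ card (S \<inter> Y) * (c (card S) * a S)))) / 9)"
    proof -
      have "(8 * sum f E + sum g E) / 9 = (\<Sum>e\<in>E. (8 * f e + g e) / 9)" for f g :: "'a set \<Rightarrow> real"
        by (simp add: sum.distrib sum_distrib_left sum_divide_distrib[symmetric])
      then show ?thesis unfolding \<Phi> by simp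
    qed
    also have "\<dots> = (\<Sum>e\<in>E. 2 / 3 * L e + (\<Sum>S\<in>\<S> e. w (card (S \<inter> Y)) * (c (card S) * a S)))"
    proof (rule sum.cong[OF refl])
      fix e
      have "(\<Sum>S\<in>\<S> e. w (card (S \<inter> Y)) * (c (card S) * a S))
         = (8 * (\<Sum>S\<in>\<S> e. c (card S) * a S) + (\<Sum>S\<in>\<S> e. (- 2) ^ card (S \<inter> Y) * (c (card S) * a S))) / 9"
        unfolding w_def sum_distrib_left sum.distrib[symmetric] sum_divide_distrib
        by (intro sum.cong refl) (simp add: field_simps)
      then show "(8 * (L e + (\<Sum>S\<in>\<S> e. c (card S) * a S))
      + (- 2 * L e + (\<Sum>S\<in>\<S> e. (- 2) ^ card (S \<inter> Y) * (c (card S) * a S)))) / 9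
        = 2 / 3 * L e + (\<Sum>S\<in>\<S> e. w (card (S \<inter> Y)) * (c (card S) * a S))" by simp
    qed
    finally show ?thesis .
  qed

  have Lterm: "c (Suc (card P)) * avg V (\<lambda>X. chi P X * y u X) = (if P \<in> links Y F l u then \<eta> * \<bar>c l\<bar> else 0)"
    if "P \<subseteq> V" for P u
  proof -
    have "avg V (\<lambda>X. chi P X * y u X) = \<sigma> * \<eta> * avg V (\<lambda>X. chi P X * M u X)"
      unfolding y_def avg_cmult[symmetric] by (simp add: algebra_simps)
    also have "avg V (\<lambda>X. chi P X * M u X) = (if P \<in> links Y F l u then 1 else 0)"
      unfolding M_def by (rule avg_chi_link_poly[OF F that])
    finally have eq: "avg V (\<lambda>X. chi P X * y u X) = \<sigma> * \<eta> * (if P \<in> links Y F l u then 1 else 0)" .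
    show ?thesis
    proof (cases "P \<in> links Y F l u")
      case True
      then have "Suc (card P) = l" using l unfolding links_def by auto
      then show ?thesis using True \<sigma>(2) unfolding eq by (simp add: algebra_simps)
    qed (simp add: eq)
  qed
  have L0: "0 \<le> L e" if "e \<in> E" for e
    unfolding L_def using Lterm R edge_V[OF that] \<eta>
    by (intro sum_nonneg) (subst Lterm, auto)
  \<comment> \<open>The linear terms of an edge are nonnegative, so it suffices to find one
    monomial: any l - 1 vertices of the edge off Y form a link of its unique vertex in Y.\<close>
  have LF: "\<eta> * \<bar>c l\<bar> \<le> L e" if e: "e \<in> F" for e
  proof -
    have eE: "e \<in> E" and fe: "finite e" "card e = k" using e F fin_edge card_edge by auto
    obtain u where u: "e \<inter> Y = {u}" using FY[OF e] by (auto simp: card_1_singleton_iff)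
    have eR: "e \<inter> R = e - {u}" unfolding R_def using u edge_V[OF eE] by auto
    have ue: "u \<in> e" using u by auto
    have "l - 1 \<le> card (e - {u})" using fe ue l by simp
    then obtain P where P: "P \<subseteq> e - {u}" "card P = l - 1" by (rule obtain_subset_with_card_n)
    have PR: "P \<in> Pow (e \<inter> R)" using P eR by auto
    have Pl: "P \<in> links Y F l u" unfolding links_def using P PR e ue unfolding R_def by auto
    have "\<eta> * \<bar>c l\<bar> = c (Suc (card P)) * avg V (\<lambda>X. chi P X * y u X)"
      using Pl PR R by (subst Lterm) auto
    also have "\<dots> \<le> (\<Sum>P\<in>Pow (e \<inter> R). c (Suc (card P)) * avg V (\<lambda>X. chi P X * y u X))"
    proof (rule member_le_sum[OF PR])
      fix P' assume "P' \<in> Pow (e \<inter> R) - {P}"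
      then show "0 \<le> c (Suc (card P')) * avg V (\<lambda>X. chi P' X * y u X)"
        using R \<eta> by (subst Lterm) auto
    qed (use fe in auto)
    also have "\<dots> = L e" unfolding L_def u by simp
    finally show ?thesis .
  qed
  have Lsum: "\<eta> * \<bar>c l\<bar> * real (card F) \<le> (\<Sum>e\<in>E. L e)"
  proof -
    have "\<eta> * \<bar>c l\<bar> * real (card F) = (\<Sum>e\<in>F. \<eta> * \<bar>c l\<bar>)" by simp
    also have "\<dots> \<le> (\<Sum>e\<in>F. L e)" by (rule sum_mono[OF LF])
    also have "\<dots> \<le> (\<Sum>e\<in>E. L e)" by (rule sum_mono2) (use finE F L0 in auto)
    finally show ?thesis .
  qed

  have ab: "\<bar>a S\<bar> \<le> \<eta>\<^sup>2 * \<bar>b S\<bar>" if "card (S \<inter> Y) = 2" for S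
  proof -
    have "a S = avg V (\<lambda>X. (\<sigma> * \<eta>)\<^sup>2 * (chi (S - Y) X * (\<Prod>u\<in>S \<inter> Y. M u X)))"
      unfolding a_def y_def using that by (simp add: prod.distrib power2_eq_square algebra_simps)
    also have "\<dots> = \<sigma> ^ (2 * 1) * (\<eta>\<^sup>2 * b S)" unfolding avg_cmult b_def by (simp add: power_mult_distrib)
    finally have "\<bar>a S\<bar> = \<sigma> ^ (2 * 1) * (\<eta>\<^sup>2 * \<bar>b S\<bar>)" by (simp add: abs_mult)
    also have "\<dots> \<le> 1 * (\<eta>\<^sup>2 * \<bar>b S\<bar>)" by (intro mult_right_mono ev) auto
    finally show ?thesis by simp
  qed
  have a4: "\<bar>a S\<bar> \<le> Q" if e: "e \<in> E" and S: "S \<subseteq> e" "4 \<le> card (S \<inter> Y)" for e S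
  proof -
    have fe: "finite e" "card e = k" using fin_edge[OF e] card_edge[OF e] by auto
    have "S \<inter> Y \<subseteq> e" using S by auto
    then have ck: "card (S \<inter> Y) \<le> k" using card_mono[OF fe(1)] fe(2) by metis
    then have cS: "card (S \<inter> Y) \<le> 2 * h" using h by simp
    have "\<bar>a S\<bar> \<le> avg V (\<lambda>X. \<bar>chi (S - Y) X * (\<Prod>u\<in>S \<inter> Y. y u X)\<bar>)" unfolding a_def by (rule abs_avg_le)
    also have "\<dots> \<le> avg V (\<lambda>X. \<Sum>u\<in>S \<inter> Y. y u X ^ 4 + y u X ^ (2 * h))"
    proof (rule avg_mono)
      fix X
      have "\<bar>chi (S - Y) X * (\<Prod>u\<in>S \<inter> Y. y u X)\<bar> = (\<Prod>u\<in>S \<inter> Y. \<bar>y u X\<bar>)"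
        by (simp add: abs_mult abs_chi abs_prod)
      also have "\<dots> \<le> (\<Sum>u\<in>S \<inter> Y. y u X ^ 4 + y u X ^ (2 * h))"
        by (rule prod_abs_le_sum_powers) (use fY S cS in auto)
      finally show "\<bar>chi (S - Y) X * (\<Prod>u\<in>S \<inter> Y. y u X)\<bar> \<le> (\<Sum>u\<in>S \<inter> Y. y u X ^ 4 + y u X ^ (2 * h))" .
    qed
    also have "\<dots> = (\<Sum>u\<in>S \<inter> Y. avg V (\<lambda>X. y u X ^ 4) + avg V (\<lambda>X. y u X ^ (2 * h)))"
      unfolding avg_sum avg_add ..
    also have "\<dots> \<le> (\<Sum>u\<in>S \<inter> Y. \<kappa> * x\<^sup>2 + \<kappa> * x ^ h)"
      by (intro sum_mono add_mono mom4 momh) auto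
    also have "\<dots> = real (card (S \<inter> Y)) * (\<kappa> * (x\<^sup>2 + x ^ h))" by (simp add: algebra_simps)
    also have "\<dots> \<le> Q" unfolding Q_def
      using ck \<kappa> x0 by (intro mult_right_mono) auto
    finally show ?thesis .
  qed
  have w: "w 2 = 4 / 3" "w 3 = 0" "\<bar>w i\<bar> \<le> 2 ^ i" for i
  proof -
    show "w 2 = 4 / 3" "w 3 = 0" unfolding w_def by simp_all
    have "\<bar>(- 2 :: real) ^ i\<bar> = 2 ^ i" by (simp add: power_abs)
    moreover have "(1 :: real) \<le> 2 ^ i" by simp
    ultimately have "\<bar>8 + (- 2 :: real) ^ i\<bar> \<le> 9 * 2 ^ i"
      using abs_triangle_ineq[of 8 "(- 2 :: real) ^ i"] by linarith
    then show "\<bar>w i\<bar> \<le> 2 ^ i" unfolding w_def by (simp add: abs_divide)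
  qed
  have hi: "- (4 / 3 * C * \<eta>\<^sup>2 * (\<Sum>S\<in>{S \<in> Pow e. card (S \<inter> Y) = 2}. \<bar>b S\<bar>) + 2 ^ k * (2 ^ k * C * Q))
      \<le> (\<Sum>S\<in>\<S> e. w (card (S \<inter> Y)) * (c (card S) * a S))" if e: "e \<in> E" for e
  proof -
    have fe: "finite e" "card e = k" using fin_edge[OF e] card_edge[OF e] by auto
    have sub: "\<S> e \<subseteq> Pow e" unfolding \<S>_def by auto
    have fS: "finite (\<S> e)" using sub fe finite_subset by (metis finite_Pow_iff)
    have "\<bar>w (card (S \<inter> Y)) * (c (card S) * a S)\<bar> \<le>
        (if card (S \<inter> Y) = 2 then 4 / 3 * C * \<eta>\<^sup>2 * \<bar>b S\<bar> else 0) + 2 ^ k * C * Q" if S: "S \<in> \<S> e" for S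
    proof -
      have Se: "S \<subseteq> e" "2 \<le> card (S \<inter> Y)" using S unfolding \<S>_def by auto
      have "card S \<le> k" using card_mono[OF fe(1) Se(1)] fe(2) by simp
      then have cC': "\<bar>c (card S)\<bar> \<le> C" by (rule cC)
      have "S \<inter> Y \<subseteq> e" using Se by auto
      then have iY: "card (S \<inter> Y) \<le> k" using card_mono[OF fe(1)] fe(2) by metis
      have CQ: "0 \<le> 2 ^ k * C * Q" using C_pos Q0 by simp
      consider "card (S \<inter> Y) = 2" | "card (S \<inter> Y) = 3" | "4 \<le> card (S \<inter> Y)" using Se by linarith
      then show ?thesis
      proof cases
        case 1
        have "\<bar>w (card (S \<inter> Y)) * (c (card S) * a S)\<bar> = 4 / 3 * (\<bar>c (card S)\<bar> * \<bar>a S\<bar>)"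
          unfolding 1 w by (simp add: abs_mult)
        also have "\<dots> \<le> 4 / 3 * (C * (\<eta>\<^sup>2 * \<bar>b S\<bar>))"
          using cC' ab[OF 1] C_pos by (intro mult_left_mono mult_mono) auto
        finally show ?thesis using 1 CQ by (simp add: mult.assoc)
      next
        case 2
        then show ?thesis using CQ by (simp add: w)
      next
        case 3
        have "\<bar>w (card (S \<inter> Y)) * (c (card S) * a S)\<bar> \<le> 2 ^ k * (C * Q)"
          unfolding abs_mult
        proof (intro mult_mono)
          have "\<bar>w (card (S \<inter> Y))\<bar> \<le> 2 ^ card (S \<inter> Y)" by (rule w)
          also have "\<dots> \<le> 2 ^ k" using iY by (intro power_increasing) auto
          finally show "\<bar>w (card (S \<inter> Y))\<bar> \<le> 2 ^ k" .
        qed (use cC' a4[OF e Se(1) 3] C_pos Q0 in auto)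
        then show ?thesis using 3 by (simp add: mult.assoc)
      qed
    qed
    then have "\<bar>\<Sum>S\<in>\<S> e. w (card (S \<inter> Y)) * (c (card S) * a S)\<bar>
      \<le> (\<Sum>S\<in>\<S> e. (if card (S \<inter> Y) = 2 then 4 / 3 * C * \<eta>\<^sup>2 * \<bar>b S\<bar> else 0) + 2 ^ k * C * Q)"
      by (intro order_trans[OF sum_abs] sum_mono)
    also have "\<dots> \<le> (\<Sum>S\<in>Pow e. (if card (S \<inter> Y) = 2 then 4 / 3 * C * \<eta>\<^sup>2 * \<bar>b S\<bar> else 0) + 2 ^ k * C * Q)"
      by (rule sum_mono2) (use fe sub C_pos Q0 in auto)
    also have "\<dots> = (\<Sum>S\<in>{S \<in> Pow e. card (S \<inter> Y) = 2}. 4 / 3 * C * \<eta>\<^sup>2 * \<bar>b S\<bar>) + real (card (Pow e)) * (2 ^ k * C * Q)"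
      unfolding sum.distrib sum_constant using fe by (subst sum.inter_filter) auto
    also have "\<dots> = 4 / 3 * C * \<eta>\<^sup>2 * (\<Sum>S\<in>{S \<in> Pow e. card (S \<inter> Y) = 2}. \<bar>b S\<bar>) + 2 ^ k * (2 ^ k * C * Q)"
      using card_Pow_edge[OF e] by (simp add: sum_distrib_left)
    finally show ?thesis by linarith
  qed
  have bsum: "(\<Sum>e\<in>E. \<Sum>S\<in>{S \<in> Pow e. card (S \<inter> Y) = 2}. \<bar>b S\<bar>) \<le> 8 ^ k * (2 * m * real k ^ 4 * \<theta>\<^sup>2)"
    unfolding b_def M_def m_def by (rule sum_pair_correlations_le[OF F FY F\<theta> Y\<theta> \<theta> l(1)])
  have lower: "2 / 3 * (\<eta> * \<bar>c l\<bar> * real (card F)) - 4 / 3 * C * \<eta>\<^sup>2 * (8 ^ k * (2 * m * real k ^ 4 * \<theta>\<^sup>2))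
     - m * (2 ^ k * (2 ^ k * C * Q)) \<le> (8 * \<Phi> 1 + \<Phi> (- 2)) / 9"
  proof -
    have "2 / 3 * (\<Sum>e\<in>E. L e) - 4 / 3 * C * \<eta>\<^sup>2 * (\<Sum>e\<in>E. \<Sum>S\<in>{S \<in> Pow e. card (S \<inter> Y) = 2}. \<bar>b S\<bar>)
        - m * (2 ^ k * (2 ^ k * C * Q))
      = (\<Sum>e\<in>E. 2 / 3 * L e - (4 / 3 * C * \<eta>\<^sup>2 * (\<Sum>S\<in>{S \<in> Pow e. card (S \<inter> Y) = 2}. \<bar>b S\<bar>) + 2 ^ k * (2 ^ k * C * Q)))"
      unfolding m_def by (simp add: sum.distrib sum_subtractf sum_distrib_left)
    also have "\<dots> \<le> (8 * \<Phi> 1 + \<Phi> (- 2)) / 9"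
      unfolding comb using hi by (intro sum_mono) force
    finally have "2 / 3 * (\<Sum>e\<in>E. L e) - 4 / 3 * C * \<eta>\<^sup>2 * (\<Sum>e\<in>E. \<Sum>S\<in>{S \<in> Pow e. card (S \<inter> Y) = 2}. \<bar>b S\<bar>)
        - m * (2 ^ k * (2 ^ k * C * Q)) \<le> (8 * \<Phi> 1 + \<Phi> (- 2)) / 9" .
    moreover have "4 / 3 * C * \<eta>\<^sup>2 * (\<Sum>e\<in>E. \<Sum>S\<in>{S \<in> Pow e. card (S \<inter> Y) = 2}. \<bar>b S\<bar>)
      \<le> 4 / 3 * C * \<eta>\<^sup>2 * (8 ^ k * (2 * m * real k ^ 4 * \<theta>\<^sup>2))"
      using bsum C_pos by (intro mult_left_mono) auto
    ultimately show ?thesis using Lsum by linarith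
  qed

  define B where "B = m * (2 ^ k * C * G ^ k)"
  have B0: "0 \<le> B" unfolding B_def m_def using C_pos G by simp
  have \<tau>0: "0 \<le> \<tau>" using ub[of "\<lambda>_. 0"] edge_poly_zero by simp
  have y2: "\<bar>2 * y u X\<bar> \<le> G" if "u \<in> Y" for u X
  proof -
    have "\<bar>2 * y u X\<bar> = \<bar>\<sigma>\<bar> * (2 * \<eta> * \<bar>M u X\<bar>)" unfolding y_def using \<eta> by (simp add: abs_mult)
    also have "\<dots> \<le> 1 * (2 * \<eta> * (2 ^ k * D))"
      using \<sigma>(1) \<eta> order_trans[OF abs_link_poly_le[OF F, of Y l u X] lD[OF that]] unfolding M_def
      by (intro mult_mono) auto
    finally show ?thesis using G by simp
  qed
  \<comment> \<open>Where all |2 y| \<le> 1, the hypothesis on the polynomial applies, as |t| \<le>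
    2. Elsewhere the crude bound B is used, and the indicator of that event is at most the sum of
    the powers (2 y)^(2 h), whose mean is small for large h.\<close>
  have upper: "\<Phi> t \<le> \<tau> + B * (real (card Y) * (2 ^ (2 * h) * (\<kappa> * x ^ h)))" if t: "\<bar>t\<bar> \<le> 2" for t
  proof -
    have ty: "\<bar>t * y u X\<bar> \<le> \<bar>2 * y u X\<bar>" for u X using t by (simp add: abs_mult mult_right_mono)
    have "edge_poly c E (mixed R Y (\<lambda>u X. t * y u X) X) \<le> \<tau> + B * (\<Sum>u\<in>Y. (2 * y u X) ^ (2 * h))" for X
    proof (cases "\<forall>u\<in>Y. \<bar>2 * y u X\<bar> \<le> 1")
      case True
      have "\<bar>mixed R Y (\<lambda>u X. t * y u X) X v\<bar> \<le> 1" for v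
        unfolding mixed_def using True order_trans[OF ty] by (auto simp: abs_chi)
      then have "edge_poly c E (mixed R Y (\<lambda>u X. t * y u X) X) \<le> \<tau>" by (rule ub)
      moreover have "0 \<le> B * (\<Sum>u\<in>Y. (2 * y u X) ^ (2 * h))"
        using B0 by (intro mult_nonneg_nonneg sum_nonneg) auto
      ultimately show ?thesis by linarith
    next
      case False
      then obtain u where u: "u \<in> Y" "1 < \<bar>2 * y u X\<bar>" by auto
      then have "1 \<le> \<bar>2 * y u X\<bar> ^ (2 * h)" by (intro one_le_power) auto
      also have "\<dots> = (2 * y u X) ^ (2 * h)" by (simp add: power_even_abs)
      also have "\<dots> \<le> (\<Sum>u\<in>Y. (2 * y u X) ^ (2 * h))" by (rule member_le_sum) (use u fY in auto)
      finally have one: "1 \<le> (\<Sum>u\<in>Y. (2 * y u X) ^ (2 * h))" .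
      have "\<bar>mixed R Y (\<lambda>u X. t * y u X) X v\<bar> \<le> G" for v
        unfolding mixed_def using y2 order_trans[OF ty] G by (auto simp: abs_chi)
      then have "\<bar>edge_poly c E (mixed R Y (\<lambda>u X. t * y u X) X)\<bar> \<le> B"
        unfolding B_def m_def by (rule abs_edge_poly_le) (rule G)
      moreover have "B * 1 \<le> B * (\<Sum>u\<in>Y. (2 * y u X) ^ (2 * h))" using one B0 by (intro mult_left_mono)
      ultimately show ?thesis using \<tau>0 by linarith
    qed
    then have "\<Phi> t \<le> avg V (\<lambda>X. \<tau> + B * (\<Sum>u\<in>Y. 2 ^ (2 * h) * y u X ^ (2 * h)))"
      unfolding \<Phi>_def power_mult_distrib by (rule avg_mono)
    also have "\<dots> = \<tau> + B * (\<Sum>u\<in>Y. 2 ^ (2 * h) * avg V (\<lambda>X. y u X ^ (2 * h)))"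
      unfolding avg_add avg_cmult avg_sum avg_const[OF finV] ..
    also have "\<dots> \<le> \<tau> + B * (\<Sum>u\<in>Y. 2 ^ (2 * h) * (\<kappa> * x ^ h))"
      using momh B0 by (intro add_left_mono mult_left_mono sum_mono) auto
    finally show ?thesis by simp
  qed
  have "(8 * \<Phi> 1 + \<Phi> (- 2)) / 9 \<le> \<tau> + B * (real (card Y) * (2 ^ (2 * h) * (\<kappa> * x ^ h)))"
    using upper[of 1] upper[of "- 2"] by simp
  then show ?thesis using lower unfolding B_def Q_def by (simp add: algebra_simps)
qed

end

section \<open>The choice of parameters\<close>

text \<open>Choose Y at random in L. For a fixed v in e \<inter> L, the event that Y meets e exactly
  in v has probability at least 2^-k; averaging over Y gives the claim.\<close>

lemma exists_single_intersections:
  assumes "finite L" "finite F" and F: "\<And>e. e \<in> F \<Longrightarrow> finite e \<and> card e = k \<and> e \<inter> L \<noteq> {}"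
  shows "\<exists>Y\<subseteq>L. card F \<le> 2 ^ k * card {e \<in> F. card (e \<inter> Y) = 1}"
proof (rule ccontr)
  assume "\<not> ?thesis"
  then have less: "2 ^ k * card {e \<in> F. card (e \<inter> Y) = 1} < card F" if "Y \<in> Pow L" for Y
    using that by (auto simp: not_le)
  have each: "2 ^ card L \<le> 2 ^ k * card {Y \<in> Pow L. card (e \<inter> Y) = 1}" if e: "e \<in> F" for e
  proof -
    obtain v where v: "v \<in> e" "v \<in> L" using F[OF e] by auto
    have fe: "finite e" "card e = k" using F[OF e] by auto
    have "insert v ` Pow (L - e) \<subseteq> {Y \<in> Pow L. card (e \<inter> Y) = 1}"
    proof
      fix Y assume "Y \<in> insert v ` Pow (L - e)"
      then obtain Z where Z: "Z \<subseteq> L - e" "Y = insert v Z" by auto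
      then have "e \<inter> Y = {v}" "Y \<subseteq> L" using v by auto
      then show "Y \<in> {Y \<in> Pow L. card (e \<inter> Y) = 1}" by simp
    qed
    then have "card (insert v ` Pow (L - e)) \<le> card {Y \<in> Pow L. card (e \<inter> Y) = 1}"
      using assms(1) by (intro card_mono) auto
    moreover have "card (insert v ` Pow (L - e)) = 2 ^ card (L - e)"
      using v assms(1) by (subst card_image) (auto simp: card_Pow intro!: inj_on_inverseI[of _ "\<lambda>Z. Z - {v}"])
    moreover have "(2::nat) ^ card L \<le> 2 ^ k * 2 ^ card (L - e)"
    proof -
      have "card L \<le> card (L - e) + card e"
        using diff_card_le_card_Diff[OF fe(1), of L] by simp
      then show ?thesis using fe by (simp add: power_add[symmetric] add.commute)
    qed
    ultimately show ?thesis
      using mult_le_mono2[of "2 ^ card (L - e)" "card {Y \<in> Pow L. card (e \<inter> Y) = 1}" "2 ^ k"] by linarith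
  qed
  have "2 ^ card L * card F = (\<Sum>e\<in>F. 2 ^ card L)" by (simp add: mult.commute)
  also have "\<dots> \<le> (\<Sum>e\<in>F. 2 ^ k * card {Y \<in> Pow L. card (e \<inter> Y) = 1})" by (rule sum_mono[OF each])
  also have "\<dots> = 2 ^ k * (\<Sum>e\<in>F. card {Y \<in> Pow L. card (e \<inter> Y) = 1})" by (rule sum_distrib_left[symmetric])
  also have "(\<Sum>e\<in>F. card {Y \<in> Pow L. card (e \<inter> Y) = 1}) = (\<Sum>Y\<in>Pow L. card {e \<in> F. card (e \<inter> Y) = 1})"
    by (rule sum_multicount_gen) (use assms in auto)
  also have "2 ^ k * \<dots> = (\<Sum>Y\<in>Pow L. 2 ^ k * card {e \<in> F. card (e \<inter> Y) = 1})" by (rule sum_distrib_left)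
  also have "\<dots> < (\<Sum>Y\<in>Pow L. card F)"
    by (rule sum_strict_mono) (use less assms in auto)
  also have "\<dots> = 2 ^ card L * card F" using assms by (simp add: card_Pow)
  finally show False by simp
qed

context uniform_poly
begin

text \<open>With B = b \<open>\<tau>\<close> bounding the total weight, the edges with two heavy
  vertices (\<open>E1\<close>) number at most 2 B^2 / q, and those with a heavy-light pair of
  codegree above q^2 (\<open>E2\<close>) at most k B^2 / q. The second hypothesis on
  \<open>\<tau>\<close> makes both together at most half of all edges. Light pairs cause no removal,
  since their codegree is at most q.\<close>

lemma structure_of_edges:
  fixes q \<tau> b :: real
  assumes ub: "\<And>s. (\<And>v. \<bar>s v\<bar> \<le> 1) \<Longrightarrow> edge_poly c E s \<le> \<tau>"
    and q: "1 \<le> q" "q ^ 9 = real (card E)" and b: "b = 8 * (2 ^ k * C) / (c 2)\<^sup>2"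
    and \<tau>: "2 * b * \<tau> \<le> q ^ 5" "2 * (k + 2) * (b * \<tau>)\<^sup>2 \<le> q ^ 10"
  obtains L F where "L \<subseteq> V" "F \<subseteq> E" "q ^ 9 \<le> 2 * real (card F)"
    "\<And>u. u \<in> L \<Longrightarrow> real (deg u) \<le> q ^ 6"
    "\<And>u v. u \<in> L \<Longrightarrow> v \<in> L \<Longrightarrow> u \<noteq> v \<Longrightarrow> real (codeg u v) \<le> q\<^sup>2"
    "\<And>f u v. f \<in> F \<Longrightarrow> u \<in> f \<Longrightarrow> v \<in> f \<Longrightarrow> u \<noteq> v \<Longrightarrow> real (codeg u v) \<le> q\<^sup>2"
    "\<And>f. f \<in> F \<Longrightarrow> f \<inter> L \<noteq> {}"
proof -
  obtain z :: "'a \<Rightarrow> nat" where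
    z: "\<And>u v. u \<in> V \<Longrightarrow> v \<in> V \<Longrightarrow> u \<noteq> v \<Longrightarrow> codeg u v \<le> max (z u) (z v)"
    and sz: "(c 2)\<^sup>2 * real (\<Sum>v\<in>V. z v) \<le> 8 * (2 ^ k * C) * \<tau>"
    using vertex_weights[OF ub] by blast
  define B where "B = b * \<tau>"
  have c2': "(c 2)\<^sup>2 > 0" using c2 by simp
  have szB: "(\<Sum>v\<in>V. real (z v)) \<le> B"
    using sz c2' unfolding B_def b by (simp add: field_simps)
  have B0: "0 \<le> B" using szB by (meson of_nat_0_le_iff order_trans sum_nonneg)
  have zB: "(\<Sum>v\<in>W. real (z v)) \<le> B" if "W \<subseteq> V" for W
    using sum_mono2[OF finV that, of "\<lambda>v. real (z v)"] szB by simp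
  have q0: "0 < q" using q by simp
  have codeg_add: "real (codeg u v) \<le> real (z u) + real (z v)" if "u \<in> V" "v \<in> V" "u \<noteq> v" for u v
    using z[OF that] by linarith
  have codeg_pos: "1 \<le> codeg u v" if "e \<in> E" "u \<in> e" "v \<in> e" for e u v
  proof -
    have "e \<in> {e \<in> E. u \<in> e \<and> v \<in> e}" using that by simp
    then have "0 < card {e \<in> E. u \<in> e \<and> v \<in> e}" using finE by (intro card_gt_0_iff[THEN iffD2]) auto
    then show ?thesis unfolding codeg_def by simp
  qed

  define H where "H = {v \<in> V. q < real (z v)}"
  define L where "L = V - H"
  have HV: "H \<subseteq> V" "finite H" and LV: "L \<subseteq> V" "finite L" and HL: "H \<inter> L = {}"
    unfolding H_def L_def using finV by auto
  have zL: "real (z v) \<le> q" if "v \<in> L" for v using that unfolding L_def H_def by auto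
  have cH: "real (card H) * q \<le> B"
  proof -
    have "real (card H) * q = (\<Sum>v\<in>H. q)" by simp
    also have "\<dots> \<le> (\<Sum>v\<in>H. real (z v))" by (rule sum_mono) (auto simp: H_def)
    also have "\<dots> \<le> B" by (rule zB[OF HV(1)])
    finally show ?thesis .
  qed
  define Z where "Z = {v \<in> V. 0 < z v}"
  have Z: "Z \<subseteq> V" "finite Z" unfolding Z_def using finV by auto
  have cZ: "real (card Z) \<le> B"
  proof -
    have "real (card Z) = (\<Sum>v\<in>Z. 1)" by simp
    also have "\<dots> \<le> (\<Sum>v\<in>Z. real (z v))" by (rule sum_mono) (auto simp: Z_def)
    also have "\<dots> \<le> B" by (rule zB[OF Z(1)])
    finally show ?thesis .
  qed

  \<comment> \<open>This uses k \<ge> 3: an edge through u has two further vertices, whose codegree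
    is positive, so one of them has positive weight. The degree of u is therefore at most the sum of
    its codegrees to the at most B vertices of positive weight.\<close>
  have Ldeg: "real (deg u) \<le> 2 * B * q" if u: "u \<in> L" for u
  proof -
    have uV: "u \<in> V" using u LV by auto
    have "{e \<in> E. u \<in> e} \<subseteq> (\<Union>w\<in>Z - {u}. {e \<in> E. u \<in> e \<and> w \<in> e})"
    proof
      fix e assume "e \<in> {e \<in> E. u \<in> e}"
      then have e: "e \<in> E" "u \<in> e" by auto
      have "2 \<le> card (e - {u})" using e fin_edge card_edge k3 by simp
      then obtain T where T: "T \<subseteq> e - {u}" "card T = 2" by (rule obtain_subset_with_card_n)
      then obtain w w' where w: "T = {w, w'}" "w \<noteq> w'" by (auto simp: card_2_iff)
      have w2: "w \<in> e" "w' \<in> e" "w \<noteq> u" "w' \<noteq> u" "w \<in> V" "w' \<in> V" using T w edge_V[OF e(1)] by auto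
      have "1 \<le> max (z w) (z w')" using codeg_pos[OF e(1) w2(1,2)] z[OF w2(5,6) w(2)] by linarith
      then have "w \<in> Z \<or> w' \<in> Z" unfolding Z_def using w2 by auto
      then show "e \<in> (\<Union>w\<in>Z - {u}. {e \<in> E. u \<in> e \<and> w \<in> e})" using e w2 by auto
    qed
    then have "deg u \<le> card (\<Union>w\<in>Z - {u}. {e \<in> E. u \<in> e \<and> w \<in> e})"
      unfolding deg_def using Z finE by (intro card_mono) auto
    also have "\<dots> \<le> (\<Sum>w\<in>Z - {u}. codeg u w)"
      unfolding codeg_def using Z by (intro card_UN_le) auto
    finally have "real (deg u) \<le> real (\<Sum>w\<in>Z - {u}. codeg u w)" by (simp only: of_nat_le_iff)
    also have "\<dots> \<le> (\<Sum>w\<in>Z - {u}. q + real (z w))"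
      unfolding of_nat_sum
    proof (rule sum_mono)
      fix w assume "w \<in> Z - {u}"
      then show "real (codeg u w) \<le> q + real (z w)"
        using codeg_add[of u w] uV Z zL[OF u] by auto
    qed
    also have "\<dots> \<le> (\<Sum>w\<in>Z. q + real (z w))"
      using Z q0 by (intro sum_mono2) auto
    also have "\<dots> = real (card Z) * q + (\<Sum>w\<in>Z. real (z w))" by (simp add: sum.distrib)
    also have "\<dots> \<le> B * q + B" using cZ zB[OF Z(1)] q0 by (intro add_mono mult_right_mono) auto
    also have "\<dots> \<le> 2 * B * q" using mult_left_mono[OF q(1) B0] by simp
    finally show ?thesis .
  qed
  have D6: "2 * B * q \<le> q ^ 6"
  proof -
    have "2 * B * q \<le> q ^ 5 * q" using \<tau>(1) q0 unfolding B_def by (intro mult_right_mono) auto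
    then show ?thesis by (simp add: power_Suc2[symmetric])
  qed

  define E1 where "E1 = {e \<in> E. \<exists>u\<in>e \<inter> H. \<exists>v\<in>e \<inter> H. u \<noteq> v}"
  have E1: "real (card E1) * q \<le> 2 * B\<^sup>2"
  proof -
    define P where "P = {x \<in> H \<times> H. fst x \<noteq> snd x}"
    have fP: "finite P" unfolding P_def using HV by auto
    have "E1 \<subseteq> (\<Union>x\<in>P. {e \<in> E. fst x \<in> e \<and> snd x \<in> e})"
    proof
      fix e assume "e \<in> E1"
      then obtain u v where "e \<in> E" "u \<in> e \<inter> H" "v \<in> e \<inter> H" "u \<noteq> v" unfolding E1_def by auto
      then have "(u, v) \<in> P" "e \<in> {e \<in> E. fst (u, v) \<in> e \<and> snd (u, v) \<in> e}" unfolding P_def by auto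
      then show "e \<in> (\<Union>x\<in>P. {e \<in> E. fst x \<in> e \<and> snd x \<in> e})" by blast
    qed
    then have "card E1 \<le> card (\<Union>x\<in>P. {e \<in> E. fst x \<in> e \<and> snd x \<in> e})"
      using fP finE by (intro card_mono) auto
    also have "\<dots> \<le> (\<Sum>x\<in>P. codeg (fst x) (snd x))"
      unfolding codeg_def by (rule card_UN_le[OF fP])
    finally have "real (card E1) \<le> real (\<Sum>x\<in>P. codeg (fst x) (snd x))" by (simp only: of_nat_le_iff)
    also have "\<dots> \<le> (\<Sum>x\<in>P. real (z (fst x)) + real (z (snd x)))"
      unfolding of_nat_sum
    proof (rule sum_mono)
      fix x assume "x \<in> P"
      then show "real (codeg (fst x) (snd x)) \<le> real (z (fst x)) + real (z (snd x))"
        using HV by (intro codeg_add) (auto simp: P_def)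
    qed
    also have "\<dots> \<le> (\<Sum>x\<in>H \<times> H. real (z (fst x)) + real (z (snd x)))"
      by (rule sum_mono2) (use HV in \<open>auto simp: P_def\<close>)
    also have "\<dots> = (\<Sum>u\<in>H. \<Sum>v\<in>H. real (z u) + real (z v))"
      by (simp add: sum.cartesian_product case_prod_beta)
    also have "\<dots> = 2 * (real (card H) * (\<Sum>u\<in>H. real (z u)))"
      by (simp add: sum.distrib sum_distrib_left)
    also have "\<dots> \<le> 2 * (real (card H) * B)" using zB[OF HV(1)] by (intro mult_left_mono) auto
    finally have "real (card E1) * q \<le> 2 * (real (card H) * B) * q" using q0 by (intro mult_right_mono) auto
    also have "\<dots> = 2 * B * (real (card H) * q)" by simp
    also have "\<dots> \<le> 2 * B * B" using cH B0 by (intro mult_left_mono) auto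
    finally show ?thesis by (simp add: power2_eq_square)
  qed

  define Q where "Q = {x \<in> H \<times> L. q\<^sup>2 < real (codeg (fst x) (snd x))}"
  have Q: "Q \<subseteq> H \<times> L" "finite Q" unfolding Q_def using HV LV by auto
  define E2 where "E2 = {e \<in> E. \<exists>x\<in>Q. fst x \<in> e \<and> snd x \<in> e}"
  \<comment> \<open>On Q the codegree exceeds q^2, so q^2 |E2| is at most the sum of squared
    codegrees, which \<open>heavy_light_bound\<close> controls with D = 2 B q. The constant b is
    such that (c 2)^2 b = 8 2^k C, and the remaining factors combine to k B^2 q.\<close>
  have E2: "real (card E2) * q \<le> k * B\<^sup>2"
  proof -
    have bound: "B > 0 \<Longrightarrow> (c 2)\<^sup>2 * (\<Sum>(a, u)\<in>Q. real (codeg a u) ^ 2) \<le> 4 * (2 ^ k * C) * k * (2 * B * q) * \<tau>"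
      by (rule heavy_light_bound[OF ub HV(1) LV(1) HL Ldeg _ Q(1)]) (use q0 in auto)
    have "E2 \<subseteq> (\<Union>x\<in>Q. {e \<in> E. fst x \<in> e \<and> snd x \<in> e})" unfolding E2_def by auto
    then have "card E2 \<le> card (\<Union>x\<in>Q. {e \<in> E. fst x \<in> e \<and> snd x \<in> e})"
      using Q finE by (intro card_mono) auto
    also have "\<dots> \<le> (\<Sum>x\<in>Q. codeg (fst x) (snd x))"
      unfolding codeg_def by (rule card_UN_le[OF Q(2)])
    finally have "real (card E2) \<le> real (\<Sum>x\<in>Q. codeg (fst x) (snd x))" by (simp only: of_nat_le_iff)
    then have "q\<^sup>2 * real (card E2) \<le> q\<^sup>2 * (\<Sum>x\<in>Q. real (codeg (fst x) (snd x)))"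
      by (intro mult_left_mono) auto
    also have "\<dots> = (\<Sum>x\<in>Q. q\<^sup>2 * real (codeg (fst x) (snd x)))" by (rule sum_distrib_left)
    also have "\<dots> \<le> (\<Sum>x\<in>Q. real (codeg (fst x) (snd x)) ^ 2)"
    proof (rule sum_mono)
      fix x assume "x \<in> Q"
      then have "q\<^sup>2 * real (codeg (fst x) (snd x)) \<le> real (codeg (fst x) (snd x)) * real (codeg (fst x) (snd x))"
        by (intro mult_right_mono) (auto simp: Q_def)
      then show "q\<^sup>2 * real (codeg (fst x) (snd x)) \<le> real (codeg (fst x) (snd x)) ^ 2"
        by (simp add: power2_eq_square)
    qed
    finally have \<Gamma>: "q\<^sup>2 * real (card E2) \<le> (\<Sum>(a, u)\<in>Q. real (codeg a u) ^ 2)" by (simp add: case_prod_beta)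
    show ?thesis
    proof (cases "B > 0")
      case True
      have "(c 2)\<^sup>2 * (q\<^sup>2 * real (card E2)) \<le> 4 * (2 ^ k * C) * k * (2 * B * q) * \<tau>"
        using order_trans[OF mult_left_mono[OF \<Gamma>] bound[OF True]] c2' by simp
      also have "\<dots> = (c 2)\<^sup>2 * (k * B * q * B)"
        unfolding B_def b using c2' by (simp add: field_simps)
      finally have "q\<^sup>2 * real (card E2) \<le> k * B * q * B" using c2' by simp
      then have "q * (real (card E2) * q) \<le> q * (k * B\<^sup>2)" by (simp add: power2_eq_square algebra_simps)
      then show ?thesis using q0 by simp
    next
      case False
      then have "real (card H) * q \<le> 0" using cH B0 by simp
      then have "card H = 0" using q0 by (simp add: mult_le_0_iff)
      then have "Q = {}" using HV Q by auto
      then have "E2 = {}" unfolding E2_def by auto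
      then show ?thesis by simp
    qed
  qed

  define F where "F = E - E1 - E2"
  have FE: "F \<subseteq> E" unfolding F_def by auto
  have E12: "E1 \<subseteq> E" "E2 \<subseteq> E" unfolding E1_def E2_def by auto
  have Fcard: "q ^ 9 \<le> 2 * real (card F)"
  proof -
    have "card E \<le> card F + card E1 + card E2"
    proof -
      have "E \<subseteq> F \<union> E1 \<union> E2" unfolding F_def by auto
      then have "card E \<le> card (F \<union> E1 \<union> E2)" using finE E12 FE finite_subset by (intro card_mono) auto
      also have "\<dots> \<le> card F + card E1 + card E2" using card_Un_le[of "F \<union> E1" E2] card_Un_le[of F E1] by linarith
      finally show ?thesis .
    qed
    then have m: "q ^ 9 \<le> real (card F) + real (card E1) + real (card E2)" using q(2) by linarith
    have "2 * ((real (card E1) + real (card E2)) * q) \<le> q ^ 10"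
      using E1 E2 \<tau>(2) unfolding B_def by (simp add: algebra_simps)
    moreover have "q ^ 10 = q ^ 9 * q" by (simp add: power_Suc2[symmetric])
    ultimately have "2 * (real (card E1) + real (card E2)) * q \<le> q ^ 9 * q" by (simp only: mult.assoc)
    then have half: "2 * (real (card E1) + real (card E2)) \<le> q ^ 9" using q0 by simp
    then show ?thesis using m unfolding distrib_left by linarith
  qed
  have qq: "q \<le> q\<^sup>2" using q by (simp add: power2_eq_square)
  have LL: "real (codeg u v) \<le> q\<^sup>2" if "u \<in> L" "v \<in> L" "u \<noteq> v" for u v
  proof -
    have "real (codeg u v) \<le> q" using z[of u v] that zL[of u] zL[of v] LV by fastforce
    then show ?thesis using qq by linarith
  qed
  have FF: "real (codeg u v) \<le> q\<^sup>2" if f: "f \<in> F" "u \<in> f" "v \<in> f" "u \<noteq> v" for f u v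
  proof -
    have fE: "f \<in> E" "f \<notin> E1" "f \<notin> E2" using f unfolding F_def by auto
    have uv: "u \<in> H \<or> u \<in> L" "v \<in> H \<or> v \<in> L" using edge_V[OF fE(1)] f unfolding L_def by auto
    have mix: "real (codeg a w) \<le> q\<^sup>2" if "a \<in> H" "w \<in> L" "a \<in> f" "w \<in> f" for a w
    proof (rule ccontr)
      assume "\<not> ?thesis"
      then have "(a, w) \<in> Q" using that unfolding Q_def by auto
      then show False using fE that unfolding E2_def by force
    qed
    have "\<not> (u \<in> H \<and> v \<in> H)" using fE f unfolding E1_def by auto
    then show ?thesis using uv LL[of u v] mix[of u v] mix[of v u] f codeg_sym[of u v] by auto
  qed
  have FL: "f \<inter> L \<noteq> {}" if f: "f \<in> F" for f
  proof
    assume "f \<inter> L = {}"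
    have fE: "f \<in> E" "f \<notin> E1" using f unfolding F_def by auto
    then have "f \<subseteq> H" using \<open>f \<inter> L = {}\<close> edge_V[OF fE(1)] unfolding L_def by auto
    moreover have "2 \<le> card f" using card_edge[OF fE(1)] k3 by simp
    then obtain T where "T \<subseteq> f" "card T = 2" by (rule obtain_subset_with_card_n)
    ultimately have "f \<in> E1" unfolding E1_def using fE by (auto simp: card_2_iff)
    then show False using fE by simp
  qed
  show thesis
    by (rule that[of L F]) (use LV FE Fcard Ldeg D6 LL FF FL in \<open>auto intro: order_trans\<close>)
qed

text \<open>Substituting D = q^6, \<open>\<theta>\<close> = q^2 and \<open>\<eta>\<close> =
  \<open>\<epsilon>\<close> / q^4 gives x = \<open>\<epsilon>\<close>^2 2^k / q^2. The exceptional
  term carries q^9 from the edges, q^9 from the vertices of Y and q^(2 k) from the crude bound,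
  while x^h supplies q^(-2 h); this is the origin of k + 9 \<le> h.\<close>

lemma bound_parameters:
  fixes q \<tau> b \<epsilon> \<kappa> :: real and h l :: nat
  assumes ub: "\<And>s. (\<And>v. \<bar>s v\<bar> \<le> 1) \<Longrightarrow> edge_poly c E s \<le> \<tau>"
    and q: "1 \<le> q" "q ^ 9 = real (card E)" and b: "b = 8 * (2 ^ k * C) / (c 2)\<^sup>2"
    and \<tau>: "2 * b * \<tau> \<le> q ^ 5" "2 * (k + 2) * (b * \<tau>)\<^sup>2 \<le> q ^ 10"
    and l: "3 \<le> l" "l \<le> k" and \<epsilon>: "0 < \<epsilon>" "\<epsilon> \<le> 1" and h: "k + 9 \<le> h" and \<kappa>: "0 \<le> \<kappa>"
    and m4: "\<And>f. lowdeg V k f \<Longrightarrow> avg V (\<lambda>X. f X ^ 4) \<le> \<kappa> * (avg V (\<lambda>X. (f X)\<^sup>2))\<^sup>2"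
    and mh: "\<And>f. lowdeg V k f \<Longrightarrow> avg V (\<lambda>X. f X ^ (2 * h)) \<le> \<kappa> * (avg V (\<lambda>X. (f X)\<^sup>2)) ^ h"
  shows "\<epsilon> * \<bar>c l\<bar> / (3 * 2 ^ k) * q ^ 5 \<le> \<tau> + \<epsilon>\<^sup>2 * (4 / 3 * C * 8 ^ k * 2 * real k ^ 4
     + 2 ^ k * (2 ^ k * C * (real k * \<kappa> * (4 ^ k + 2 ^ (k * h))))
     + 2 ^ k * C * 2 ^ (Suc k * k) * (real k * 2 ^ (2 * h) * \<kappa> * 2 ^ (k * h))) * q ^ 5"
proof -
  obtain L F where LF: "L \<subseteq> V" "F \<subseteq> E" "q ^ 9 \<le> 2 * real (card F)"
    "\<And>u. u \<in> L \<Longrightarrow> real (deg u) \<le> q ^ 6"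
    "\<And>u v. u \<in> L \<Longrightarrow> v \<in> L \<Longrightarrow> u \<noteq> v \<Longrightarrow> real (codeg u v) \<le> q\<^sup>2"
    "\<And>f u v. f \<in> F \<Longrightarrow> u \<in> f \<Longrightarrow> v \<in> f \<Longrightarrow> u \<noteq> v \<Longrightarrow> real (codeg u v) \<le> q\<^sup>2"
    "\<And>f. f \<in> F \<Longrightarrow> f \<inter> L \<noteq> {}"
  proof (rule structure_of_edges[of \<tau> q b, OF _ q b \<tau>])
    fix s :: "'a \<Rightarrow> real" assume "\<And>v. \<bar>s v\<bar> \<le> 1"
    then show "edge_poly c E s \<le> \<tau>" by (rule ub)
  qed (rule that, assumption+)
  have fin: "finite L" "finite F" using finite_subset[OF LF(1) finV] finite_subset[OF LF(2) finE] by auto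
  have "finite e \<and> card e = k \<and> e \<inter> L \<noteq> {}" if "e \<in> F" for e
    using LF(2) LF(7)[OF that] fin_edge card_edge that by auto
  then obtain Y where Y: "Y \<subseteq> L" "card F \<le> 2 ^ k * card {e \<in> F. card (e \<inter> Y) = 1}"
    using exists_single_intersections[OF fin, of k] by auto
  define F' where "F' = {e \<in> F. card (e \<inter> Y) = 1}"
  have YV: "Y \<subseteq> V" using Y LF by auto
  have q0: "0 < q" using q by simp
  define \<eta> where "\<eta> = \<epsilon> / q ^ 4"
  define x where "x = \<eta>\<^sup>2 * (2 ^ k * q ^ 6)"
  have \<eta>: "0 < \<eta>" unfolding \<eta>_def using \<epsilon> q0 by simp
  \<comment> \<open>An upper bound on all doubled answers: an answer is at most
    \<open>\<eta>\<close> 2^k q^6, and \<open>\<epsilon>\<close> \<le> 1 is used.\<close>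
  define G where "G = 2 ^ Suc k * q\<^sup>2"
  have G: "1 \<le> G" "2 * \<eta> * (2 ^ k * q ^ 6) \<le> G"
  proof -
    have "1 * 1 \<le> 2 ^ Suc k * q\<^sup>2" using q by (intro mult_mono one_le_power) auto
    then show "1 \<le> G" unfolding G_def by simp
    have q6: "q ^ 6 = q\<^sup>2 * q ^ 4" by (simp add: power_add[symmetric])
    have "2 * \<eta> * (2 ^ k * q ^ 6) = 2 * 2 ^ k * (\<epsilon> * q\<^sup>2) * (q ^ 4 / q ^ 4)"
      unfolding \<eta>_def q6 by (simp only: times_divide_eq_left times_divide_eq_right mult_ac)
    also have "\<dots> = \<epsilon> * G" unfolding G_def using q0 by simp
    finally have "2 * \<eta> * (2 ^ k * q ^ 6) = \<epsilon> * G" .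
    also have "\<dots> \<le> 1 * G" using \<epsilon> \<open>1 \<le> G\<close> by (intro mult_right_mono) auto
    finally show "2 * \<eta> * (2 ^ k * q ^ 6) \<le> G" by simp
  qed
  have "2 / 3 * \<eta> * \<bar>c l\<bar> * real (card F') \<le> \<tau>
    + 4 / 3 * C * \<eta>\<^sup>2 * (8 ^ k * (2 * real (card E) * real k ^ 4 * (q\<^sup>2)\<^sup>2))
    + real (card E) * (2 ^ k * (2 ^ k * C * (real k * (\<kappa> * (x\<^sup>2 + x ^ h)))))
    + real (card E) * (2 ^ k * C * G ^ k) * (real (card Y) * (2 ^ (2 * h) * (\<kappa> * x ^ h)))"
    unfolding x_def
  proof (rule pseudorandom_bound[OF _ l YV])
    fix s :: "'a \<Rightarrow> real" assume "\<And>v. \<bar>s v\<bar> \<le> 1"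
    then show "edge_poly c E s \<le> \<tau>" by (rule ub)
  next
    show "F' \<subseteq> E" and "\<And>f. f \<in> F' \<Longrightarrow> card (f \<inter> Y) = 1" unfolding F'_def using LF(2) by auto
    show "real (codeg u v) \<le> q\<^sup>2" if "f \<in> F'" "u \<in> f" "v \<in> f" "u \<noteq> v" for f u v
      using LF(6)[of f u v] that unfolding F'_def by auto
    show "real (codeg u v) \<le> q\<^sup>2" if "u \<in> Y" "v \<in> Y" "u \<noteq> v" for u v using LF(5) that Y(1) by auto
    show "real (deg u) \<le> q ^ 6" if "u \<in> Y" for u using LF(4) that Y(1) by auto
    show "avg V (\<lambda>X. f X ^ 4) \<le> \<kappa> * (avg V (\<lambda>X. (f X)\<^sup>2))\<^sup>2" if "lowdeg V k f" for f using m4 that .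
    show "avg V (\<lambda>X. f X ^ (2 * h)) \<le> \<kappa> * avg V (\<lambda>X. (f X)\<^sup>2) ^ h" if "lowdeg V k f" for f using mh that .
  qed (use \<eta> G \<kappa> h q0 in auto)
  then have main: "2 / 3 * \<eta> * \<bar>c l\<bar> * real (card F') \<le> \<tau>
    + 4 / 3 * C * \<eta>\<^sup>2 * (8 ^ k * (2 * q ^ 9 * real k ^ 4 * (q\<^sup>2)\<^sup>2))
    + q ^ 9 * (2 ^ k * (2 ^ k * C * (real k * (\<kappa> * (x\<^sup>2 + x ^ h)))))
    + q ^ 9 * (2 ^ k * C * G ^ k) * (real (card Y) * (2 ^ (2 * h) * (\<kappa> * x ^ h)))"
    unfolding q(2) .
  have "\<epsilon> * \<bar>c l\<bar> / (3 * 2 ^ k) * q ^ 5 = 2 / 3 * \<eta> * \<bar>c l\<bar> * (q ^ 9 / (2 * 2 ^ k))"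
    unfolding \<eta>_def using q0 by (simp add: field_simps power_add[symmetric])
  also have "\<dots> \<le> 2 / 3 * \<eta> * \<bar>c l\<bar> * real (card F')"
  proof (rule mult_left_mono)
    have "real (card F) \<le> real (2 ^ k * card F')" using Y(2) unfolding F'_def by (simp only: of_nat_le_iff)
    then have "q ^ 9 \<le> 2 * (2 ^ k * real (card F'))" using LF(3) by simp
    then show "q ^ 9 / (2 * 2 ^ k) \<le> real (card F')" by (simp add: field_simps)
  qed (use \<eta> in auto)
  also note main
  finally have main': "\<epsilon> * \<bar>c l\<bar> / (3 * 2 ^ k) * q ^ 5 \<le> \<tau>
    + 4 / 3 * C * \<eta>\<^sup>2 * (8 ^ k * (2 * q ^ 9 * real k ^ 4 * (q\<^sup>2)\<^sup>2))
    + q ^ 9 * (2 ^ k * (2 ^ k * C * (real k * (\<kappa> * (x\<^sup>2 + x ^ h)))))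
    + q ^ 9 * (2 ^ k * C * G ^ k) * (real (card Y) * (2 ^ (2 * h) * (\<kappa> * x ^ h)))" .
  have t2: "4 / 3 * C * \<eta>\<^sup>2 * (8 ^ k * (2 * q ^ 9 * real k ^ 4 * (q\<^sup>2)\<^sup>2))
     = \<epsilon>\<^sup>2 * (4 / 3 * C * 8 ^ k * 2 * real k ^ 4) * q ^ 5"
  proof -
    have "\<eta>\<^sup>2 * (q ^ 9 * (q\<^sup>2)\<^sup>2) = \<epsilon>\<^sup>2 * q ^ 5"
      unfolding \<eta>_def using q0 by (simp add: field_simps power_add[symmetric] power_mult[symmetric])
    then show ?thesis by (simp add: algebra_simps)
  qed
  have xq: "x = \<epsilon>\<^sup>2 * 2 ^ k / q\<^sup>2"
    unfolding x_def \<eta>_def using q0 by (simp add: field_simps power_add[symmetric] power_mult[symmetric])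
  have x0: "0 \<le> x" unfolding xq by simp
  \<comment> \<open>All higher powers of \<open>\<epsilon>\<close> are absorbed into
    \<open>\<epsilon>\<close>^2, so that a single quadratic loss remains against the linear
    gain.\<close>
  have e2: "(\<epsilon>\<^sup>2) ^ i \<le> \<epsilon>\<^sup>2" if "1 \<le> i" for i
    using power_decreasing[of 1 i "\<epsilon>\<^sup>2"] that \<epsilon> by (simp add: power_le_one)
  have xx: "q ^ 9 * x\<^sup>2 \<le> \<epsilon>\<^sup>2 * 4 ^ k * q ^ 5"
  proof -
    have "q ^ 9 * x\<^sup>2 = (\<epsilon>\<^sup>2)\<^sup>2 * 4 ^ k * q ^ 5"
    proof -
      have "((2::real) ^ k)\<^sup>2 = 4 ^ k" by (simp add: power2_eq_square power_mult_distrib[symmetric])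
      then show ?thesis unfolding xq using q0
        by (simp add: field_simps power_add[symmetric] power_mult[symmetric])
    qed
    also have "\<dots> \<le> \<epsilon>\<^sup>2 * 4 ^ k * q ^ 5" using e2[of 2] q0 by (intro mult_right_mono) auto
    finally show ?thesis .
  qed
  have xh: "q ^ (2 * h) * x ^ h \<le> \<epsilon>\<^sup>2 * 2 ^ (k * h)"
  proof -
    have "q ^ (2 * h) * x ^ h = (\<epsilon>\<^sup>2) ^ h * 2 ^ (k * h)"
      unfolding xq using q0 by (simp add: power_divide power_mult power_mult_distrib)
    also have "\<dots> \<le> \<epsilon>\<^sup>2 * 2 ^ (k * h)" using e2[of h] h by (intro mult_right_mono) auto
    finally show ?thesis .
  qed
  have xh': "q ^ i * x ^ h \<le> \<epsilon>\<^sup>2 * 2 ^ (k * h)" if "i \<le> 2 * h" for i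
  proof -
    have "q ^ i * x ^ h \<le> q ^ (2 * h) * x ^ h"
      using that q x0 by (intro mult_right_mono power_increasing) auto
    then show ?thesis using xh by linarith
  qed
  have q5: "1 \<le> q ^ 5" using q by simp
  have bd: "\<epsilon>\<^sup>2 * 2 ^ (k * h) \<le> \<epsilon>\<^sup>2 * 2 ^ (k * h) * q ^ 5"
    using mult_left_mono[OF q5, of "\<epsilon>\<^sup>2 * 2 ^ (k * h)"] by simp
  have t3: "q ^ 9 * (2 ^ k * (2 ^ k * C * (real k * (\<kappa> * (x\<^sup>2 + x ^ h)))))
     \<le> \<epsilon>\<^sup>2 * (2 ^ k * (2 ^ k * C * (real k * \<kappa> * (4 ^ k + 2 ^ (k * h))))) * q ^ 5"
  proof -
    have "q ^ 9 * x\<^sup>2 + q ^ 9 * x ^ h \<le> \<epsilon>\<^sup>2 * 4 ^ k * q ^ 5 + \<epsilon>\<^sup>2 * 2 ^ (k * h) * q ^ 5"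
      using xx xh'[of 9] bd h by (intro add_mono) auto
    then have "(2 ^ k * (2 ^ k * C * (real k * \<kappa>))) * (q ^ 9 * x\<^sup>2 + q ^ 9 * x ^ h)
      \<le> (2 ^ k * (2 ^ k * C * (real k * \<kappa>))) * (\<epsilon>\<^sup>2 * 4 ^ k * q ^ 5 + \<epsilon>\<^sup>2 * 2 ^ (k * h) * q ^ 5)"
      using C_pos \<kappa> by (intro mult_left_mono) auto
    then show ?thesis by (simp add: algebra_simps)
  qed
  have t4: "q ^ 9 * (2 ^ k * C * G ^ k) * (real (card Y) * (2 ^ (2 * h) * (\<kappa> * x ^ h)))
     \<le> \<epsilon>\<^sup>2 * (2 ^ k * C * 2 ^ (Suc k * k) * (real k * 2 ^ (2 * h) * \<kappa> * 2 ^ (k * h))) * q ^ 5"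
  proof -
    have "card Y \<le> k * card E" using card_mono[OF finV YV] card_V_le by simp
    then have "real (card Y) \<le> real (k * card E)" by (simp only: of_nat_le_iff)
    then have cY: "real (card Y) \<le> real k * q ^ 9" using q(2) by simp
    have Gk: "G ^ k = 2 ^ (Suc k * k) * q ^ (2 * k)" unfolding G_def power_mult_distrib power_mult ..
    have "q ^ 9 * (2 ^ k * C * G ^ k) * (real (card Y) * (2 ^ (2 * h) * (\<kappa> * x ^ h)))
      \<le> q ^ 9 * (2 ^ k * C * G ^ k) * (real k * q ^ 9 * (2 ^ (2 * h) * (\<kappa> * x ^ h)))"
      using cY C_pos \<kappa> x0 G q0 by (intro mult_left_mono mult_right_mono) auto
    also have "\<dots> = (2 ^ k * C * 2 ^ (Suc k * k) * (real k * 2 ^ (2 * h) * \<kappa>)) * (q ^ (18 + 2 * k) * x ^ h)"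
    proof -
      have "q ^ (18 + 2 * k) = q ^ 9 * q ^ 9 * q ^ (2 * k)" by (simp add: power_add[symmetric])
      then show ?thesis unfolding Gk by (simp add: algebra_simps)
    qed
    also have "\<dots> \<le> (2 ^ k * C * 2 ^ (Suc k * k) * (real k * 2 ^ (2 * h) * \<kappa>)) * (\<epsilon>\<^sup>2 * 2 ^ (k * h) * q ^ 5)"
      using order_trans[OF xh'[of "18 + 2 * k"] bd] C_pos \<kappa> h by (intro mult_left_mono) auto
    finally show ?thesis by (simp add: algebra_simps)
  qed
  have distr: "e * (u + v + w) * z = e * u * z + e * v * z + e * w * z" for e u v w z :: real
    by (simp add: algebra_simps)
  show ?thesis unfolding distr using main' t2 t3 t4 by linarith
qed

end

section \<open>The final constants and the contradiction\<close>

lemma exists_edge_poly_large: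
  fixes c :: "nat \<Rightarrow> real"
  assumes k: "3 \<le> k" and c2: "c 2 < 0" and l: "3 \<le> l" "l \<le> k" and cl: "c l \<noteq> 0"
  shows "\<exists>\<delta>>0. \<forall>E::'a set set. finite E \<longrightarrow> (\<forall>e\<in>E. card e = k) \<longrightarrow>
    (\<exists>s. (\<forall>v. \<bar>s v\<bar> \<le> 1) \<and> \<delta> * real (card E) powr (5 / 9) \<le> edge_poly c E s)"
proof -
  define C where "C = (\<Sum>j\<le>k. \<bar>c j\<bar>)"
  have cC: "\<bar>c j\<bar> \<le> C" if "j \<le> k" for j
    unfolding C_def using that by (intro member_le_sum) auto
  have C0: "0 < C" using cC[of 2] c2 k by linarith
  \<comment> \<open>A power of two, as \<open>moment_bound\<close> provides only such moments, and
    large enough for k + 9 \<le> h.\<close>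
  define h :: nat where "h = 2 ^ (k + 4)"
  have h: "k + 9 \<le> h"
  proof -
    have "k < 2 ^ k" by (rule less_exp)
    then have "Suc k \<le> 2 ^ k" by (rule Suc_leI)
    moreover have "h = 16 * 2 ^ k" unfolding h_def by (simp add: power_add)
    ultimately show ?thesis by simp
  qed
  obtain \<kappa>1 where \<kappa>1: "\<kappa>1 \<ge> 1" "\<And>(R::'a set) f. finite R \<Longrightarrow> lowdeg R k f \<Longrightarrow>
     avg R (\<lambda>X. f X ^ (2 ^ Suc 1)) \<le> \<kappa>1 * (avg R (\<lambda>X. (f X)\<^sup>2)) ^ (2 ^ 1)"
    using moment_bound[of k 1] by blast
  obtain \<kappa>2 where \<kappa>2: "\<kappa>2 \<ge> 1" "\<And>(R::'a set) f. finite R \<Longrightarrow> lowdeg R k f \<Longrightarrow>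
     avg R (\<lambda>X. f X ^ (2 ^ Suc (k + 4))) \<le> \<kappa>2 * (avg R (\<lambda>X. (f X)\<^sup>2)) ^ (2 ^ (k + 4))"
    using moment_bound[of k "k + 4"] by blast
  define \<kappa> where "\<kappa> = max \<kappa>1 \<kappa>2"
  have \<kappa>0: "0 \<le> \<kappa>" unfolding \<kappa>_def using \<kappa>1 by auto
  have m4: "avg R (\<lambda>X. f X ^ 4) \<le> \<kappa> * (avg R (\<lambda>X. (f X)\<^sup>2))\<^sup>2" if "finite R" "lowdeg R k f" for R :: "'a set" and f
  proof -
    have "avg R (\<lambda>X. f X ^ 4) \<le> \<kappa>1 * (avg R (\<lambda>X. (f X)\<^sup>2))\<^sup>2" using \<kappa>1(2)[OF that] by simp
    also have "\<dots> \<le> \<kappa> * (avg R (\<lambda>X. (f X)\<^sup>2))\<^sup>2" by (intro mult_right_mono) (auto simp: \<kappa>_def)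
    finally show ?thesis .
  qed
  have mh: "avg R (\<lambda>X. f X ^ (2 * h)) \<le> \<kappa> * (avg R (\<lambda>X. (f X)\<^sup>2)) ^ h" if "finite R" "lowdeg R k f" for R :: "'a set" and f
  proof -
    have "avg R (\<lambda>X. f X ^ (2 * h)) \<le> \<kappa>2 * (avg R (\<lambda>X. (f X)\<^sup>2)) ^ h"
      using \<kappa>2(2)[OF that] unfolding h_def power_Suc[of 2 "k + 4"] .
    also have "\<dots> \<le> \<kappa> * (avg R (\<lambda>X. (f X)\<^sup>2)) ^ h"
      by (intro mult_right_mono zero_le_power[OF avg_nonneg]) (auto simp: \<kappa>_def)
    finally show ?thesis .
  qed
  define b where "b = 8 * (2 ^ k * C) / (c 2)\<^sup>2"
  have b: "0 < b" unfolding b_def using C0 c2 by simp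
  define K where "K = 4 / 3 * C * 8 ^ k * 2 * real k ^ 4
     + 2 ^ k * (2 ^ k * C * (real k * \<kappa> * (4 ^ k + 2 ^ (k * h))))
     + 2 ^ k * C * 2 ^ (Suc k * k) * (real k * 2 ^ (2 * h) * \<kappa> * 2 ^ (k * h))"
  have K: "0 < K"
  proof -
    have "0 < 4 / 3 * C * 8 ^ k * 2 * real k ^ 4" using C0 k by simp
    moreover have "0 \<le> 2 ^ k * (2 ^ k * C * (real k * \<kappa> * (4 ^ k + 2 ^ (k * h))))" using C0 \<kappa>0 by simp
    moreover have "0 \<le> 2 ^ k * C * 2 ^ (Suc k * k) * (real k * 2 ^ (2 * h) * \<kappa> * 2 ^ (k * h))"
      using C0 \<kappa>0 by simp
    ultimately show ?thesis unfolding K_def by linarith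
  qed
  define a where "a = \<bar>c l\<bar> / (3 * 2 ^ k)"
  have a: "0 < a" unfolding a_def using cl by simp
  \<comment> \<open>The gain is \<open>\<epsilon>\<close> a and the loss \<open>\<epsilon>\<close>^2
    K; this choice keeps the loss at most half the gain.\<close>
  define \<epsilon> where "\<epsilon> = min 1 (a / (2 * K))"
  have \<epsilon>: "0 < \<epsilon>" "\<epsilon> \<le> 1" unfolding \<epsilon>_def using a K by auto
  have \<epsilon>K: "\<epsilon> * K \<le> a / 2"
  proof -
    have "\<epsilon> * K \<le> a / (2 * K) * K" unfolding \<epsilon>_def using K by (intro mult_right_mono) auto
    then show ?thesis using K by simp
  qed
  \<comment> \<open>The first bound leaves \<open>\<tau>\<close> at a quarter of the gain, so
    together with the loss at most three quarters are accounted for. The second bound yields the two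
    conditions on \<open>\<tau>\<close> under which \<open>structure_of_edges\<close> works.\<close>
  define \<delta> where "\<delta> = min (\<epsilon> * a / 4) (1 / (2 * b * (real k + 2)))"
  have \<delta>: "0 < \<delta>" unfolding \<delta>_def using \<epsilon> a b by auto
  have \<delta>b: "2 * b * \<delta> * (real k + 2) \<le> 1"
  proof -
    have bk: "0 < 2 * b * (real k + 2)" using b by simp
    have "\<delta> \<le> 1 / (2 * b * (real k + 2))" unfolding \<delta>_def by simp
    then have "\<delta> * (2 * b * (real k + 2)) \<le> 1" using pos_le_divide_eq[OF bk] by blast
    then show ?thesis by (simp add: mult_ac)
  qed
  show ?thesis
  proof (intro exI[of _ \<delta>] conjI allI impI \<delta>, rule ccontr)
    fix E :: "'a set set" assume E: "finite E" "\<forall>e\<in>E. card e = k"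
    interpret uniform_poly k c E C
      by unfold_locales (use E k c2 cC in auto)
    assume contra: "\<not> (\<exists>s. (\<forall>v. \<bar>s v\<bar> \<le> 1) \<and> \<delta> * real (card E) powr (5 / 9) \<le> edge_poly c E s)"
    define q where "q = real (card E) powr (1 / 9)"
    \<comment> \<open>Without edges the target is 0, because 0 powr a = 0, and the zero bias attains
      it. Otherwise q \<ge> 1, as all later comparisons of powers require.\<close>
    have "card E \<noteq> 0"
    proof
      assume "card E = 0"
      then have "\<delta> * real (card E) powr (5 / 9) \<le> edge_poly c E (\<lambda>_. 0)" using edge_poly_zero by simp
      then show False using contra by (metis abs_zero zero_le_one)
    qed
    then have m1: "1 \<le> real (card E)" by simp
    then have q1: "1 \<le> q" unfolding q_def by (simp add: ge_one_powr_ge_zero)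
    have q9: "q ^ 9 = real (card E)" and q5: "real (card E) powr (5 / 9) = q ^ 5"
      unfolding q_def using m1 by (simp_all add: powr_realpow[symmetric] powr_powr)
    define \<tau> where "\<tau> = \<delta> * q ^ 5"
    have ub: "edge_poly c E s \<le> \<tau>" if "\<And>v. \<bar>s v\<bar> \<le> 1" for s
      using contra that unfolding \<tau>_def q5 by (meson linear)
    have q50: "0 < q ^ 5" using q1 by simp
    have b\<tau>0: "0 \<le> 2 * (b * \<tau>)" unfolding \<tau>_def using b \<delta> q50 by simp
    have b\<tau>: "2 * (b * \<tau>) * (real k + 2) \<le> q ^ 5"
      using mult_right_mono[OF \<delta>b less_imp_le[OF q50]] unfolding \<tau>_def by (simp add: algebra_simps)
    have t1: "2 * b * \<tau> \<le> q ^ 5"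
    proof -
      have "2 * (b * \<tau>) * 1 \<le> 2 * (b * \<tau>) * (real k + 2)" using b\<tau>0 by (intro mult_left_mono) auto
      then show ?thesis using b\<tau> by simp
    qed
    have t2: "2 * (k + 2) * (b * \<tau>)\<^sup>2 \<le> q ^ 10"
    proof -
      have "2 * (real k + 2) * (b * \<tau>)\<^sup>2 = (2 * (b * \<tau>) * (real k + 2)) * (b * \<tau>)"
        by (simp add: power2_eq_square)
      also have "\<dots> \<le> q ^ 5 * q ^ 5"
      proof (rule mult_mono[OF b\<tau>])
        show "0 \<le> b * \<tau>" using b\<tau>0 by linarith
        then show "b * \<tau> \<le> q ^ 5" using t1 unfolding mult.assoc by linarith
      qed (use q50 in auto)
      finally show ?thesis by (simp add: power_add[symmetric] algebra_simps)
    qed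
    have "\<epsilon> * \<bar>c l\<bar> / (3 * 2 ^ k) * q ^ 5 \<le> \<tau> + \<epsilon>\<^sup>2 * K * q ^ 5"
      unfolding K_def
      by (rule bound_parameters[OF ub q1 q9 b_def t1 t2 l \<epsilon> h \<kappa>0 m4[OF finV] mh[OF finV]])
    then have "(\<epsilon> * a) * q ^ 5 \<le> (\<delta> + \<epsilon>\<^sup>2 * K) * q ^ 5" unfolding a_def \<tau>_def by (simp add: algebra_simps)
    then have "\<epsilon> * a \<le> \<delta> + \<epsilon>\<^sup>2 * K" using q50 by simp
    moreover have "\<epsilon>\<^sup>2 * K \<le> \<epsilon> * (a / 2)"
      using mult_left_mono[OF \<epsilon>K, of \<epsilon>] \<epsilon> by (simp add: power2_eq_square mult.assoc)
    moreover have "\<delta> \<le> \<epsilon> * a / 4" unfolding \<delta>_def by simp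
    moreover have "0 < \<epsilon> * a" using \<epsilon> a by simp
    ultimately show False by simp
  qed
qed

theorem theorem1p2:
  fixes k r :: nat
  assumes "2 \<le> r" and "r \<le> k" and "r \<ge> 3 \<or> k \<ge> 4"
  shows "\<exists>c::real. c > 0 \<and>
    (\<forall>(V :: 'a set) (E :: 'a set set) (m :: nat).
       uniform_hypergraph k V E \<and> card E = m \<longrightarrow>
       (\<exists>P. is_cut r V P \<and> excess k r E P \<ge> c * real m powr (5 / 9)))"
proof -
  have "\<exists>l. 3 \<le> l \<and> l \<le> k \<and> bias_coeff k r l \<noteq> 0"
  proof (cases "r \<ge> 3")
    case True
    then show ?thesis using bias_coeff_3[of r k] assms by (intro exI[of _ 3]) auto
  next
    case False
    then have "r = 2" "k \<ge> 4" using assms by auto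
    then show ?thesis using bias_coeff_4[of k] by (intro exI[of _ 4]) auto
  qed
  then obtain l where l: "3 \<le> l" "l \<le> k" "bias_coeff k r l \<noteq> 0" by blast
  have "bias_coeff k r 2 < 0"
    using bias_coeff_2[of r k] assms by auto
  then obtain \<delta> where \<delta>: "\<delta> > 0" "\<And>E::'a set set. finite E \<Longrightarrow> \<forall>e\<in>E. card e = k \<Longrightarrow>
    \<exists>s. (\<forall>v. \<bar>s v\<bar> \<le> 1) \<and> \<delta> * real (card E) powr (5 / 9) \<le> edge_poly (bias_coeff k r) E s"
    using exists_edge_poly_large[of k "bias_coeff k r" l, where 'a = 'a] l assms by auto
  show ?thesis
  proof (intro exI[of _ \<delta>] conjI allI impI \<delta>(1))
    fix V :: "'a set" and E :: "'a set set" and m :: nat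
    assume H: "uniform_hypergraph k V E \<and> card E = m"
    then have "finite E" "\<forall>e\<in>E. card e = k"
      unfolding uniform_hypergraph_def by (auto intro: finite_subset[of E "Pow V"])
    then obtain s where s: "\<And>v. \<bar>s v\<bar> \<le> 1" "\<delta> * real (card E) powr (5 / 9) \<le> edge_poly (bias_coeff k r) E s"
      using \<delta>(2) by blast
    obtain P where "is_cut r V P" "excess k r E P \<ge> edge_poly (bias_coeff k r) E s"
      using exists_cut_excess_ge[of k V E r s] H assms s(1) by blast
    then show "\<exists>P. is_cut r V P \<and> excess k r E P \<ge> \<delta> * real m powr (5 / 9)"
      using s(2) H by force
  qed
qed

end
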